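(* Let $\mu$ be a stochastic measure on $\mathcal{B}([0,2\pi])$. Assume that there exists a real-valued finite measure $\mathsf{m}$ on $([0,2\pi],\mathcal{B}([0,2\pi]))$ with the following property: if a measurable function $g:[0,2\pi]\to\mathbb{R}$ is such that $\int_{[0,2\pi]}2^{\lambda|g|}\,d\mathsf{m}<+\infty$ for all real $\lambda>0$, then $g$ is integrable with respect to $\mu$ on $[0,2\pi]$. Assume also that the process $\mu(t)=\mu((0,t])$, $0\le t\le 2\pi$, has continuous paths. Define random variables $$\xi_0=2\mu((0,2\pi])-\frac1\pi\int_{(0,2\pi]}s\,d\mu(s),\qquad \xi_k=-\frac{1}{k\pi}\int_{(0,2\pi]}\sin ks\,d\mu(s),\qquad \eta_k=\frac{1}{k\pi}\int_{(0,2\pi]}(\cos ks-1)\,d\mu(s),\quad k\ge1,$$ and $$S_n(t)=\frac{\xi_0}{2}+\sum_{k=1}^n(\xi_k\cos kt+\eta_k\sin kt),\qquad t\in[0,2\pi],\ n\ge 1.$$ Then for any $t\in(0,2\pi)$, $S_n(t)\to\mu(t)$ in probability as $n\to\infty$, and $S_n(0)=S_n(2\pi)\to\mu(2\pi)/2$ in probability as $n\to\infty$.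
   Context: Let $(\Omega,\mathcal{F},\mathsf{P})$ be a complete probability space and $\mathsf{L}_0=\mathsf{L}_0(\Omega,\mathcal{F},\mathsf{P})$ the set of all real-valued random variables on it, with convergence in probability. For a measurable space $(\mathsf{X},\mathcal{B})$, a stochastic measure (SM) is a $\sigma$-additive mapping $\mu:\mathcal{B}\to\mathsf{L}_0$ (i.e. for pairwise disjoint $A_n\in\mathcal{B}$, $\mu(\bigcup_n A_n)=\sum_n\mu(A_n)$ with the series converging in probability). No moment existence or martingale property is assumed. $\mathcal{B}([0,2\pi])$ denotes the Borel $\sigma$-algebra. Integral of deterministic functions: for a simple measurable function $f=\sum_i c_i\mathbf{1}_{A_i}$ and $A\in\mathcal{B}$ set $\int_A f\,d\mu=\sum_i c_i\,\mu(A\cap A_i)$. A measurable $g:\mathsf{X}\to\mathbb{R}$ is integrable with respect to $\mu$ on $\mathsf{X}$ if there are simple functions $g_n\to g$ pointwise such that for every $A\in\mathcal{B}$ the sequence $\int_A g_n\,d\mu$ converges in probability; the limit is denoted $\int_A g\,d\mu$ (it does not depend on the choice of the sequence). Every bounded measurable function is integrable with respect to any SM. When the paths of $\mu(t)$ are Riemann integrable (in particular continuous), the variables above are the Fourier coefficients $\xi_k=\frac1\pi\int_{[0,2\pi]}\mu(s)\cos ks\,ds$ ($k\ge 0$) and $\eta_k=\frac1\pi\int_{[0,2\pi]}\mu(s)\sin ks\,ds$ ($k\ge1$) of the paths, by integration by parts. *)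

theory Defs
  imports "HOL-Probability.Probability"
begin

definition tendsto_in_prob ::
  "'a measure \<Rightarrow> (nat \<Rightarrow> 'a \<Rightarrow> real) \<Rightarrow> ('a \<Rightarrow> real) \<Rightarrow> bool" where
  "tendsto_in_prob M Y Z \<longleftrightarrow>
     (\<forall>e>0. (\<lambda>n. measure M {\<omega> \<in> space M. \<bar>Y n \<omega> - Z \<omega>\<bar> > e}) \<longlonglongrightarrow> 0)"

text \<open>Elements of \<open>L\<^sub>0\<close> are represented by measurable functions, so \<open>\<mu> A\<close> is a function on the
  sample space, and additivity holds almost surely only (limits in probability are unique only
  up to null sets). Only the space and the \<open>\<sigma>\<close>-algebra of \<open>X\<close> are used, never its measure.\<close>

definition stochastic_measure ::
  "'a measure \<Rightarrow> 'b measure \<Rightarrow> ('b set \<Rightarrow> 'a \<Rightarrow> real) \<Rightarrow> bool" where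
  "stochastic_measure M X \<mu> \<longleftrightarrow>
     (\<forall>A\<in>sets X. \<mu> A \<in> borel_measurable M) \<and>
     (\<forall>A::nat \<Rightarrow> 'b set. range A \<subseteq> sets X \<longrightarrow> disjoint_family A \<longrightarrow>
        tendsto_in_prob M (\<lambda>n \<omega>. \<Sum>i<n. \<mu> (A i) \<omega>) (\<mu> (\<Union>i. A i)))"

text \<open>As in the library's \<open>simple_integral\<close>, the canonical representation of a simple function
  by its level sets is used; other representations give the same variable almost surely.\<close>

definition sm_simple_integral ::
  "'b measure \<Rightarrow> ('b set \<Rightarrow> 'a \<Rightarrow> real) \<Rightarrow> 'b set \<Rightarrow> ('b \<Rightarrow> real) \<Rightarrow> 'a \<Rightarrow> real" where
  "sm_simple_integral X \<mu> A f =
     (\<lambda>\<omega>. \<Sum>c\<in>f ` space X. c * \<mu> (A \<inter> (f -` {c} \<inter> space X)) \<omega>)"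

definition sm_approx_seq ::
  "'a measure \<Rightarrow> 'b measure \<Rightarrow> ('b set \<Rightarrow> 'a \<Rightarrow> real) \<Rightarrow> ('b \<Rightarrow> real) \<Rightarrow> (nat \<Rightarrow> 'b \<Rightarrow> real) \<Rightarrow> bool"
  where
  "sm_approx_seq M X \<mu> g s \<longleftrightarrow>
     (\<forall>n. simple_function X (s n)) \<and>
     (\<forall>x\<in>space X. (\<lambda>n. s n x) \<longlonglongrightarrow> g x) \<and>
     (\<forall>A\<in>sets X. \<exists>J\<in>borel_measurable M.
        tendsto_in_prob M (\<lambda>n. sm_simple_integral X \<mu> A (s n)) J)"

definition sm_integrable ::
  "'a measure \<Rightarrow> 'b measure \<Rightarrow> ('b set \<Rightarrow> 'a \<Rightarrow> real) \<Rightarrow> ('b \<Rightarrow> real) \<Rightarrow> bool" where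
  "sm_integrable M X \<mu> g \<longleftrightarrow>
     g \<in> borel_measurable X \<and> (\<exists>s. sm_approx_seq M X \<mu> g s)"

definition has_sm_integral ::
  "'a measure \<Rightarrow> 'b measure \<Rightarrow> ('b set \<Rightarrow> 'a \<Rightarrow> real) \<Rightarrow> 'b set \<Rightarrow> ('b \<Rightarrow> real) \<Rightarrow> ('a \<Rightarrow> real) \<Rightarrow> bool"
  where
  "has_sm_integral M X \<mu> A g J \<longleftrightarrow>
     J \<in> borel_measurable M \<and>
     (\<exists>s. sm_approx_seq M X \<mu> g s \<and>
          tendsto_in_prob M (\<lambda>n. sm_simple_integral X \<mu> A (s n)) J)"

text \<open>The integral is determined up to almost sure equality; a representative is chosen. The value
  is meaningful only for \<open>g\<close> integrable with respect to \<open>\<mu>\<close> and \<open>A \<in> sets X\<close>.\<close>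

definition sm_integral ::
  "'a measure \<Rightarrow> 'b measure \<Rightarrow> ('b set \<Rightarrow> 'a \<Rightarrow> real) \<Rightarrow> 'b set \<Rightarrow> ('b \<Rightarrow> real) \<Rightarrow> 'a \<Rightarrow> real" where
  "sm_integral M X \<mu> A g = (SOME J. has_sm_integral M X \<mu> A g J)"

abbreviation borel_0_2pi :: "real measure" where
  "borel_0_2pi \<equiv> restrict_space borel {0..2 * pi}"

definition sm_xi :: "'a measure \<Rightarrow> (real set \<Rightarrow> 'a \<Rightarrow> real) \<Rightarrow> nat \<Rightarrow> 'a \<Rightarrow> real" where
  "sm_xi M \<mu> k = (\<lambda>\<omega>.
     if k = 0
     then 2 * \<mu> {0<..2 * pi} \<omega> - 1 / pi * sm_integral M borel_0_2pi \<mu> {0<..2 * pi} (\<lambda>s. s) \<omega>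
     else - (1 / (real k * pi)) *
            sm_integral M borel_0_2pi \<mu> {0<..2 * pi} (\<lambda>s. sin (real k * s)) \<omega>)"

definition sm_eta :: "'a measure \<Rightarrow> (real set \<Rightarrow> 'a \<Rightarrow> real) \<Rightarrow> nat \<Rightarrow> 'a \<Rightarrow> real" where
  "sm_eta M \<mu> k = (\<lambda>\<omega>.
     1 / (real k * pi) *
       sm_integral M borel_0_2pi \<mu> {0<..2 * pi} (\<lambda>s. cos (real k * s) - 1) \<omega>)"

definition sm_fourier_sum ::
  "'a measure \<Rightarrow> (real set \<Rightarrow> 'a \<Rightarrow> real) \<Rightarrow> nat \<Rightarrow> real \<Rightarrow> 'a \<Rightarrow> real" where
  "sm_fourier_sum M \<mu> n t = (\<lambda>\<omega>.
     sm_xi M \<mu> 0 \<omega> / 2 +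
     (\<Sum>k=1..n. sm_xi M \<mu> k \<omega> * cos (real k * t) + sm_eta M \<mu> k \<omega> * sin (real k * t)))"

end

theory Submission
  imports Defs
begin

text \<open>The Fourier coefficients are integrals against \<open>\<mu>\<close>, so the partial sum \<open>S\<^sub>n(t)\<close> is the integral over
  \<open>(0, 2\<pi>]\<close> of a deterministic kernel in \<open>s\<close>, namely \<open>1 - s / 2\<pi> + (\<sigma>\<^sub>n(t - s) - \<sigma>\<^sub>n(t)) / \<pi>\<close>, where
  \<open>\<sigma>\<^sub>n(x)\<close> is the \<open>n\<close>-th partial sum of the sawtooth series \<open>\<Sum> sin(kx) / k\<close>. The \<open>\<sigma>\<^sub>n\<close> are uniformly bounded
  and converge pointwise (\<open>sawtooth_sum_bound\<close>, \<open>sawtooth_sum_tendsto\<close>). For \<open>0 < t < 2\<pi>\<close> the kernels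
  therefore converge boundedly to the indicator of \<open>(0, t)\<close> plus half the indicator of \<open>{t}\<close>, and for
  \<open>t = 0\<close> to half the indicator of \<open>(0, 2\<pi>)\<close>. Continuity of the paths gives \<open>\<mu>({t}) = 0\<close>, so the
  integrals of the limits are the claimed random variables. What remains is a bounded convergence
  theorem for the integral with respect to \<open>\<mu>\<close> (\<open>bounded_convergence\<close>).

  The difficulty is that \<open>L\<^sub>0\<close> is not locally convex, so that the integral of a uniformly small function
  is not obviously small. Three facts make up for this.

  First, the range of \<open>\<mu>\<close> is bounded in probability (\<open>range_bounded_in_prob\<close>), a theorem of Talagrand
  and of Kalton, Peck and Roberts. If it were not, then for most of the \<open>\<omega>\<close> that see sets of arbitrarily
  large measure, a fine enough partition would have many cells of large measure (\<open>many_large_atoms\<close>).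
  A small random selection of the cells then has large measure with a probability that is bounded
  below, and hardly diminishes the unboundedness on the remaining cells (\<open>split_off_large_part\<close>).
  Iteration gives disjoint sets whose measures do not tend to \<open>0\<close>, contrary to
  \<open>\<sigma>\<close>-additivity.

  Second, bounds for the measures of sets carry over to the integrals of bounded functions
  (\<open>prob_bounded_combination_le\<close>): a combination of the measures of disjoint sets with coefficients
  in \<open>[0, 1]\<close> is the mean of the measure of a random union, and by Khintchine's inequality the
  fluctuation of the latter is controlled by the measures of the unions themselves.

  Third, the integral is defined through simple functions that need not be uniformly bounded. Nikodym's
  theorem (\<open>nikodym_continuity_from_above\<close>) shows that the indefinite integral is continuous from
  above nevertheless, so that the sets where the approximation is still bad can be neglected
  (\<open>prob_indefinite_integral_le\<close>). The same splitting into good and bad points, this time of the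
  convergence of the integrands, gives bounded convergence.\<close>

section \<open>Convergence in probability as convergence in a norm\<close>

definition L0_norm :: "'a measure \<Rightarrow> ('a \<Rightarrow> real) \<Rightarrow> real" where
  "L0_norm M Y = (\<integral>\<omega>. min 1 \<bar>Y \<omega>\<bar> \<partial>M)"

context prob_space
begin

lemma L0_integrable:
  fixes Y :: "'a \<Rightarrow> real"
  assumes [measurable]: "Y \<in> borel_measurable M"
  shows "integrable M (\<lambda>\<omega>. min 1 \<bar>Y \<omega>\<bar>)"
proof -
  have "AE \<omega> in M. norm (min 1 \<bar>Y \<omega>\<bar>) \<le> 1" by (intro AE_I2) (simp add: min_def)
  then show ?thesis by (rule integrable_const_bound) measurable
qed

lemma L0_norm_nonneg: "0 \<le> L0_norm M Y"
  unfolding L0_norm_def by (rule integral_nonneg_AE) auto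

lemma L0_norm_cong_AE:
  assumes "Y \<in> borel_measurable M" "Z \<in> borel_measurable M" "AE \<omega> in M. Y \<omega> = Z \<omega>"
  shows "L0_norm M Y = L0_norm M Z"
  unfolding L0_norm_def using assms by (intro integral_cong_AE) auto

lemma L0_norm_le_sum:
  assumes [measurable]: "Y \<in> borel_measurable M" "Z \<in> borel_measurable M" "W \<in> borel_measurable M"
    and AE: "AE \<omega> in M. \<bar>Y \<omega>\<bar> \<le> \<bar>Z \<omega>\<bar> + \<bar>W \<omega>\<bar>"
  shows "L0_norm M Y \<le> L0_norm M Z + L0_norm M W"
proof -
  have "L0_norm M Y \<le> (\<integral>\<omega>. min 1 \<bar>Z \<omega>\<bar> + min 1 \<bar>W \<omega>\<bar> \<partial>M)"
    unfolding L0_norm_def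
    by (rule integral_mono_AE) (use AE in \<open>auto intro!: L0_integrable Bochner_Integration.integrable_add\<close>)
  also have "\<dots> = L0_norm M Z + L0_norm M W"
    unfolding L0_norm_def by (rule Bochner_Integration.integral_add) (auto intro: L0_integrable)
  finally show ?thesis .
qed

lemma prob_le_L0_norm:
  assumes [measurable]: "Y \<in> borel_measurable M" and e: "0 < e" "e \<le> 1"
  shows "prob {\<omega> \<in> space M. \<bar>Y \<omega>\<bar> > e} \<le> L0_norm M Y / e"
proof -
  have "e * prob {\<omega> \<in> space M. \<bar>Y \<omega>\<bar> > e}
      = (\<integral>\<omega>. e * indicator {\<omega> \<in> space M. \<bar>Y \<omega>\<bar> > e} \<omega> \<partial>M)"
    by simp
  also have "\<dots> \<le> L0_norm M Y"
    unfolding L0_norm_def using e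
    by (intro integral_mono_AE L0_integrable integrable_mult_right integrable_real_indicator)
       (auto simp: indicator_def emeasure_eq_measure)
  finally show ?thesis using e by (simp add: field_simps)
qed

lemma L0_norm_le_prob:
  assumes [measurable]: "Y \<in> borel_measurable M" and e: "0 \<le> e"
  shows "L0_norm M Y \<le> e + prob {\<omega> \<in> space M. \<bar>Y \<omega>\<bar> > e}"
proof -
  have "L0_norm M Y \<le> (\<integral>\<omega>. e + indicator {\<omega> \<in> space M. \<bar>Y \<omega>\<bar> > e} \<omega> \<partial>M)"
    unfolding L0_norm_def using e
    by (intro integral_mono_AE L0_integrable Bochner_Integration.integrable_add integrable_const
          integrable_real_indicator) (auto simp: indicator_def emeasure_eq_measure)
  also have "\<dots> = e + prob {\<omega> \<in> space M. \<bar>Y \<omega>\<bar> > e}"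
    by (subst Bochner_Integration.integral_add) (auto simp: prob_space emeasure_eq_measure)
  finally show ?thesis .
qed

lemma prob_Un_le2:
  assumes [measurable]: "{\<omega>\<in>space M. P \<omega>} \<in> events" "{\<omega>\<in>space M. Q \<omega>} \<in> events"
    "{\<omega>\<in>space M. R \<omega>} \<in> events"
    and "AE \<omega> in M. P \<omega> \<longrightarrow> Q \<omega> \<or> R \<omega>"
  shows "prob {\<omega>\<in>space M. P \<omega>} \<le> prob {\<omega>\<in>space M. Q \<omega>} + prob {\<omega>\<in>space M. R \<omega>}"
proof -
  have "prob {\<omega>\<in>space M. P \<omega>} \<le> prob ({\<omega>\<in>space M. Q \<omega>} \<union> {\<omega>\<in>space M. R \<omega>})"
    by (rule finite_measure_mono_AE) (use assms(4) in auto)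
  also have "\<dots> \<le> prob {\<omega>\<in>space M. Q \<omega>} + prob {\<omega>\<in>space M. R \<omega>}"
    by (rule measure_Un_le) auto
  finally show ?thesis .
qed

lemma prob_mono_AE:
  assumes "{\<omega>\<in>space M. Q \<omega>} \<in> events" "AE \<omega> in M. P \<omega> \<longrightarrow> Q \<omega>"
  shows "prob {\<omega>\<in>space M. P \<omega>} \<le> prob {\<omega>\<in>space M. Q \<omega>}"
  by (rule finite_measure_mono_AE) (use assms in auto)

lemma tendsto_in_prob_iff_L0:
  assumes [measurable]: "\<And>n. Y n \<in> borel_measurable M" "Z \<in> borel_measurable M"
  shows "tendsto_in_prob M Y Z \<longleftrightarrow> (\<lambda>n. L0_norm M (\<lambda>\<omega>. Y n \<omega> - Z \<omega>)) \<longlonglongrightarrow> 0"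
proof
  assume lim: "tendsto_in_prob M Y Z"
  show "(\<lambda>n. L0_norm M (\<lambda>\<omega>. Y n \<omega> - Z \<omega>)) \<longlonglongrightarrow> 0"
  proof (rule LIMSEQ_I)
    fix e :: real assume e: "e > 0"
    then have "(\<lambda>n. prob {\<omega> \<in> space M. \<bar>Y n \<omega> - Z \<omega>\<bar> > e/2}) \<longlonglongrightarrow> 0"
      using lim unfolding tendsto_in_prob_def by (meson half_gt_zero)
    from LIMSEQ_D[OF this, of "e/2"] e obtain n0 where
      n0: "\<And>n. n \<ge> n0 \<Longrightarrow> prob {\<omega> \<in> space M. \<bar>Y n \<omega> - Z \<omega>\<bar> > e/2} < e/2"
      by auto
    have "norm (L0_norm M (\<lambda>\<omega>. Y n \<omega> - Z \<omega>) - 0) < e" if "n \<ge> n0" for n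
    proof -
      have "L0_norm M (\<lambda>\<omega>. Y n \<omega> - Z \<omega>) \<le> e/2 + prob {\<omega> \<in> space M. \<bar>Y n \<omega> - Z \<omega>\<bar> > e/2}"
        by (rule L0_norm_le_prob) (use e in auto)
      then show ?thesis using n0[OF that] L0_norm_nonneg[of "\<lambda>\<omega>. Y n \<omega> - Z \<omega>"] by simp
    qed
    then show "\<exists>n0. \<forall>n\<ge>n0. norm (L0_norm M (\<lambda>\<omega>. Y n \<omega> - Z \<omega>) - 0) < e" by blast
  qed
next
  assume lim: "(\<lambda>n. L0_norm M (\<lambda>\<omega>. Y n \<omega> - Z \<omega>)) \<longlonglongrightarrow> 0"
  show "tendsto_in_prob M Y Z"
    unfolding tendsto_in_prob_def
  proof (intro allI impI)
    fix e :: real assume e: "e > 0"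
    define e' where "e' = min e 1"
    have e': "0 < e'" "e' \<le> 1" "e' \<le> e" using e by (auto simp: e'_def)
    have "(\<lambda>n. L0_norm M (\<lambda>\<omega>. Y n \<omega> - Z \<omega>) / e') \<longlonglongrightarrow> 0 / e'"
      using e' by (intro tendsto_divide lim) auto
    then have lim': "(\<lambda>n. L0_norm M (\<lambda>\<omega>. Y n \<omega> - Z \<omega>) / e') \<longlonglongrightarrow> 0" by simp
    show "(\<lambda>n. prob {\<omega> \<in> space M. \<bar>Y n \<omega> - Z \<omega>\<bar> > e}) \<longlonglongrightarrow> 0"
    proof (rule tendsto_sandwich[OF _ _ tendsto_const lim'])
      show "\<forall>\<^sub>F n in sequentially. prob {\<omega> \<in> space M. \<bar>Y n \<omega> - Z \<omega>\<bar> > e}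
          \<le> L0_norm M (\<lambda>\<omega>. Y n \<omega> - Z \<omega>) / e'"
      proof (intro always_eventually allI)
        fix n
        have "prob {\<omega> \<in> space M. \<bar>Y n \<omega> - Z \<omega>\<bar> > e} \<le> prob {\<omega> \<in> space M. \<bar>Y n \<omega> - Z \<omega>\<bar> > e'}"
          by (rule finite_measure_mono) (use e' in auto)
        also have "\<dots> \<le> L0_norm M (\<lambda>\<omega>. Y n \<omega> - Z \<omega>) / e'"
          by (rule prob_le_L0_norm) (use e' in auto)
        finally show "prob {\<omega> \<in> space M. \<bar>Y n \<omega> - Z \<omega>\<bar> > e} \<le> L0_norm M (\<lambda>\<omega>. Y n \<omega> - Z \<omega>) / e'" .
      qed
    qed auto
  qed
qed

lemma L0_norm_eq_0_AE:
  assumes [measurable]: "Y \<in> borel_measurable M" and "L0_norm M Y = 0"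
  shows "AE \<omega> in M. Y \<omega> = 0"
proof -
  have "AE \<omega> in M. min 1 \<bar>Y \<omega>\<bar> = 0"
    using assms integral_nonneg_eq_0_iff_AE[OF L0_integrable[OF assms(1)]]
    unfolding L0_norm_def by auto
  then show ?thesis by eventually_elim (auto simp: min_def split: if_splits)
qed

lemma tendsto_in_prob_cong_AE:
  assumes [measurable]: "\<And>n. Y n \<in> borel_measurable M" "\<And>n. Y' n \<in> borel_measurable M"
    "Z \<in> borel_measurable M" "Z' \<in> borel_measurable M"
    and AE: "\<And>n. AE \<omega> in M. Y n \<omega> = Y' n \<omega>" "AE \<omega> in M. Z \<omega> = Z' \<omega>"
  shows "tendsto_in_prob M Y Z \<longleftrightarrow> tendsto_in_prob M Y' Z'"
proof -
  have "L0_norm M (\<lambda>\<omega>. Y n \<omega> - Z \<omega>) = L0_norm M (\<lambda>\<omega>. Y' n \<omega> - Z' \<omega>)" for n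
  proof (rule L0_norm_cong_AE)
    show "AE \<omega> in M. Y n \<omega> - Z \<omega> = Y' n \<omega> - Z' \<omega>"
      using AE(1)[of n] AE(2) by eventually_elim auto
  qed auto
  then show ?thesis by (simp add: tendsto_in_prob_iff_L0)
qed

lemma tendsto_in_prob_add:
  assumes [measurable]: "\<And>n. Y n \<in> borel_measurable M" "\<And>n. Y' n \<in> borel_measurable M"
    "Z \<in> borel_measurable M" "Z' \<in> borel_measurable M"
    and lim: "tendsto_in_prob M Y Z" "tendsto_in_prob M Y' Z'"
  shows "tendsto_in_prob M (\<lambda>n \<omega>. Y n \<omega> + Y' n \<omega>) (\<lambda>\<omega>. Z \<omega> + Z' \<omega>)"
proof -
  have "(\<lambda>n. L0_norm M (\<lambda>\<omega>. Y n \<omega> - Z \<omega>) + L0_norm M (\<lambda>\<omega>. Y' n \<omega> - Z' \<omega>)) \<longlonglongrightarrow> 0 + 0"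
    by (intro tendsto_add) (use lim in \<open>auto simp: tendsto_in_prob_iff_L0\<close>)
  then have lim': "(\<lambda>n. L0_norm M (\<lambda>\<omega>. Y n \<omega> - Z \<omega>) + L0_norm M (\<lambda>\<omega>. Y' n \<omega> - Z' \<omega>)) \<longlonglongrightarrow> 0"
    by simp
  have le: "L0_norm M (\<lambda>\<omega>. (Y n \<omega> + Y' n \<omega>) - (Z \<omega> + Z' \<omega>))
      \<le> L0_norm M (\<lambda>\<omega>. Y n \<omega> - Z \<omega>) + L0_norm M (\<lambda>\<omega>. Y' n \<omega> - Z' \<omega>)" for n
    by (rule L0_norm_le_sum) auto
  have "(\<lambda>n. L0_norm M (\<lambda>\<omega>. (Y n \<omega> + Y' n \<omega>) - (Z \<omega> + Z' \<omega>))) \<longlonglongrightarrow> 0"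
    by (rule tendsto_sandwich[OF _ _ tendsto_const lim'])
       (auto intro!: always_eventually allI L0_norm_nonneg le)
  then show ?thesis by (subst tendsto_in_prob_iff_L0) auto
qed

lemma tendsto_in_prob_cmult:
  assumes lim: "tendsto_in_prob M Y Z"
  shows "tendsto_in_prob M (\<lambda>n \<omega>. c * Y n \<omega>) (\<lambda>\<omega>. c * Z \<omega>)"
proof (cases "c = 0")
  case True
  then show ?thesis by (simp add: tendsto_in_prob_def)
next
  case False
  show ?thesis unfolding tendsto_in_prob_def
  proof (intro allI impI)
    fix e :: real assume "e > 0"
    have "{\<omega>\<in>space M. e < \<bar>c * Y n \<omega> - c * Z \<omega>\<bar>} = {\<omega>\<in>space M. e / \<bar>c\<bar> < \<bar>Y n \<omega> - Z \<omega>\<bar>}" for n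
    proof (rule Collect_cong)
      fix \<omega>
      have "\<bar>c * Y n \<omega> - c * Z \<omega>\<bar> = \<bar>c\<bar> * \<bar>Y n \<omega> - Z \<omega>\<bar>"
        by (simp add: abs_mult flip: right_diff_distrib)
      then show "(\<omega> \<in> space M \<and> e < \<bar>c * Y n \<omega> - c * Z \<omega>\<bar>)
          = (\<omega> \<in> space M \<and> e / \<bar>c\<bar> < \<bar>Y n \<omega> - Z \<omega>\<bar>)"
        using False by (simp add: pos_divide_less_eq mult.commute)
    qed
    moreover have "e / \<bar>c\<bar> > 0" using \<open>e > 0\<close> False by auto
    ultimately show "(\<lambda>n. prob {\<omega> \<in> space M. e < \<bar>c * Y n \<omega> - c * Z \<omega>\<bar>}) \<longlonglongrightarrow> 0"
      using lim unfolding tendsto_in_prob_def by simp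
  qed
qed

lemma tendsto_in_prob_const: "tendsto_in_prob M (\<lambda>n. Y) Y"
  by (simp add: tendsto_in_prob_def)

lemma tendsto_in_prob_sum:
  assumes "\<And>i n. i \<in> I \<Longrightarrow> Y i n \<in> borel_measurable M" "\<And>i. i \<in> I \<Longrightarrow> Z i \<in> borel_measurable M"
    and "\<And>i. i \<in> I \<Longrightarrow> tendsto_in_prob M (Y i) (Z i)"
  shows "tendsto_in_prob M (\<lambda>n \<omega>. \<Sum>i\<in>I. Y i n \<omega>) (\<lambda>\<omega>. \<Sum>i\<in>I. Z i \<omega>)"
  using assms
proof (induction I rule: infinite_finite_induct)
  case (insert i I)
  have "tendsto_in_prob M (\<lambda>n \<omega>. Y i n \<omega> + (\<Sum>j\<in>I. Y j n \<omega>)) (\<lambda>\<omega>. Z i \<omega> + (\<Sum>j\<in>I. Z j \<omega>))"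
    using insert by (intro tendsto_in_prob_add) auto
  then show ?case using insert.hyps by simp
qed (auto simp: tendsto_in_prob_const)

lemma tendsto_in_prob_subseq:
  assumes "tendsto_in_prob M Y Z" "strict_mono r"
  shows "tendsto_in_prob M (\<lambda>n. Y (r n)) Z"
  unfolding tendsto_in_prob_def
proof (intro allI impI)
  fix e :: real assume "e > 0"
  then have "(\<lambda>n. prob {\<omega> \<in> space M. e < \<bar>Y n \<omega> - Z \<omega>\<bar>}) \<longlonglongrightarrow> 0"
    using assms(1) unfolding tendsto_in_prob_def by simp
  from LIMSEQ_subseq_LIMSEQ[OF this assms(2)]
  show "(\<lambda>n. prob {\<omega> \<in> space M. e < \<bar>Y (r n) \<omega> - Z \<omega>\<bar>}) \<longlonglongrightarrow> 0"
    by (simp add: o_def)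
qed

lemma tendsto_in_prob_unique:
  assumes [measurable]: "\<And>n. Y n \<in> borel_measurable M" "Z \<in> borel_measurable M" "W \<in> borel_measurable M"
    and lim: "tendsto_in_prob M Y Z" "tendsto_in_prob M Y W"
  shows "AE \<omega> in M. Z \<omega> = W \<omega>"
proof -
  have "(\<lambda>n. L0_norm M (\<lambda>\<omega>. Y n \<omega> - Z \<omega>) + L0_norm M (\<lambda>\<omega>. Y n \<omega> - W \<omega>)) \<longlonglongrightarrow> 0 + 0"
    by (intro tendsto_add) (use lim in \<open>auto simp: tendsto_in_prob_iff_L0\<close>)
  moreover have "L0_norm M (\<lambda>\<omega>. Z \<omega> - W \<omega>) \<le> L0_norm M (\<lambda>\<omega>. Y n \<omega> - Z \<omega>) + L0_norm M (\<lambda>\<omega>. Y n \<omega> - W \<omega>)"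
    for n by (rule L0_norm_le_sum) auto
  ultimately have "L0_norm M (\<lambda>\<omega>. Z \<omega> - W \<omega>) \<le> 0 + 0"
    by (intro LIMSEQ_le_const[where X = "\<lambda>n. L0_norm M (\<lambda>\<omega>. Y n \<omega> - Z \<omega>) + L0_norm M (\<lambda>\<omega>. Y n \<omega> - W \<omega>)"]) auto
  then have "L0_norm M (\<lambda>\<omega>. Z \<omega> - W \<omega>) = 0" using L0_norm_nonneg by (auto intro: antisym)
  then have "AE \<omega> in M. Z \<omega> - W \<omega> = 0" by (rule L0_norm_eq_0_AE[rotated]) auto
  then show ?thesis by eventually_elim auto
qed

lemma tendsto_in_prob_AE:
  assumes [measurable]: "\<And>n. Y n \<in> borel_measurable M" "Z \<in> borel_measurable M"
    and "AE \<omega> in M. (\<lambda>n. Y n \<omega>) \<longlonglongrightarrow> Z \<omega>"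
  shows "tendsto_in_prob M Y Z"
proof -
  have "(\<lambda>n. \<integral>\<omega>. min 1 \<bar>Y n \<omega> - Z \<omega>\<bar> \<partial>M) \<longlonglongrightarrow> (\<integral>\<omega>. 0 \<partial>M)"
  proof (rule integral_dominated_convergence[where w = "\<lambda>_. 1"])
    show "AE \<omega> in M. (\<lambda>n. min 1 \<bar>Y n \<omega> - Z \<omega>\<bar>) \<longlonglongrightarrow> 0"
      using assms(3)
    proof eventually_elim
      case (elim \<omega>)
      have "(\<lambda>n. min 1 \<bar>Y n \<omega> - Z \<omega>\<bar>) \<longlonglongrightarrow> min 1 \<bar>Z \<omega> - Z \<omega>\<bar>"
        by (intro tendsto_intros elim)
      then show ?case by simp
    qed
  qed auto
  then show ?thesis by (subst tendsto_in_prob_iff_L0) (auto simp: L0_norm_def)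
qed

text \<open>The threshold has to grow a little when a tail bound is passed to a limit in probability.\<close>

lemma tail_bound_limit_in_prob:
  assumes [measurable]: "\<And>n. Y n \<in> borel_measurable M" "Z \<in> borel_measurable M"
    and lim: "tendsto_in_prob M Y Z" and L: "L < L'"
    and bound: "\<And>n. n \<ge> n0 \<Longrightarrow> prob {\<omega>\<in>space M. \<bar>Y n \<omega>\<bar> > L} \<le> p"
  shows "prob {\<omega>\<in>space M. \<bar>Z \<omega>\<bar> > L'} \<le> p"
proof -
  have "(\<lambda>n. p + prob {\<omega>\<in>space M. \<bar>Y n \<omega> - Z \<omega>\<bar> > L' - L}) \<longlonglongrightarrow> p + 0"
    using lim L unfolding tendsto_in_prob_def by (intro tendsto_intros) auto
  moreover have "prob {\<omega>\<in>space M. \<bar>Z \<omega>\<bar> > L'} \<le> p + prob {\<omega>\<in>space M. \<bar>Y n \<omega> - Z \<omega>\<bar> > L' - L}" if "n \<ge> n0" for n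
  proof -
    have "prob {\<omega>\<in>space M. \<bar>Z \<omega>\<bar> > L'} \<le> prob {\<omega>\<in>space M. \<bar>Y n \<omega>\<bar> > L} + prob {\<omega>\<in>space M. \<bar>Y n \<omega> - Z \<omega>\<bar> > L' - L}"
      by (rule prob_Un_le2) auto
    then show ?thesis using bound[OF that] by simp
  qed
  ultimately have "prob {\<omega>\<in>space M. \<bar>Z \<omega>\<bar> > L'} \<le> p + 0"
    by (intro LIMSEQ_le_const) auto
  then show ?thesis by simp
qed

end

section \<open>Elementary properties of stochastic measures\<close>

locale stochastic_measure_space = prob_space M for M :: "'a measure" +
  fixes X :: "'b measure" and \<mu> :: "'b set \<Rightarrow> 'a \<Rightarrow> real"
  assumes stochastic_measure: "stochastic_measure M X \<mu>"
begin

lemma measurable_sm [measurable]: "A \<in> sets X \<Longrightarrow> \<mu> A \<in> borel_measurable M"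
  using stochastic_measure unfolding stochastic_measure_def by auto

lemma sm_sigma_additive:
  fixes A :: "nat \<Rightarrow> 'b set"
  assumes "range A \<subseteq> sets X" "disjoint_family A"
  shows "tendsto_in_prob M (\<lambda>n \<omega>. \<Sum>i<n. \<mu> (A i) \<omega>) (\<mu> (\<Union>i. A i))"
  using stochastic_measure assms unfolding stochastic_measure_def by auto

lemma L0_norm_disjoint_tendsto_0:
  fixes A :: "nat \<Rightarrow> 'b set"
  assumes A: "range A \<subseteq> sets X" "disjoint_family A"
  shows "(\<lambda>n. L0_norm M (\<mu> (A n))) \<longlonglongrightarrow> 0"
proof -
  have [measurable]: "A i \<in> sets X" for i using A by auto
  have UN [measurable]: "(\<Union>i. A i) \<in> sets X" by auto
  let ?d = "\<lambda>n. L0_norm M (\<lambda>\<omega>. (\<Sum>i<n. \<mu> (A i) \<omega>) - \<mu> (\<Union>i. A i) \<omega>)"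
  have lim: "?d \<longlonglongrightarrow> 0"
    using sm_sigma_additive[OF A] by (subst (asm) tendsto_in_prob_iff_L0) auto
  have "(\<lambda>n. ?d (Suc n) + ?d n) \<longlonglongrightarrow> 0 + 0"
    by (intro tendsto_add LIMSEQ_Suc lim)
  then have lim': "(\<lambda>n. ?d (Suc n) + ?d n) \<longlonglongrightarrow> 0" by simp
  have le: "L0_norm M (\<mu> (A n)) \<le> ?d (Suc n) + ?d n" for n
    by (rule L0_norm_le_sum) auto
  show ?thesis
    by (rule tendsto_sandwich[OF _ _ tendsto_const lim'])
       (auto intro!: always_eventually L0_norm_nonneg le simp del: sum.lessThan_Suc)
qed

lemma sm_empty: "AE \<omega> in M. \<mu> {} \<omega> = 0"
proof -
  have "(\<lambda>n::nat. L0_norm M (\<mu> {})) \<longlonglongrightarrow> 0"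
    using L0_norm_disjoint_tendsto_0[of "\<lambda>_. {}"] by (auto simp: disjoint_family_on_def)
  then have "L0_norm M (\<mu> {}) = 0" by (simp add: LIMSEQ_const_iff)
  then show ?thesis by (intro L0_norm_eq_0_AE) auto
qed

lemma sm_Un:
  assumes [measurable]: "A \<in> sets X" "B \<in> sets X" and AB: "A \<inter> B = {}"
  shows "AE \<omega> in M. \<mu> (A \<union> B) \<omega> = \<mu> A \<omega> + \<mu> B \<omega>"
proof -
  define C where "C = (\<lambda>i::nat. if i = 0 then A else if i = 1 then B else {})"
  have C: "range C \<subseteq> sets X" "disjoint_family C" "(\<Union>i. C i) = A \<union> B"
    using AB by (auto simp: C_def disjoint_family_on_def split: if_splits)
  have [measurable]: "C i \<in> sets X" for i using C by auto
  have "tendsto_in_prob M (\<lambda>n \<omega>. \<Sum>i<n. \<mu> (C i) \<omega>) (\<mu> (A \<union> B))"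
    using sm_sigma_additive[OF C(1,2)] C(3) by simp
  from tendsto_in_prob_subseq[OF this, of "\<lambda>n. n + 2"]
  have "tendsto_in_prob M (\<lambda>n \<omega>. \<Sum>i<n+2. \<mu> (C i) \<omega>) (\<mu> (A \<union> B))"
    by (simp add: strict_mono_def)
  moreover have "AE \<omega> in M. (\<Sum>i<n+2. \<mu> (C i) \<omega>) = \<mu> A \<omega> + \<mu> B \<omega>" for n
    using sm_empty
  proof eventually_elim
    case (elim \<omega>)
    have "(\<Sum>i<n+2. \<mu> (C i) \<omega>) = (\<Sum>i\<in>{0,1}. \<mu> (C i) \<omega>)"
      by (rule sum.mono_neutral_right) (auto simp: C_def elim)
    then show ?case by (simp add: C_def)
  qed
  then have "tendsto_in_prob M (\<lambda>n \<omega>. \<Sum>i<n+2. \<mu> (C i) \<omega>) (\<lambda>\<omega>. \<mu> A \<omega> + \<mu> B \<omega>)"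
    by (subst tendsto_in_prob_cong_AE[where Y' = "\<lambda>_ \<omega>. \<mu> A \<omega> + \<mu> B \<omega>" and Z' = "\<lambda>\<omega>. \<mu> A \<omega> + \<mu> B \<omega>"])
       (auto simp: tendsto_in_prob_const)
  ultimately show ?thesis
    by (intro tendsto_in_prob_unique[where Y = "\<lambda>n \<omega>. \<Sum>i<n+2. \<mu> (C i) \<omega>"]) auto
qed

lemma sm_split:
  assumes [measurable]: "A \<in> sets X" "B \<in> sets X"
  shows "AE \<omega> in M. \<mu> A \<omega> = \<mu> (A \<inter> B) \<omega> + \<mu> (A - B) \<omega>"
  using sm_Un[of "A \<inter> B" "A - B"] by (auto simp: Int_Diff_Un)

lemma sm_finite_UN:
  assumes "finite I" "\<And>i. i \<in> I \<Longrightarrow> A i \<in> sets X" "disjoint_family_on A I"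
  shows "AE \<omega> in M. \<mu> (\<Union>i\<in>I. A i) \<omega> = (\<Sum>i\<in>I. \<mu> (A i) \<omega>)"
  using assms
proof (induction I)
  case empty
  then show ?case using sm_empty by simp
next
  case (insert i I)
  have "AE \<omega> in M. \<mu> (A i \<union> (\<Union>i\<in>I. A i)) \<omega> = \<mu> (A i) \<omega> + \<mu> (\<Union>i\<in>I. A i) \<omega>"
    by (rule sm_Un) (use insert in \<open>auto simp: disjoint_family_on_def\<close>)
  moreover have "AE \<omega> in M. \<mu> (\<Union>i\<in>I. A i) \<omega> = (\<Sum>i\<in>I. \<mu> (A i) \<omega>)"
    by (rule insert.IH) (use insert in \<open>auto simp: disjoint_family_on_def\<close>)
  ultimately show ?case by eventually_elim (use insert.hyps in auto)
qed

lemma sm_incseq: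
  assumes A: "range A \<subseteq> sets X" "incseq A"
  shows "tendsto_in_prob M (\<lambda>n. \<mu> (A n)) (\<mu> (\<Union>n. A n))"
proof -
  have [measurable]: "A n \<in> sets X" for n using A by auto
  have dis: "disjoint_family (disjointed A)" by (rule disjoint_family_disjointed)
  have m[measurable]: "disjointed A n \<in> sets X" for n
    using A by (auto simp: disjointed_def)
  have "tendsto_in_prob M (\<lambda>n \<omega>. \<Sum>i<n. \<mu> (disjointed A i) \<omega>) (\<mu> (\<Union>i. disjointed A i))"
    by (rule sm_sigma_additive) (auto simp: dis)
  from tendsto_in_prob_subseq[OF this, of Suc]
  have "tendsto_in_prob M (\<lambda>n \<omega>. \<Sum>i<Suc n. \<mu> (disjointed A i) \<omega>) (\<mu> (\<Union>i. A i))"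
    unfolding UN_disjointed_eq by (simp add: strict_mono_Suc_iff)
  moreover have "AE \<omega> in M. \<mu> (A n) \<omega> = (\<Sum>i<Suc n. \<mu> (disjointed A i) \<omega>)" for n
  proof -
    have "(\<Union>i\<in>{..<Suc n}. disjointed A i) = (\<Union>i\<in>{..<Suc n}. A i)"
      using finite_UN_disjointed_eq[of A "Suc n"] by (simp only: atLeast0LessThan)
    also have "\<dots> = A n"
    proof (intro equalityI UN_least)
      show "A i \<subseteq> A n" if "i \<in> {..<Suc n}" for i using that incseqD[OF A(2)] by auto
    qed auto
    finally have "(\<Union>i\<in>{..<Suc n}. disjointed A i) = A n" .
    moreover have "AE \<omega> in M. \<mu> (\<Union>i\<in>{..<Suc n}. disjointed A i) \<omega> = (\<Sum>i<Suc n. \<mu> (disjointed A i) \<omega>)"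
      by (rule sm_finite_UN) (use dis in \<open>auto intro: disjoint_family_on_mono\<close>)
    ultimately show ?thesis by simp
  qed
  ultimately show ?thesis
    by (subst tendsto_in_prob_cong_AE[where Y' = "\<lambda>n \<omega>. \<Sum>i<Suc n. \<mu> (disjointed A i) \<omega>" and Z' = "\<mu> (\<Union>n. A n)"]) auto
qed

lemma L0_norm_tail_le:
  assumes [measurable]: "A \<in> sets X" "B \<in> sets X"
  shows "L0_norm M (\<mu> A) \<le> L0_norm M (\<mu> (A \<inter> B)) + L0_norm M (\<mu> (A - B))"
  by (rule L0_norm_le_sum) (use sm_split[of A B] in \<open>auto elim!: eventually_mono\<close>)

lemma L0_norm_Diff_decseq:
  assumes A: "A \<in> sets X" and B: "range B \<subseteq> sets X" "decseq B" "(\<Inter>n. B n) = {}"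
  shows "(\<lambda>n. L0_norm M (\<mu> (A \<inter> B n))) \<longlonglongrightarrow> 0"
proof -
  have [measurable]: "B n \<in> sets X" "A \<in> sets X" for n using B A by auto
  have "incseq (\<lambda>n. A - B n)" using B(2) by (auto simp: decseq_def incseq_def)
  then have "tendsto_in_prob M (\<lambda>n. \<mu> (A - B n)) (\<mu> (\<Union>n. A - B n))"
    by (intro sm_incseq) auto
  also have "(\<Union>n. A - B n) = A" using B(3) by auto
  finally have lim: "(\<lambda>n. L0_norm M (\<lambda>\<omega>. \<mu> (A - B n) \<omega> - \<mu> A \<omega>)) \<longlonglongrightarrow> 0"
    by (subst (asm) tendsto_in_prob_iff_L0) auto
  have "L0_norm M (\<lambda>\<omega>. \<mu> (A - B n) \<omega> - \<mu> A \<omega>) = L0_norm M (\<mu> (A \<inter> B n))" for n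
  proof -
    have "L0_norm M (\<lambda>\<omega>. \<mu> (A - B n) \<omega> - \<mu> A \<omega>) = L0_norm M (\<lambda>\<omega>. - \<mu> (A \<inter> B n) \<omega>)"
      by (rule L0_norm_cong_AE) (use sm_split[of A "B n"] in \<open>auto elim!: eventually_mono\<close>)
    then show ?thesis by (simp add: L0_norm_def)
  qed
  then show ?thesis using lim by simp
qed

text \<open>A gliding hump. If subsets of every \<open>B n\<close> could have large measure, then continuity from above
  would allow cutting them down to disjoint pieces that are still large, and a disjoint sequence has
  measures tending to \<open>0\<close>.\<close>

lemma uniformly_small_on_decseq:
  assumes B: "range B \<subseteq> sets X" "decseq B" "(\<Inter>n. B n) = {}" and e: "e > 0"
  shows "\<exists>n. \<forall>A\<in>sets X. A \<subseteq> B n \<longrightarrow> L0_norm M (\<mu> A) < e"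
proof (rule ccontr)
  assume contr: "\<not> ?thesis"
  have [measurable]: "B n \<in> sets X" for n using B by auto
  have step: "\<exists>m>n. \<exists>D\<in>sets X. D \<subseteq> B n - B m \<and> L0_norm M (\<mu> D) \<ge> e / 2" for n
  proof -
    obtain A where A[measurable]: "A \<in> sets X" and AB: "A \<subseteq> B n" "L0_norm M (\<mu> A) \<ge> e"
      using contr by (meson not_less)
    from LIMSEQ_D[OF L0_norm_Diff_decseq[OF A B], of "e/2"] e obtain m0 where
      m0: "\<And>m. m \<ge> m0 \<Longrightarrow> L0_norm M (\<mu> (A \<inter> B m)) < e/2" by (auto simp: L0_norm_nonneg)
    define m where "m = max m0 (Suc n)"
    have "L0_norm M (\<mu> A) \<le> L0_norm M (\<mu> (A \<inter> B m)) + L0_norm M (\<mu> (A - B m))"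
      by (rule L0_norm_tail_le) auto
    moreover have "L0_norm M (\<mu> (A \<inter> B m)) < e/2" by (rule m0) (simp add: m_def)
    ultimately have "L0_norm M (\<mu> (A - B m)) \<ge> e/2" using AB by simp
    moreover have "A - B m \<subseteq> B n - B m" using AB by auto
    moreover have "m > n" by (simp add: m_def)
    ultimately show ?thesis using A by (intro exI[of _ m] conjI bexI[of _ "A - B m"]) auto
  qed
  then obtain next_index piece where s:
    "\<And>n. next_index n > n" "\<And>n. piece n \<in> sets X" "\<And>n. piece n \<subseteq> B n - B (next_index n)"
    "\<And>n. L0_norm M (\<mu> (piece n)) \<ge> e / 2"
    by metis
  define k where "k j = (next_index ^^ j) 0" for j
  have k_Suc: "k (Suc j) = next_index (k j)" for j by (simp add: k_def)
  have "strict_mono k" unfolding strict_mono_Suc_iff by (simp add: k_Suc s(1))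
  then have k_mono: "mono k" by (rule strict_mono_mono)
  have disj: "piece (k i) \<inter> piece (k j) = {}" if "i < j" for i j
  proof -
    have "B (k j) \<subseteq> B (k (Suc i))" using that k_mono decseqD[OF B(2)] by (simp add: mono_def)
    then show ?thesis using s(3)[of "k i"] s(3)[of "k j"] by (auto simp: k_Suc)
  qed
  have "disjoint_family (\<lambda>j. piece (k j))"
    unfolding disjoint_family_on_def
  proof (intro ballI impI)
    fix i j :: nat assume "i \<noteq> j"
    then show "piece (k i) \<inter> piece (k j) = {}"
      using disj[of i j] disj[of j i] by (cases "i < j") auto
  qed
  then have "(\<lambda>j. L0_norm M (\<mu> (piece (k j)))) \<longlonglongrightarrow> 0"
    using s(2) by (intro L0_norm_disjoint_tendsto_0) auto
  from LIMSEQ_le_const[OF this, of "e/2"] show False using s(4) e by auto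
qed

end

section \<open>Random subset sums\<close>

text \<open>The probability that a random subset of \<open>I\<close> equals \<open>S\<close> when each \<open>i\<close> is included
  independently with probability \<open>c i\<close>.\<close>

definition subset_weight :: "'i set \<Rightarrow> ('i \<Rightarrow> real) \<Rightarrow> 'i set \<Rightarrow> real" where
  "subset_weight I c S = (\<Prod>i\<in>I. if i \<in> S then c i else 1 - c i)"

definition subset_mean :: "'i set \<Rightarrow> ('i \<Rightarrow> real) \<Rightarrow> ('i set \<Rightarrow> real) \<Rightarrow> real" where
  "subset_mean I c F = (\<Sum>S\<in>Pow I. subset_weight I c S * F S)"

lemma subset_mean_empty [simp]: "subset_mean {} c F = F {}"
  by (simp add: subset_mean_def subset_weight_def)

lemma subset_mean_insert:
  assumes "finite I" "i \<notin> I"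
  shows "subset_mean (insert i I) c F =
    subset_mean I c (\<lambda>S. (1 - c i) * F S + c i * F (insert i S))"
proof -
  have 1: "subset_weight (insert i I) c S = (1 - c i) * subset_weight I c S" if "S \<in> Pow I" for S
    using assms that by (auto simp: subset_weight_def)
  have 2: "subset_weight (insert i I) c (insert i S) = c i * subset_weight I c S" if "S \<in> Pow I" for S
  proof -
    have "(\<Prod>j\<in>I. if j \<in> insert i S then c j else 1 - c j) = (\<Prod>j\<in>I. if j \<in> S then c j else 1 - c j)"
      using assms by (intro prod.cong) auto
    then show ?thesis using assms by (simp add: subset_weight_def)
  qed
  have inj: "inj_on (insert i) (Pow I)" using assms by (auto simp: inj_on_def)
  have disj: "Pow I \<inter> insert i ` Pow I = {}" using assms by auto
  have "subset_mean (insert i I) c F =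
      (\<Sum>S\<in>Pow I. subset_weight (insert i I) c S * F S)
      + (\<Sum>S\<in>Pow I. subset_weight (insert i I) c (insert i S) * F (insert i S))"
    unfolding subset_mean_def Pow_insert using assms disj inj
    by (subst sum.union_disjoint) (auto simp: sum.reindex)
  also have "\<dots> = (\<Sum>S\<in>Pow I. subset_weight I c S * ((1 - c i) * F S + c i * F (insert i S)))"
    unfolding sum.distrib[symmetric] by (intro sum.cong) (auto simp: 1 2 algebra_simps)
  finally show ?thesis by (simp add: subset_mean_def)
qed

lemma subset_mean_add: "subset_mean I c (\<lambda>S. F S + G S) = subset_mean I c F + subset_mean I c G"
  by (simp add: subset_mean_def algebra_simps sum.distrib)

lemma subset_mean_cmult: "subset_mean I c (\<lambda>S. a * F S) = a * subset_mean I c F"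
  by (simp add: subset_mean_def sum_distrib_left mult_ac)

lemma subset_mean_cong:
  "(\<And>S. S \<subseteq> I \<Longrightarrow> F S = G S) \<Longrightarrow> subset_mean I c F = subset_mean I c G"
  unfolding subset_mean_def by (intro sum.cong) auto

lemma subset_mean_const: "finite I \<Longrightarrow> subset_mean I c (\<lambda>S. a) = a"
proof (induction I rule: finite_induct)
  case (insert i I)
  have "(1 - c i) * a + c i * a = a" by (simp add: algebra_simps)
  then show ?case using insert by (simp add: subset_mean_insert)
qed simp

lemma subset_weight_nonneg:
  assumes "\<And>i. i \<in> I \<Longrightarrow> 0 \<le> c i" "\<And>i. i \<in> I \<Longrightarrow> c i \<le> 1"
  shows "0 \<le> subset_weight I c S"
  unfolding subset_weight_def using assms by (intro prod_nonneg) auto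

lemma subset_mean_mono:
  assumes "\<And>i. i \<in> I \<Longrightarrow> 0 \<le> c i" "\<And>i. i \<in> I \<Longrightarrow> c i \<le> 1"
    and "\<And>S. S \<subseteq> I \<Longrightarrow> F S \<le> G S"
  shows "subset_mean I c F \<le> subset_mean I c G"
  unfolding subset_mean_def using assms by (intro sum_mono mult_left_mono subset_weight_nonneg) auto

definition centred_sum :: "'i set \<Rightarrow> ('i \<Rightarrow> real) \<Rightarrow> ('i \<Rightarrow> real) \<Rightarrow> 'i set \<Rightarrow> real" where
  "centred_sum I c x S = (\<Sum>i\<in>S. x i) - (\<Sum>i\<in>I. c i * x i)"

lemma centred_sum_insert:
  assumes "finite I" "i \<notin> I" "S \<subseteq> I"
  shows "centred_sum (insert i I) c x S = centred_sum I c x S - c i * x i"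
    and "centred_sum (insert i I) c x (insert i S) = centred_sum I c x S + (1 - c i) * x i"
proof -
  have "finite S" "i \<notin> S" using assms finite_subset by auto
  then show "centred_sum (insert i I) c x S = centred_sum I c x S - c i * x i"
    "centred_sum (insert i I) c x (insert i S) = centred_sum I c x S + (1 - c i) * x i"
    using assms by (auto simp: centred_sum_def algebra_simps)
qed

lemma subset_mean_centred_sum_square:
  assumes "finite I"
  shows "subset_mean I c (\<lambda>S. (centred_sum I c x S)\<^sup>2) = (\<Sum>i\<in>I. c i * (1 - c i) * (x i)\<^sup>2)"
  using assms
proof (induction I rule: finite_induct)
  case empty
  then show ?case by (simp add: centred_sum_def)
next
  case (insert i I)
  have "subset_mean (insert i I) c (\<lambda>S. (centred_sum (insert i I) c x S)\<^sup>2)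
      = subset_mean I c (\<lambda>S. (centred_sum I c x S)\<^sup>2 + c i * (1 - c i) * (x i)\<^sup>2)"
    unfolding subset_mean_insert[OF insert.hyps]
    by (rule subset_mean_cong)
       (simp add: centred_sum_insert[OF insert.hyps] power2_eq_square algebra_simps)
  then show ?case
    using insert by (simp add: subset_mean_add subset_mean_const)
qed

text \<open>Khintchine's inequality for the fourth moment; for inclusion probability \<open>1/2\<close> the centred
  sum is half a Rademacher sum.\<close>

lemma subset_mean_centred_sum_fourth:
  assumes "finite I"
  shows "subset_mean I (\<lambda>_. 1/2) (\<lambda>S. (centred_sum I (\<lambda>_. 1/2) x S) ^ 4) \<le> 3 * (\<Sum>i\<in>I. (x i)\<^sup>2 / 4)\<^sup>2"
  using assms
proof (induction I rule: finite_induct)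
  case empty
  then show ?case by (simp add: centred_sum_def)
next
  case (insert i I)
  let ?c = "\<lambda>_. 1/2 :: real"
  let ?v = "\<Sum>i\<in>I. (x i)\<^sup>2 / 4"
  have "subset_mean (insert i I) ?c (\<lambda>S. (centred_sum (insert i I) ?c x S) ^ 4)
      = subset_mean I ?c (\<lambda>S. (centred_sum I ?c x S) ^ 4
          + (3/2 * (x i)\<^sup>2 * (centred_sum I ?c x S)\<^sup>2 + (x i) ^ 4 / 16))"
    unfolding subset_mean_insert[OF insert.hyps]
  proof (rule subset_mean_cong)
    fix S assume S: "S \<subseteq> I"
    have id: "(1 - 1/2) * (s - 1/2 * y) ^ 4 + 1/2 * (s + (1 - 1/2) * y) ^ 4
        = s ^ 4 + (3/2 * y\<^sup>2 * s\<^sup>2 + y ^ 4 / 16)" for s y :: real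
      by (simp add: power4_eq_xxxx power2_eq_square field_simps)
    show "(1 - 1/2) * (centred_sum (insert i I) ?c x S) ^ 4
        + 1/2 * (centred_sum (insert i I) ?c x (insert i S)) ^ 4
      = (centred_sum I ?c x S) ^ 4 + (3/2 * (x i)\<^sup>2 * (centred_sum I ?c x S)\<^sup>2 + (x i) ^ 4 / 16)"
      unfolding centred_sum_insert[OF insert.hyps S] by (rule id)
  qed
  also have "\<dots> = subset_mean I ?c (\<lambda>S. (centred_sum I ?c x S) ^ 4)
      + (3/2 * (x i)\<^sup>2 * ?v + (x i) ^ 4 / 16)"
    using subset_mean_centred_sum_square[OF insert.hyps(1), of ?c x]
    unfolding subset_mean_add subset_mean_cmult subset_mean_const[OF insert.hyps(1)] by simp
  also have "\<dots> \<le> 3 * ?v\<^sup>2 + (3/2 * (x i)\<^sup>2 * ?v + (x i) ^ 4 / 16)"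
    using insert.IH by simp
  also have "\<dots> \<le> 3 * ((x i)\<^sup>2 / 4 + ?v)\<^sup>2"
  proof -
    have "3 * (a / 4 + v)\<^sup>2 - (3 * v\<^sup>2 + (3/2 * a * v + a\<^sup>2 / 16)) = a\<^sup>2 / 8" for a v :: real
      by (simp add: power2_eq_square field_simps)
    from this[of "(x i)\<^sup>2" ?v]
    have "3 * ?v\<^sup>2 + (3/2 * (x i)\<^sup>2 * ?v + ((x i)\<^sup>2)\<^sup>2 / 16) \<le> 3 * ((x i)\<^sup>2 / 4 + ?v)\<^sup>2"
      using zero_le_power2[of "(x i)\<^sup>2"] by linarith
    then show ?thesis by simp
  qed
  finally show ?case using insert.hyps by simp
qed

text \<open>The sum over a random subset with inclusion probabilities \<open>c i\<close> has mean \<open>\<Sum>i\<in>I. c i * x i\<close> and a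
  variance that is at most that for the fair random subset. The latter is controlled by the
  Paley--Zygmund argument: if most subset sums are bounded by \<open>K\<close>, then Khintchine's inequality forces the variance to be of order
  \<open>K\<^sup>2\<close>. The average is therefore close to some bounded subset sum.\<close>

lemma average_bounded_by_subset_sums:
  fixes x c :: "'i \<Rightarrow> real"
  assumes I: "finite I" and K: "K > 0"
    and c: "\<And>i. i \<in> I \<Longrightarrow> 0 \<le> c i" "\<And>i. i \<in> I \<Longrightarrow> c i \<le> 1"
    and fair: "subset_mean I (\<lambda>_. 1/2) (\<lambda>S. of_bool (\<bar>\<Sum>i\<in>S. x i\<bar> > K \<or> \<bar>\<Sum>i\<in>I. x i\<bar> > K)) \<le> 1/12"
    and bias: "subset_mean I c (\<lambda>S. of_bool (\<bar>\<Sum>i\<in>S. x i\<bar> > K)) < 1/2"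
  shows "\<bar>\<Sum>i\<in>I. c i * x i\<bar> \<le> 4 * K"
proof (rule ccontr)
  define Z where "Z = (\<Sum>i\<in>I. c i * x i)"
  assume "\<not> ?thesis"
  then have Z: "\<bar>Z\<bar> > 4 * K" by (simp add: Z_def)
  let ?h = "\<lambda>_. 1/2 :: real"
  define v where "v = (\<Sum>i\<in>I. (x i)\<^sup>2 / 4)"
  define U where "U = centred_sum I ?h x"
  define bad where "bad S \<longleftrightarrow> \<bar>\<Sum>i\<in>S. x i\<bar> > K \<or> \<bar>\<Sum>i\<in>I. x i\<bar> > K" for S
  have v0: "v \<ge> 0" unfolding v_def by (intro sum_nonneg) auto
  \<comment> \<open>The second moment splits into the part where \<open>\<bar>U\<bar> \<le> 3/2 * K\<close> and the rest, which the fourth moment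
    controls because the bad sets have weight at most \<open>1/12\<close>.\<close>
  have v_le: "v \<le> 9/2 * K\<^sup>2"
  proof (cases "v = 0")
    case False
    then have v: "v > 0" using v0 by simp
    have U2: "subset_mean I ?h (\<lambda>S. (U S)\<^sup>2) = v"
      using subset_mean_centred_sum_square[OF I, of ?h x] by (simp add: U_def v_def)
    have U4: "subset_mean I ?h (\<lambda>S. (U S) ^ 4) \<le> 3 * v\<^sup>2"
      using subset_mean_centred_sum_fourth[OF I, of x] by (simp add: U_def v_def)
    have "v \<le> subset_mean I ?h (\<lambda>S. 9/4 * K\<^sup>2 + (1 / (12 * v) * (U S) ^ 4 + 3 * v * of_bool (bad S)))"
      unfolding U2[symmetric]
    proof (rule subset_mean_mono)
      fix S
      show "(U S)\<^sup>2 \<le> 9/4 * K\<^sup>2 + (1 / (12 * subset_mean I ?h (\<lambda>S. (U S)\<^sup>2)) * (U S) ^ 4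
          + 3 * subset_mean I ?h (\<lambda>S. (U S)\<^sup>2) * of_bool (bad S))"
        unfolding U2
      proof (cases "bad S")
        case True
        have "0 \<le> ((U S)\<^sup>2 - 6 * v)\<^sup>2 / (12 * v)" using v by simp
        also have "\<dots> = 1 / (12 * v) * (U S) ^ 4 + 3 * v - (U S)\<^sup>2"
          using v by (simp add: power2_eq_square power4_eq_xxxx field_simps)
        finally have "(U S)\<^sup>2 \<le> 1 / (12 * v) * (U S) ^ 4 + 3 * v" by linarith
        moreover have "9/4 * K\<^sup>2 \<ge> 0" by simp
        ultimately show "(U S)\<^sup>2 \<le> 9/4 * K\<^sup>2 + (1 / (12 * v) * (U S) ^ 4 + 3 * v * of_bool (bad S))"
          using True by (simp only: of_bool_eq mult_1_right)
      next
        case False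
        then have "\<bar>\<Sum>i\<in>S. x i\<bar> \<le> K" "\<bar>\<Sum>i\<in>I. x i\<bar> \<le> K" by (auto simp: bad_def)
        moreover have "U S = (\<Sum>i\<in>S. x i) - (\<Sum>i\<in>I. x i) / 2"
          by (simp add: U_def centred_sum_def sum_divide_distrib)
        ultimately have "\<bar>U S\<bar> \<le> 3/2 * K" by linarith
        then have "(U S)\<^sup>2 \<le> (3/2 * K)\<^sup>2" by (rule abs_le_square_iff[THEN iffD1, OF order_trans]) (use K in auto)
        also have "\<dots> = 9/4 * K\<^sup>2" by (simp add: power2_eq_square)
        finally show "(U S)\<^sup>2 \<le> 9/4 * K\<^sup>2 + (1 / (12 * v) * (U S) ^ 4 + 3 * v * of_bool (bad S))"
          using False v by (simp add: add_increasing2)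
      qed
    qed auto
    also have "\<dots> = 9/4 * K\<^sup>2 + (1 / (12 * v) * subset_mean I ?h (\<lambda>S. (U S) ^ 4)
        + 3 * v * subset_mean I ?h (\<lambda>S. of_bool (bad S)))"
      using I by (simp only: subset_mean_add subset_mean_cmult subset_mean_const)
    also have "\<dots> \<le> 9/4 * K\<^sup>2 + (1 / (12 * v) * (3 * v\<^sup>2) + 3 * v * (1/12))"
      using v U4 fair unfolding bad_def by (intro add_left_mono add_mono mult_left_mono) auto
    also have "\<dots> = 9/4 * K\<^sup>2 + v / 2" using v by (simp add: power2_eq_square field_simps)
    finally show ?thesis by linarith
  qed (use K in simp)
  have "9 * K\<^sup>2 * (1/2) < 9 * K\<^sup>2 * (1 - subset_mean I c (\<lambda>S. of_bool (\<bar>\<Sum>i\<in>S. x i\<bar> > K)))"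
    using K bias by (intro mult_strict_left_mono) auto
  also have "\<dots> = subset_mean I c (\<lambda>S. 9 * K\<^sup>2 * (1 + (- 1) * of_bool (\<bar>\<Sum>i\<in>S. x i\<bar> > K)))"
    unfolding subset_mean_cmult subset_mean_add subset_mean_const[OF I] by simp
  also have "\<dots> \<le> subset_mean I c (\<lambda>S. (centred_sum I c x S)\<^sup>2)"
  proof (rule subset_mean_mono[OF c])
    fix S
    show "9 * K\<^sup>2 * (1 + (- 1) * of_bool (\<bar>\<Sum>i\<in>S. x i\<bar> > K)) \<le> (centred_sum I c x S)\<^sup>2"
    proof (cases "\<bar>\<Sum>i\<in>S. x i\<bar> > K")
      case False
      then have "3 * K \<le> \<bar>centred_sum I c x S\<bar>" using Z by (simp add: centred_sum_def Z_def)
      then have "(3 * K)\<^sup>2 \<le> \<bar>centred_sum I c x S\<bar>\<^sup>2" using K by (intro power_mono) auto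
      then show ?thesis using False by (simp add: power2_eq_square)
    qed simp
  qed
  also have "\<dots> = (\<Sum>i\<in>I. c i * (1 - c i) * (x i)\<^sup>2)" by (rule subset_mean_centred_sum_square[OF I])
  also have "\<dots> \<le> v"
    unfolding v_def
  proof (rule sum_mono)
    fix i
    have "0 \<le> (c i - 1/2)\<^sup>2" by simp
    then have "c i * (1 - c i) \<le> 1/4" by (simp add: power2_eq_square algebra_simps)
    then have "c i * (1 - c i) * (x i)\<^sup>2 \<le> 1/4 * (x i)\<^sup>2" by (rule mult_right_mono) simp
    then show "c i * (1 - c i) * (x i)\<^sup>2 \<le> (x i)\<^sup>2 / 4" by simp
  qed
  also have "\<dots> \<le> 9 * K\<^sup>2 * (1/2)" using v_le by simp
  finally show False by simp
qed

context prob_space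
begin

lemma prob_subset_mean_le:
  assumes I: "finite I" and c: "\<And>i. i \<in> I \<Longrightarrow> 0 \<le> c i" "\<And>i. i \<in> I \<Longrightarrow> c i \<le> 1"
    and [measurable]: "\<And>S. S \<subseteq> I \<Longrightarrow> {\<omega>\<in>space M. Q S \<omega>} \<in> events"
    and Q: "\<And>S. S \<subseteq> I \<Longrightarrow> prob {\<omega>\<in>space M. Q S \<omega>} \<le> p" and a: "a > 0"
  shows "{\<omega>\<in>space M. subset_mean I c (\<lambda>S. of_bool (Q S \<omega>)) \<ge> a} \<in> events"
    and "prob {\<omega>\<in>space M. subset_mean I c (\<lambda>S. of_bool (Q S \<omega>)) \<ge> a} \<le> p / a"
proof -
  let ?G = "\<lambda>\<omega>. subset_mean I c (\<lambda>S. indicator {\<omega>\<in>space M. Q S \<omega>} \<omega>)"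
  have G[measurable]: "?G \<in> borel_measurable M"
    unfolding subset_mean_def by (intro borel_measurable_sum borel_measurable_times) auto
  have eq: "{\<omega>\<in>space M. subset_mean I c (\<lambda>S. of_bool (Q S \<omega>)) \<ge> a} = {\<omega>\<in>space M. ?G \<omega> \<ge> a}"
    by (intro Collect_cong conj_cong refl) (simp add: indicator_def of_bool_def)
  show "{\<omega>\<in>space M. subset_mean I c (\<lambda>S. of_bool (Q S \<omega>)) \<ge> a} \<in> events"
    unfolding eq by measurable
  have int: "integrable M (\<lambda>\<omega>. subset_weight I c S * indicator {\<omega>\<in>space M. Q S \<omega>} \<omega> :: real)"
    if "S \<in> Pow I" for S
    using that by (intro integrable_mult_right integrable_real_indicator) (auto simp: emeasure_eq_measure)
  have intG: "integrable M ?G"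
    unfolding subset_mean_def by (intro Bochner_Integration.integrable_sum int)
  have "prob {\<omega>\<in>space M. ?G \<omega> \<ge> a} \<le> (\<integral>\<omega>. ?G \<omega> \<partial>M) / a"
  proof (rule integral_Markov_inequality_measure[where A = "{}"])
    have "0 \<le> ?G \<omega>" for \<omega>
      unfolding subset_mean_def using c by (intro sum_nonneg mult_nonneg_nonneg subset_weight_nonneg) auto
    then show "AE \<omega> in M. 0 \<le> ?G \<omega>" by simp
  qed (use intG a in auto)
  also have "(\<integral>\<omega>. ?G \<omega> \<partial>M) = subset_mean I c (\<lambda>S. prob {\<omega>\<in>space M. Q S \<omega>})"
    unfolding subset_mean_def
    by (subst Bochner_Integration.integral_sum[OF int]) (auto intro!: sum.cong)
  also have "\<dots> \<le> subset_mean I c (\<lambda>S. p)"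
    using c Q by (intro subset_mean_mono) auto
  also have "\<dots> = p" by (rule subset_mean_const[OF I])
  finally show "prob {\<omega>\<in>space M. subset_mean I c (\<lambda>S. of_bool (Q S \<omega>)) \<ge> a} \<le> p / a"
    unfolding eq using a by (simp add: divide_right_mono)
qed

text \<open>By Markov's inequality, each of the two conditions of \<open>average_bounded_by_subset_sums\<close> fails with
  probability at most a multiple of \<open>p\<close>.\<close>

lemma prob_convex_combination_le:
  fixes x :: "'i \<Rightarrow> 'a \<Rightarrow> real" and c :: "'i \<Rightarrow> real"
  assumes I: "finite I" and [measurable]: "\<And>i. i \<in> I \<Longrightarrow> x i \<in> borel_measurable M"
    and K: "K > 0" and c: "\<And>i. i \<in> I \<Longrightarrow> 0 \<le> c i" "\<And>i. i \<in> I \<Longrightarrow> c i \<le> 1"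
    and p: "\<And>S. S \<subseteq> I \<Longrightarrow> prob {\<omega>\<in>space M. \<bar>\<Sum>i\<in>S. x i \<omega>\<bar> > K} \<le> p"
  shows "prob {\<omega>\<in>space M. \<bar>\<Sum>i\<in>I. c i * x i \<omega>\<bar> > 4 * K} \<le> 26 * p"
proof -
  have [measurable]: "(\<lambda>\<omega>. \<Sum>i\<in>S. x i \<omega>) \<in> borel_measurable M" if "S \<subseteq> I" for S
    using that by (intro borel_measurable_sum) auto
  have m2: "{\<omega>\<in>space M. \<bar>\<Sum>i\<in>S. x i \<omega>\<bar> > K} \<in> events" if "S \<subseteq> I" for S
    using that by measurable
  have m1: "{\<omega>\<in>space M. \<bar>\<Sum>i\<in>S. x i \<omega>\<bar> > K \<or> \<bar>\<Sum>i\<in>I. x i \<omega>\<bar> > K} \<in> events" if "S \<subseteq> I" for S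
    using that by measurable
  have p1: "prob {\<omega>\<in>space M. \<bar>\<Sum>i\<in>S. x i \<omega>\<bar> > K \<or> \<bar>\<Sum>i\<in>I. x i \<omega>\<bar> > K} \<le> 2 * p" if "S \<subseteq> I" for S
  proof -
    have "prob {\<omega>\<in>space M. \<bar>\<Sum>i\<in>S. x i \<omega>\<bar> > K \<or> \<bar>\<Sum>i\<in>I. x i \<omega>\<bar> > K}
        \<le> prob {\<omega>\<in>space M. \<bar>\<Sum>i\<in>S. x i \<omega>\<bar> > K} + prob {\<omega>\<in>space M. \<bar>\<Sum>i\<in>I. x i \<omega>\<bar> > K}"
      by (rule prob_Un_le2) (use that m1 m2 in auto)
    then show ?thesis using p[OF that] p[of I] by simp
  qed
  let ?fair = "\<lambda>\<omega>. subset_mean I (\<lambda>_. 1/2) (\<lambda>S. of_bool (\<bar>\<Sum>i\<in>S. x i \<omega>\<bar> > K \<or> \<bar>\<Sum>i\<in>I. x i \<omega>\<bar> > K))"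
  let ?bias = "\<lambda>\<omega>. subset_mean I c (\<lambda>S. of_bool (\<bar>\<Sum>i\<in>S. x i \<omega>\<bar> > K))"
  have "prob {\<omega>\<in>space M. \<bar>\<Sum>i\<in>I. c i * x i \<omega>\<bar> > 4 * K}
      \<le> prob {\<omega>\<in>space M. ?fair \<omega> \<ge> 1/12} + prob {\<omega>\<in>space M. ?bias \<omega> \<ge> 1/2}"
  proof (rule prob_Un_le2)
    show "{\<omega>\<in>space M. ?fair \<omega> \<ge> 1/12} \<in> events"
      by (rule prob_subset_mean_le(1)[OF I _ _ m1 p1]) auto
    show "{\<omega>\<in>space M. ?bias \<omega> \<ge> 1/2} \<in> events"
      by (rule prob_subset_mean_le(1)[OF I c m2 p]) auto
    show "AE \<omega> in M. \<bar>\<Sum>i\<in>I. c i * x i \<omega>\<bar> > 4 * K \<longrightarrow> ?fair \<omega> \<ge> 1/12 \<or> ?bias \<omega> \<ge> 1/2"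
    proof (intro AE_I2 impI)
      fix \<omega> assume "\<bar>\<Sum>i\<in>I. c i * x i \<omega>\<bar> > 4 * K"
      then show "?fair \<omega> \<ge> 1/12 \<or> ?bias \<omega> \<ge> 1/2"
        using average_bounded_by_subset_sums[OF I K c, where x = "\<lambda>i. x i \<omega>"] by force
    qed
  qed measurable
  also have "\<dots> \<le> 2 * p / (1/12) + p / (1/2)"
    by (intro add_mono prob_subset_mean_le(2)[OF I _ _ m1 p1] prob_subset_mean_le(2)[OF I c m2 p]) auto
  finally show ?thesis by simp
qed

lemma prob_bounded_combination_le:
  fixes x :: "'i \<Rightarrow> 'a \<Rightarrow> real" and c :: "'i \<Rightarrow> real"
  assumes I: "finite I" and m[measurable]: "\<And>i. i \<in> I \<Longrightarrow> x i \<in> borel_measurable M"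
    and K: "K > 0" and c: "\<And>i. i \<in> I \<Longrightarrow> \<bar>c i\<bar> \<le> 1"
    and p: "\<And>S. S \<subseteq> I \<Longrightarrow> prob {\<omega>\<in>space M. \<bar>\<Sum>i\<in>S. x i \<omega>\<bar> > K} \<le> p"
  shows "prob {\<omega>\<in>space M. \<bar>\<Sum>i\<in>I. c i * x i \<omega>\<bar> > 8 * K} \<le> 52 * p"
proof -
  have "prob {\<omega>\<in>space M. \<bar>\<Sum>i\<in>I. c i * x i \<omega>\<bar> > 8 * K}
      \<le> prob {\<omega>\<in>space M. \<bar>\<Sum>i\<in>I. max 0 (c i) * x i \<omega>\<bar> > 4 * K}
        + prob {\<omega>\<in>space M. \<bar>\<Sum>i\<in>I. max 0 (- c i) * x i \<omega>\<bar> > 4 * K}"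
  proof (rule prob_Un_le2)
    have "c i = max 0 (c i) - max 0 (- c i)" for i by (simp add: max_def)
    then have "(\<Sum>i\<in>I. c i * x i \<omega>) = (\<Sum>i\<in>I. max 0 (c i) * x i \<omega>) - (\<Sum>i\<in>I. max 0 (- c i) * x i \<omega>)" for \<omega>
      unfolding sum_subtractf[symmetric] left_diff_distrib[symmetric] by simp
    then show "AE \<omega> in M. \<bar>\<Sum>i\<in>I. c i * x i \<omega>\<bar> > 8 * K \<longrightarrow>
        \<bar>\<Sum>i\<in>I. max 0 (c i) * x i \<omega>\<bar> > 4 * K \<or> \<bar>\<Sum>i\<in>I. max 0 (- c i) * x i \<omega>\<bar> > 4 * K"
      by auto
  qed measurable
  also have "\<dots> \<le> 26 * p + 26 * p"
    using c by (intro add_mono prob_convex_combination_le[OF I m K _ _ p]) (auto simp: abs_le_iff)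
  finally show ?thesis by simp
qed

end

section \<open>The range of a stochastic measure is bounded in probability\<close>

lemma exists_large_summand:
  fixes y :: "'i \<Rightarrow> real"
  assumes "finite I" "card I \<le> n" "L \<ge> 0" "\<bar>\<Sum>i\<in>I. y i\<bar> > real n * L"
  shows "\<exists>i\<in>I. \<bar>y i\<bar> > L"
proof (rule ccontr)
  assume "\<not> ?thesis"
  then have "(\<Sum>i\<in>I. \<bar>y i\<bar>) \<le> real (card I) * L" by (intro sum_bounded_above) auto
  also have "\<dots> \<le> real n * L" using assms by (intro mult_right_mono) auto
  finally show False using assms sum_abs[of y I] by linarith
qed

text \<open>The cells of the partition of \<open>A\<close> generated by \<open>F\<close> are indexed by the subfamilies of \<open>F\<close> and not
  given as a set of sets: empty cells then need no care, and the cells of the partition generated by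
  \<open>G \<supseteq> F\<close> that lie in the cell of \<open>S\<close> are those with index \<open>T\<close> such that \<open>T \<inter> F = S\<close>.\<close>

definition atom :: "'b set \<Rightarrow> 'b set set \<Rightarrow> 'b set set \<Rightarrow> 'b set" where
  "atom A F S = {x\<in>A. \<forall>B\<in>F. x \<in> B \<longleftrightarrow> B \<in> S}"

lemma atom_subset: "atom A F S \<subseteq> A"
  by (auto simp: atom_def)

lemma sets_atom:
  assumes "finite F" "F \<subseteq> sets N" "A \<in> sets N"
  shows "atom A F S \<in> sets N"
  using assms
proof (induction F rule: finite_induct)
  case empty
  then show ?case by (simp add: atom_def)
next
  case (insert B F)
  have "atom A (insert B F) S = (if B \<in> S then atom A F S \<inter> B else atom A F S - B)"
    by (auto simp: atom_def)
  then show ?case using insert by auto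
qed

lemma atom_disjoint: "S \<in> Pow F \<Longrightarrow> T \<in> Pow F \<Longrightarrow> S \<noteq> T \<Longrightarrow> atom A F S \<inter> atom A F T = {}"
  by (auto simp: atom_def)

lemma Int_atom_refine:
  assumes "F \<subseteq> G" "S \<subseteq> F" "B \<in> G"
  shows "B \<inter> atom A F S = (\<Union>T\<in>{T\<in>Pow G. T \<inter> F = S \<and> B \<in> T}. atom A G T)" (is "_ = ?R")
proof (intro equalityI subsetI)
  fix x assume x: "x \<in> B \<inter> atom A F S"
  have "x \<in> atom A G {C\<in>G. x \<in> C}" using x by (auto simp: atom_def)
  moreover have "{C\<in>G. x \<in> C} \<inter> F = S" using x assms by (auto simp: atom_def)
  ultimately show "x \<in> ?R" using x assms by (intro UN_I[of "{C\<in>G. x \<in> C}"]) auto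
next
  fix x assume "x \<in> ?R"
  then show "x \<in> B \<inter> atom A F S" using assms by (auto simp: atom_def)
qed

lemma atom_refine:
  assumes "F \<subseteq> G" "S \<subseteq> F"
  shows "atom A F S = (\<Union>T\<in>{T\<in>Pow G. T \<inter> F = S}. atom A G T)" (is "_ = ?R")
proof (intro equalityI subsetI)
  fix x assume x: "x \<in> atom A F S"
  have "x \<in> atom A G {C\<in>G. x \<in> C}" using x by (auto simp: atom_def)
  moreover have "{C\<in>G. x \<in> C} \<inter> F = S" using x assms by (auto simp: atom_def)
  ultimately show "x \<in> ?R" using x assms by (intro UN_I[of "{C\<in>G. x \<in> C}"]) auto
next
  fix x assume "x \<in> ?R"
  then show "x \<in> atom A F S" using assms by (auto simp: atom_def)
qed

lemma UN_Int_atom: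
  assumes "B \<subseteq> A"
  shows "B = (\<Union>S\<in>Pow F. B \<inter> atom A F S)" (is "_ = ?R")
proof (intro equalityI subsetI)
  fix x assume x: "x \<in> B"
  have "x \<in> atom A F {C\<in>F. x \<in> C}" using x assms by (auto simp: atom_def)
  then show "x \<in> ?R" using x by (intro UN_I[of "{C\<in>F. x \<in> C}"]) auto
qed auto

text \<open>Refining keeps at least one large piece in every large atom; an atom that is cut into two large
  pieces contributes one more.\<close>

lemma count_large_refined:
  fixes y :: "'b set set \<Rightarrow> real"
  defines "x \<equiv> \<lambda>F G S. \<Sum>T\<in>{T\<in>Pow G. T \<inter> F = S}. y T"
  assumes G: "finite G" "F \<subseteq> G" and L: "L \<ge> 0" and S0: "S0 \<subseteq> F"
    and z: "\<bar>\<Sum>T\<in>{T\<in>Pow G. T \<inter> F = S0 \<and> B \<in> T}. y T\<bar> > 2 ^ card G * L"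
    and z': "\<bar>x F G S0 - (\<Sum>T\<in>{T\<in>Pow G. T \<inter> F = S0 \<and> B \<in> T}. y T)\<bar> > 2 ^ card G * L"
  shows "Suc (card {S\<in>Pow F. \<bar>x F G S\<bar> > 2 ^ card G * L}) \<le> card {T\<in>Pow G. \<bar>y T\<bar> > L}"
proof -
  have fin: "finite (Pow G)" "finite (Pow F)" using G finite_subset by auto
  have large: "\<exists>T\<in>C. \<bar>y T\<bar> > L" if "C \<subseteq> Pow G" "\<bar>\<Sum>T\<in>C. y T\<bar> > 2 ^ card G * L" for C
  proof (rule exists_large_summand)
    show "finite C" using that fin finite_subset by auto
    show "card C \<le> 2 ^ card G" using card_mono[OF fin(1) that(1)] G by (simp add: card_Pow)
  qed (use L that in auto)
  let ?W = "{S\<in>Pow F. \<bar>x F G S\<bar> > 2 ^ card G * L}"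
  let ?V = "{T\<in>Pow G. \<bar>y T\<bar> > L}"
  have "\<exists>T. T \<in> ?V \<and> T \<inter> F = S" if "S \<in> ?W" for S
    using large[of "{T\<in>Pow G. T \<inter> F = S}"] that unfolding x_def by auto
  then have "\<forall>S\<in>?W. \<exists>T. T \<in> ?V \<and> T \<inter> F = S" by blast
  from bchoice[OF this] obtain t where t0: "\<forall>S\<in>?W. t S \<in> ?V \<and> t S \<inter> F = S" ..
  note t = bspec[OF t0, THEN conjunct1] bspec[OF t0, THEN conjunct2]
  have "\<exists>T\<in>{T\<in>Pow G. T \<inter> F = S0 \<and> B \<in> T}. \<bar>y T\<bar> > L" using z by (intro large) auto
  then obtain T1 where T1': "T1 \<in> {T\<in>Pow G. T \<inter> F = S0 \<and> B \<in> T}" "\<bar>y T1\<bar> > L" by (rule bexE)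
  then have T1: "T1 \<in> ?V" "T1 \<inter> F = S0" "B \<in> T1" by simp_all
  have "x F G S0 - (\<Sum>T\<in>{T\<in>Pow G. T \<inter> F = S0 \<and> B \<in> T}. y T)
      = (\<Sum>T\<in>{T\<in>Pow G. T \<inter> F = S0} - {T\<in>Pow G. T \<inter> F = S0 \<and> B \<in> T}. y T)"
    unfolding x_def by (rule sum_diff[symmetric]) (use G in auto)
  also have "{T\<in>Pow G. T \<inter> F = S0} - {T\<in>Pow G. T \<inter> F = S0 \<and> B \<in> T}
      = {T\<in>Pow G. T \<inter> F = S0 \<and> B \<notin> T}" by auto
  finally have "\<bar>\<Sum>T\<in>{T\<in>Pow G. T \<inter> F = S0 \<and> B \<notin> T}. y T\<bar> > 2 ^ card G * L"
    using z' by simp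
  then have "\<exists>T\<in>{T\<in>Pow G. T \<inter> F = S0 \<and> B \<notin> T}. \<bar>y T\<bar> > L" by (intro large) auto
  then obtain T2 where T2': "T2 \<in> {T\<in>Pow G. T \<inter> F = S0 \<and> B \<notin> T}" "\<bar>y T2\<bar> > L" by (rule bexE)
  then have T2: "T2 \<in> ?V" "T2 \<inter> F = S0" "B \<notin> T2" by simp_all
  have finW: "finite ?W" and finV: "finite ?V" using fin by auto
  have inj: "inj_on t (?W - {S0})" by (rule inj_on_inverseI[of _ "\<lambda>T. T \<inter> F"], rule t(2), erule DiffD1)
  have new: "t ` (?W - {S0}) \<inter> {T1, T2} = {}"
  proof -
    have "T \<inter> F \<noteq> S0" if "T \<in> t ` (?W - {S0})" for T
    proof -
      from that obtain S where S: "T = t S" "S \<in> ?W" "S \<noteq> S0" by (elim imageE DiffE) simp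
      then show ?thesis using t(2)[OF S(2)] by simp
    qed
    then show ?thesis using T1(2) T2(2) by blast
  qed
  have "Suc (card ?W) \<le> card (?W - {S0}) + 2"
    using finW by (cases "S0 \<in> ?W") (auto simp: card_Diff_singleton_if)
  also have "\<dots> = card (t ` (?W - {S0})) + card {T1, T2}"
    using T1 T2 by (subst card_image[OF inj]) (auto simp: card_insert_if)
  also have "\<dots> = card (t ` (?W - {S0}) \<union> {T1, T2})"
    using finW new by (subst card_Un_disjoint) auto
  also have "\<dots> \<le> card ?V"
  proof (intro card_mono Un_least image_subsetI)
    show "t S \<in> ?V" if "S \<in> ?W - {S0}" for S using that by (intro t(1)) (erule DiffD1)
    show "{T1, T2} \<subseteq> ?V" using T1(1) T2(1) by blast
  qed (rule finV)
  finally show ?thesis .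
qed

text \<open>A flip exchanges the colours \<open>0\<close> and \<open>1\<close> of one large summand and thereby changes the
  sum over colour \<open>0\<close> by more than \<open>2\<close>. So that sum exceeds \<open>1\<close> in absolute value for at least half of
  the colourings in which some large summand has colour \<open>0\<close> or \<open>1\<close>, and these are at least half of all
  colourings.\<close>

lemma many_colourings_with_large_sum:
  fixes x :: "'i \<Rightarrow> real" and n :: nat
  assumes I: "finite I" and W: "W \<subseteq> I" "\<And>i. i \<in> W \<Longrightarrow> \<bar>x i\<bar> > 2"
    and n: "n \<ge> 2" "(1 - 2 / real n) ^ card W \<le> 1/2"
  shows "real (n ^ card I) / 4
    \<le> real (card {c \<in> I \<rightarrow>\<^sub>E {..<n}. \<bar>\<Sum>i\<in>{i\<in>I. c i = 0}. x i\<bar> > 1})"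
proof -
  define C where "C = I \<rightarrow>\<^sub>E {..<n}"
  define f where "f c = (\<Sum>i\<in>{i\<in>I. c i = 0}. x i)" for c :: "'i \<Rightarrow> nat"
  define T where "T = {c\<in>C. \<exists>i\<in>W. c i < 2}"
  define sel where "sel c = (SOME i. i \<in> {i\<in>W. c i < 2})" for c :: "'i \<Rightarrow> nat"
  define flip where "flip c = c(sel c := 1 - c (sel c))" for c
  have finC: "finite C" and cardC: "card C = n ^ card I"
    using I by (auto simp: C_def finite_PiE card_PiE)
  have finW: "finite W" using W I finite_subset by auto
  have sel: "sel c \<in> W" "c (sel c) < 2" if "c \<in> T" for c
  proof -
    have "\<exists>i. i \<in> {i\<in>W. c i < 2}" using that by (auto simp: T_def)
    then have "sel c \<in> {i\<in>W. c i < 2}" unfolding sel_def by (rule someI_ex)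
    then show "sel c \<in> W" "c (sel c) < 2" by auto
  qed
  have flip_T: "flip c \<in> T" if c: "c \<in> T" for c
  proof -
    have "flip c \<in> C"
      using c sel[OF c] W n unfolding C_def T_def flip_def by (auto simp: PiE_iff extensional_def)
    then show ?thesis using sel[OF c] by (auto simp: T_def flip_def intro!: bexI[of _ "sel c"])
  qed
  have sel_flip: "sel (flip c) = sel c" if c: "c \<in> T" for c
  proof -
    have "{i\<in>W. flip c i < 2} = {i\<in>W. c i < 2}" using sel[OF c] by (auto simp: flip_def)
    then show ?thesis by (simp add: sel_def)
  qed
  have flip_flip: "flip (flip c) = c" if c: "c \<in> T" for c
  proof -
    have "flip (flip c) = c(sel c := 1 - (1 - c (sel c)))"
      using sel_flip[OF c] by (simp add: flip_def)
    also have "1 - (1 - c (sel c)) = c (sel c)" using sel[OF c] by simp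
    finally show ?thesis by simp
  qed
  have jump: "\<bar>f c - f (flip c)\<bar> > 2" if c: "c \<in> T" for c
  proof -
    let ?i = "sel c"
    let ?J = "{i\<in>I - {?i}. c i = 0}"
    have iI: "?i \<in> I" using sel[OF c] W by auto
    have split: "f d = (if d ?i = 0 then x ?i else 0) + (\<Sum>i\<in>?J. x i)"
      if d: "\<And>i. i \<noteq> ?i \<Longrightarrow> d i = c i" for d
    proof -
      have "{i\<in>I. d i = 0} = (if d ?i = 0 then insert ?i ?J else ?J)"
      proof (rule set_eqI)
        show "j \<in> {i\<in>I. d i = 0} \<longleftrightarrow> j \<in> (if d ?i = 0 then insert ?i ?J else ?J)" for j
          using d[of j] iI by (cases "j = ?i") auto
      qed
      then show ?thesis using I by (simp add: f_def)
    qed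
    have "c ?i = 0 \<or> c ?i = 1" using sel[OF c] by auto
    moreover have "\<bar>x ?i\<bar> > 2" using sel[OF c] W by auto
    ultimately show ?thesis
      using split[of c] split[of "flip c"] by (auto simp: flip_def)
  qed
  let ?G = "{c\<in>C. \<bar>f c\<bar> > 1}"
  have "T \<subseteq> ?G \<union> flip ` (?G \<inter> T)"
  proof
    fix c assume c: "c \<in> T"
    have cC: "c \<in> C" "flip c \<in> C" using c flip_T[OF c] by (auto simp: T_def)
    have "\<bar>f c\<bar> > 1 \<or> \<bar>f (flip c)\<bar> > 1" using jump[OF c] by linarith
    moreover have "c = flip (flip c)" using flip_flip[OF c] by simp
    ultimately show "c \<in> ?G \<union> flip ` (?G \<inter> T)" using cC flip_T[OF c] by blast
  qed
  then have "card T \<le> card (?G \<union> flip ` (?G \<inter> T))"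
    using finC by (intro card_mono) auto
  also have "\<dots> \<le> card ?G + card (flip ` (?G \<inter> T))" by (rule card_Un_le)
  also have "card (flip ` (?G \<inter> T)) \<le> card ?G"
    using finC by (intro order_trans[OF card_image_le] card_mono) auto
  finally have T_le: "card T \<le> 2 * card ?G" by simp
  have "C - T = PiE I (\<lambda>i. if i \<in> W then {2..<n} else {..<n})"
  proof (intro equalityI subsetI)
    fix c assume "c \<in> C - T"
    then show "c \<in> PiE I (\<lambda>i. if i \<in> W then {2..<n} else {..<n})"
      by (auto simp: C_def T_def PiE_iff)
  next
    fix c assume c: "c \<in> PiE I (\<lambda>i. if i \<in> W then {2..<n} else {..<n})"
    have mem: "c i \<in> (if i \<in> W then {2..<n} else {..<n})" if "i \<in> I" for i
      using c that by (rule PiE_mem)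
    have "c i < n" if "i \<in> I" for i using mem[OF that] by (auto split: if_splits)
    moreover have "\<not> c i < 2" if "i \<in> W" for i using mem[of i] that W(1) by auto
    moreover have "c \<in> extensional I" using c by (simp add: PiE_iff)
    ultimately show "c \<in> C - T" by (simp add: C_def T_def PiE_iff)
  qed
  then have "card (C - T) = (\<Prod>i\<in>I. if i \<in> W then n - 2 else n)"
    using I by (simp add: card_PiE if_distrib cong: if_cong)
  also have "\<dots> = (n - 2) ^ card W * n ^ card (I - W)"
    using I W by (simp add: prod.If_cases Int_absorb1 Diff_eq[symmetric] Int_commute)
  finally have "real (card (C - T)) = (real n - 2) ^ card W * real n ^ card (I - W)"
    using n by simp
  also have "(real n - 2) ^ card W = (1 - 2 / real n) ^ card W * real n ^ card W"
    using n by (simp add: power_mult_distrib[symmetric] algebra_simps)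
  also have "\<dots> * real n ^ card (I - W) = (1 - 2 / real n) ^ card W * real (n ^ card I)"
    using card_Diff_subset[OF finW W(1)] card_mono[OF I W(1)] by (simp add: power_add[symmetric])
  also have "\<dots> \<le> 1/2 * real (n ^ card I)" using n by (intro mult_right_mono) auto
  finally have "real (card C) - real (card T) \<le> 1/2 * real (n ^ card I)"
    using finC card_Diff_subset[of T C] card_mono[of C T] by (auto simp: T_def of_nat_diff)
  then have "real (n ^ card I) / 2 \<le> real (card T)" using cardC by simp
  then show ?thesis using T_le unfolding C_def f_def by linarith
qed

lemma card_colourings_avoiding:
  fixes n :: nat
  assumes I: "finite I" and i: "i \<in> I" and n: "n \<ge> 1"
  shows "real (card {c \<in> I \<rightarrow>\<^sub>E {..<n}. c i \<noteq> 0}) = (1 - 1 / real n) * real (n ^ card I)"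
proof -
  have "{c \<in> I \<rightarrow>\<^sub>E {..<n}. c i \<noteq> 0} = PiE I (\<lambda>j. if j = i then {1..<n} else {..<n})"
  proof (intro equalityI subsetI)
    fix c assume "c \<in> {c \<in> I \<rightarrow>\<^sub>E {..<n}. c i \<noteq> 0}"
    then show "c \<in> PiE I (\<lambda>j. if j = i then {1..<n} else {..<n})" using i by (auto simp: PiE_iff)
  next
    fix c assume c: "c \<in> PiE I (\<lambda>j. if j = i then {1..<n} else {..<n})"
    have mem: "c j \<in> (if j = i then {1..<n} else {..<n})" if "j \<in> I" for j
      using c that by (rule PiE_mem)
    have "c j < n" if "j \<in> I" for j using mem[OF that] by (auto split: if_splits)
    moreover have "c i \<noteq> 0" using mem[OF i] by auto
    moreover have "c \<in> extensional I" using c by (simp add: PiE_iff)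
    ultimately show "c \<in> {c \<in> I \<rightarrow>\<^sub>E {..<n}. c i \<noteq> 0}" by (simp add: PiE_iff)
  qed
  then have "card {c \<in> I \<rightarrow>\<^sub>E {..<n}. c i \<noteq> 0} = (\<Prod>j\<in>I. if j = i then n - 1 else n)"
    using I by (simp add: card_PiE if_distrib cong: if_cong)
  also have "\<dots> = (n - 1) * n ^ (card I - 1)"
    using I i by (simp add: prod.If_cases Diff_eq[symmetric] card_Diff_singleton)
  finally have "real (card {c \<in> I \<rightarrow>\<^sub>E {..<n}. c i \<noteq> 0}) = (real n - 1) * real n ^ (card I - 1)"
    using n by simp
  also have "\<dots> = (1 - 1 / real n) * (real n * real n ^ (card I - 1))"
    using n by (simp add: field_simps)
  also have "real n * real n ^ (card I - 1) = real (n ^ card I)"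
    using i I card_gt_0_iff[of I] by (cases "card I") auto
  finally show ?thesis .
qed

context prob_space
begin

lemma events_card_ge:
  assumes I: "finite I" and [measurable]: "\<And>i. i \<in> I \<Longrightarrow> {\<omega>\<in>space M. P i \<omega>} \<in> events"
  shows "{\<omega>\<in>space M. m \<le> card {i\<in>I. P i \<omega>}} \<in> events"
proof -
  have "real (card {i\<in>I. P i \<omega>}) = (\<Sum>i\<in>I. indicator {\<omega>\<in>space M. P i \<omega>} \<omega>)" if "\<omega> \<in> space M" for \<omega>
    using I that by (simp add: indicator_def sum.If_cases Int_def)
  then have "{\<omega>\<in>space M. m \<le> card {i\<in>I. P i \<omega>}}
      = {\<omega>\<in>space M. real m \<le> (\<Sum>i\<in>I. indicator {\<omega>\<in>space M. P i \<omega>} \<omega>)}"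
    by (intro Collect_cong conj_cong refl) (simp flip: of_nat_le_iff[where 'a = real])
  also have "\<dots> \<in> events" by measurable
  finally show ?thesis .
qed

lemma double_counting:
  assumes C: "finite C" and [measurable]: "\<And>c. c \<in> C \<Longrightarrow> E c \<in> events" "F \<in> events"
    and AE: "AE \<omega> in M. \<omega> \<in> F \<longrightarrow> k \<le> real (card {c\<in>C. \<omega> \<in> E c})"
  shows "k * prob F \<le> (\<Sum>c\<in>C. prob (E c))"
proof -
  have int: "integrable M (\<lambda>\<omega>. indicator (E c) \<omega> :: real)" if "c \<in> C" for c
    using that by (intro integrable_real_indicator) (auto simp: emeasure_eq_measure)
  have "k * prob F = (\<integral>\<omega>. k * indicator F \<omega> \<partial>M)" by simp
  also have "\<dots> \<le> (\<integral>\<omega>. (\<Sum>c\<in>C. indicator (E c) \<omega>) \<partial>M)"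
  proof (rule integral_mono_AE)
    show "integrable M (\<lambda>\<omega>. k * indicator F \<omega>)"
      by (intro integrable_mult_right integrable_real_indicator) (auto simp: emeasure_eq_measure)
    show "integrable M (\<lambda>\<omega>. \<Sum>c\<in>C. indicator (E c) \<omega> :: real)"
      by (intro Bochner_Integration.integrable_sum int)
    show "AE \<omega> in M. k * indicator F \<omega> \<le> (\<Sum>c\<in>C. indicator (E c) \<omega> :: real)"
      using AE
    proof eventually_elim
      case (elim \<omega>)
      have "(\<Sum>c\<in>C. indicator (E c) \<omega> :: real) = real (card {c\<in>C. \<omega> \<in> E c})"
        using C by (simp add: indicator_def sum.If_cases Int_def)
      then show ?case using elim by (auto simp: indicator_def)
    qed
  qed
  also have "\<dots> = (\<Sum>c\<in>C. prob (E c))"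
    by (subst Bochner_Integration.integral_sum[OF int]) auto
  finally show ?thesis .
qed

lemma tight_random_variable:
  fixes Y :: "'a \<Rightarrow> real"
  assumes [measurable]: "Y \<in> borel_measurable M" and e: "e > 0"
  shows "\<exists>K>0. prob {\<omega>\<in>space M. \<bar>Y \<omega>\<bar> > K} \<le> e"
proof -
  have "(\<lambda>n. prob {\<omega>\<in>space M. \<bar>Y \<omega>\<bar> > real n}) \<longlonglongrightarrow> prob (\<Inter>n. {\<omega>\<in>space M. \<bar>Y \<omega>\<bar> > real n})"
    by (rule finite_Lim_measure_decseq) (auto simp: decseq_def)
  also have "(\<Inter>n. {\<omega>\<in>space M. \<bar>Y \<omega>\<bar> > real n}) = {}"
    using reals_Archimedean2 not_less_iff_gr_or_eq by fastforce
  finally have "(\<lambda>n. prob {\<omega>\<in>space M. \<bar>Y \<omega>\<bar> > real n}) \<longlonglongrightarrow> 0" by simp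
  from LIMSEQ_D[OF this e] obtain n0 where n0: "\<And>n. n \<ge> n0 \<Longrightarrow> prob {\<omega>\<in>space M. \<bar>Y \<omega>\<bar> > real n} < e"
    by auto
  then show ?thesis using n0[of "Suc n0"] by (intro exI[of _ "real (Suc n0)"]) auto
qed

end

context stochastic_measure_space
begin

definition exceeds :: "real \<Rightarrow> 'b set \<Rightarrow> 'a set" where
  "exceeds K B = {\<omega>\<in>space M. \<bar>\<mu> B \<omega>\<bar> > K}"

lemma exceeds_events [measurable]: "B \<in> sets X \<Longrightarrow> exceeds K B \<in> events"
  unfolding exceeds_def by measurable

lemma exceeds_antimono: "K \<le> K' \<Longrightarrow> exceeds K' B \<subseteq> exceeds K B"
  by (auto simp: exceeds_def)

text \<open>The size \<open>r\<close> of the family is fixed before the size \<open>K\<close> of the measure. This is essential: cutting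
  sets into pieces along the family then costs only a constant factor in \<open>K\<close>.\<close>

definition spread :: "'b set \<Rightarrow> nat \<Rightarrow> real \<Rightarrow> bool" where
  "spread A r q \<longleftrightarrow> (\<forall>K. \<exists>\<B>. finite \<B> \<and> card \<B> \<le> r \<and> \<B> \<subseteq> sets X \<inter> Pow A
     \<and> q \<le> prob (\<Union>B\<in>\<B>. exceeds K B))"

text \<open>The range of \<open>\<mu>\<close> on the subsets of \<open>A\<close> is unbounded in probability iff \<open>reach A > 0\<close>. Compared with
  single large sets, admitting finite families makes the supremum stable: two events that almost attain
  it almost coincide.\<close>

definition reach :: "'b set \<Rightarrow> real" where
  "reach A = Sup {q. \<exists>r. spread A r q}"

lemma spread_le_1: "spread A r q \<Longrightarrow> q \<le> 1"
  unfolding spread_def using prob_le_1 order_trans by blast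

lemma bdd_above_spread: "bdd_above {q. \<exists>r. spread A r q}"
  using spread_le_1 by (intro bdd_aboveI[of _ 1]) auto

lemma spread_0: "spread A 0 0"
  unfolding spread_def by (auto intro!: exI[of _ "{}"])

lemma spread_le_reach: "spread A r q \<Longrightarrow> q \<le> reach A"
  unfolding reach_def using bdd_above_spread by (intro cSup_upper) auto

lemma reach_nonneg: "0 \<le> reach A"
  using spread_0 by (rule spread_le_reach)

lemma reach_le_1: "reach A \<le> 1"
  unfolding reach_def using spread_0 spread_le_1 by (intro cSup_least) auto

lemma spread_below_reach:
  assumes "q < reach A" shows "\<exists>r. spread A r q"
proof -
  obtain q' r where "q < q'" "spread A r q'"
    using assms less_cSup_iff[OF _ bdd_above_spread, of A q] spread_0 unfolding reach_def by blast
  then have "spread A r q"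
    unfolding spread_def by (meson less_imp_le order_trans)
  then show ?thesis by blast
qed

lemma reach_mono: "A \<subseteq> B \<Longrightarrow> reach A \<le> reach B"
proof -
  assume "A \<subseteq> B"
  then have "spread B r q" if "spread A r q" for r q
    using that unfolding spread_def by (meson Int_mono Pow_mono order_refl order_trans)
  then have sub: "{q. \<exists>r. spread A r q} \<subseteq> {q. \<exists>r. spread B r q}" by auto
  show ?thesis
    unfolding reach_def by (rule cSup_subset_mono[OF _ bdd_above_spread sub]) (use spread_0[of A] in blast)
qed

lemma prob_above_reach:
  assumes "reach A < q"
  shows "\<exists>K0. \<forall>K\<ge>K0. \<forall>\<B>. finite \<B> \<and> card \<B> \<le> r \<and> \<B> \<subseteq> sets X \<inter> Pow A
    \<longrightarrow> prob (\<Union>B\<in>\<B>. exceeds K B) < q"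
proof -
  have "\<not> spread A r q" using assms spread_le_reach by force
  then obtain K0 where K0: "\<And>\<B>. finite \<B> \<and> card \<B> \<le> r \<and> \<B> \<subseteq> sets X \<inter> Pow A
      \<Longrightarrow> prob (\<Union>B\<in>\<B>. exceeds K0 B) < q"
    unfolding spread_def by (meson not_less)
  show ?thesis
  proof (intro exI[of _ K0] allI impI)
    fix K \<B> assume K: "K0 \<le> K" and B: "finite \<B> \<and> card \<B> \<le> r \<and> \<B> \<subseteq> sets X \<inter> Pow A"
    have "prob (\<Union>B\<in>\<B>. exceeds K B) \<le> prob (\<Union>B\<in>\<B>. exceeds K0 B)"
    proof (rule finite_measure_mono)
      show "(\<Union>B\<in>\<B>. exceeds K0 B) \<in> events"
        using B by (intro sets.finite_UN exceeds_events) auto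
    qed (use exceeds_antimono[OF K] in blast)
    then show "prob (\<Union>B\<in>\<B>. exceeds K B) < q" using K0[OF B] by simp
  qed
qed

lemma AE_sm_union_of_atoms:
  assumes G: "finite G" "G \<subseteq> sets X" "A \<in> sets X" and "\<S> \<subseteq> Pow G"
  shows "AE \<omega> in M. \<mu> (\<Union>T\<in>\<S>. atom A G T) \<omega> = (\<Sum>T\<in>\<S>. \<mu> (atom A G T) \<omega>)"
proof (rule sm_finite_UN)
  show "finite \<S>" using finite_subset[OF assms(4)] G by simp
  show "disjoint_family_on (atom A G) \<S>"
    using atom_disjoint[of _ G _ A] assms(4) unfolding disjoint_family_on_def by blast
qed (use sets_atom[OF G] in auto)

lemma AE_sm_atom_pieces:
  assumes F: "finite F" "F \<subseteq> sets X" "A \<in> sets X" and B: "B \<in> sets X" "B \<subseteq> A"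
  shows "AE \<omega> in M. \<mu> B \<omega> = (\<Sum>S\<in>Pow F. \<mu> (B \<inter> atom A F S) \<omega>)"
proof -
  have "AE \<omega> in M. \<mu> (\<Union>S\<in>Pow F. B \<inter> atom A F S) \<omega> = (\<Sum>S\<in>Pow F. \<mu> (B \<inter> atom A F S) \<omega>)"
  proof (rule sm_finite_UN)
    show "disjoint_family_on (\<lambda>S. B \<inter> atom A F S) (Pow F)"
      using atom_disjoint[of _ F _ A] unfolding disjoint_family_on_def by blast
  qed (use sets_atom[OF F] F B in auto)
  then show ?thesis using UN_Int_atom[OF B(2), of F] by simp
qed

lemma events_many_large_atoms:
  assumes "finite F" "F \<subseteq> sets X" "A \<in> sets X"
  shows "{\<omega>\<in>space M. m \<le> card {S\<in>Pow F. \<bar>\<mu> (atom A F S) \<omega>\<bar> > K}} \<in> events"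
proof (rule events_card_ge)
  fix S
  have [measurable]: "atom A F S \<in> sets X" by (rule sets_atom[OF assms])
  show "{\<omega>\<in>space M. \<bar>\<mu> (atom A F S) \<omega>\<bar> > K} \<in> events" by measurable
qed (use assms in auto)

end

context stochastic_measure_space
begin

text \<open>The induction step uses that \<open>reach A\<close> is a supremum: the event that the atoms of \<open>F\<close> already
  contain the required number of large ones, and the event that a new family \<open>\<B>\<close> has a member of much larger measure,
  both have probability close to \<open>reach A\<close>, and so has their union, by maximality. Hence the two events
  almost coincide. On their intersection some atom is cut by a member of \<open>\<B>\<close> into two pieces of large
  measure, because the atom itself has moderate measure compared with the piece.\<close>

lemma many_large_atoms:
  assumes A: "A \<in> sets X" and q: "q < reach A"
  shows "\<exists>N. \<forall>K. \<exists>F. finite F \<and> card F \<le> N \<and> F \<subseteq> sets X \<and>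
    q \<le> prob {\<omega>\<in>space M. Suc m \<le> card {S\<in>Pow F. \<bar>\<mu> (atom A F S) \<omega>\<bar> > K}}"
  using q
proof (induction m arbitrary: q)
  case 0
  then obtain r where r: "spread A r q" using spread_below_reach by blast
  show ?case
  proof (intro exI[of _ r] allI)
    fix K :: real
    define L where "L = max K 1"
    obtain F where F: "finite F" "card F \<le> r" "F \<subseteq> sets X \<inter> Pow A"
      "q \<le> prob (\<Union>B\<in>F. exceeds (2 ^ r * L) B)"
      using r unfolding spread_def by meson
    then have Fs: "F \<subseteq> sets X" by auto
    let ?H = "{\<omega>\<in>space M. Suc 0 \<le> card {S\<in>Pow F. \<bar>\<mu> (atom A F S) \<omega>\<bar> > K}}"
    have "AE \<omega> in M. \<forall>B\<in>F. \<mu> B \<omega> = (\<Sum>S\<in>{S\<in>Pow F. B \<in> S}. \<mu> (atom A F S) \<omega>)"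
    proof (rule AE_finite_allI[OF F(1)])
      fix B assume B: "B \<in> F"
      have "B = B \<inter> atom A {} {}" using B F(3) by (auto simp: atom_def)
      also have "\<dots> = (\<Union>S\<in>{S\<in>Pow F. S \<inter> {} = {} \<and> B \<in> S}. atom A F S)"
        by (rule Int_atom_refine) (use B in auto)
      finally have "B = (\<Union>S\<in>{S\<in>Pow F. B \<in> S}. atom A F S)" by simp
      note eq = this
      have "AE \<omega> in M. \<mu> (\<Union>S\<in>{S\<in>Pow F. B \<in> S}. atom A F S) \<omega>
          = (\<Sum>S\<in>{S\<in>Pow F. B \<in> S}. \<mu> (atom A F S) \<omega>)"
        by (rule AE_sm_union_of_atoms[OF F(1) Fs A]) auto
      then show "AE \<omega> in M. \<mu> B \<omega> = (\<Sum>S\<in>{S\<in>Pow F. B \<in> S}. \<mu> (atom A F S) \<omega>)"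
        by (simp only: eq[symmetric])
    qed
    then have "AE \<omega> in M. \<omega> \<in> (\<Union>B\<in>F. exceeds (2 ^ r * L) B) \<longrightarrow> \<omega> \<in> ?H"
    proof eventually_elim
      case (elim \<omega>)
      show ?case
      proof
        assume "\<omega> \<in> (\<Union>B\<in>F. exceeds (2 ^ r * L) B)"
        then obtain B where B: "B \<in> F" "\<omega> \<in> space M" "\<bar>\<mu> B \<omega>\<bar> > 2 ^ r * L"
          by (auto simp: exceeds_def)
        have "\<exists>S\<in>{S\<in>Pow F. B \<in> S}. \<bar>\<mu> (atom A F S) \<omega>\<bar> > L"
        proof (rule exists_large_summand)
          have "card {S\<in>Pow F. B \<in> S} \<le> card (Pow F)" using F by (intro card_mono) auto
          also have "\<dots> = 2 ^ card F" using F by (simp add: card_Pow)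
          also have "\<dots> \<le> 2 ^ r" using F by (intro power_increasing) auto
          finally show "card {S\<in>Pow F. B \<in> S} \<le> 2 ^ r" .
          show "real (2 ^ r) * L < \<bar>\<Sum>S\<in>{S\<in>Pow F. B \<in> S}. \<mu> (atom A F S) \<omega>\<bar>"
            using B elim by simp
        qed (use F in \<open>auto simp: L_def\<close>)
        then obtain S where "S \<in> {S\<in>Pow F. \<bar>\<mu> (atom A F S) \<omega>\<bar> > K}" by (auto simp: L_def)
        moreover have "finite {S\<in>Pow F. \<bar>\<mu> (atom A F S) \<omega>\<bar> > K}" using F by auto
        ultimately show "\<omega> \<in> ?H" using B(2) by (auto simp: Suc_le_eq card_gt_0_iff)
      qed
    qed
    then have "prob (\<Union>B\<in>F. exceeds (2 ^ r * L) B) \<le> prob ?H"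
      using events_many_large_atoms[OF F(1) Fs A] by (intro finite_measure_mono_AE) auto
    then show "\<exists>F. finite F \<and> card F \<le> r \<and> F \<subseteq> sets X \<and> q \<le> prob
        {\<omega>\<in>space M. Suc 0 \<le> card {S\<in>Pow F. \<bar>\<mu> (atom A F S) \<omega>\<bar> > K}}"
      using F Fs by (intro exI[of _ F]) auto
  qed
next
  case (Suc m)
  define e where "e = (reach A - q) / 4"
  have e: "e > 0" "q = reach A - 4 * e" using Suc.prems by (auto simp: e_def field_simps)
  obtain N where N: "\<And>K. \<exists>F. finite F \<and> card F \<le> N \<and> F \<subseteq> sets X \<and> reach A - e \<le> prob
      {\<omega>\<in>space M. Suc m \<le> card {S\<in>Pow F. \<bar>\<mu> (atom A F S) \<omega>\<bar> > K}}"
    using Suc.IH[of "reach A - e"] e by auto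
  obtain r where r: "spread A r (reach A - e)"
    using spread_below_reach[of "reach A - e" A] e by auto
  have "reach A < reach A + e" using e by simp
  from prob_above_reach[OF this, of "2 ^ N + r"]
  obtain K0 where K0: "\<And>K \<B>. K \<ge> K0 \<Longrightarrow> finite \<B> \<and> card \<B> \<le> 2 ^ N + r \<and> \<B> \<subseteq> sets X \<inter> Pow A
      \<Longrightarrow> prob (\<Union>B\<in>\<B>. exceeds K B) < reach A + e"
    by blast
  show ?case
  proof (intro exI[of _ "N + r"] allI)
    fix K :: real
    define L where "L = max (2 ^ (N + r) * max K 1) K0"
    have L: "L \<ge> 2 ^ (N + r) * max K 1" "L \<ge> K0" by (auto simp: L_def)
    have L0: "L > 0" by (rule less_le_trans[OF _ L(1)]) simp
    obtain F where F: "finite F" "card F \<le> N" "F \<subseteq> sets X"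
      "reach A - e \<le> prob {\<omega>\<in>space M. Suc m \<le> card {S\<in>Pow F. \<bar>\<mu> (atom A F S) \<omega>\<bar> > L}}"
      using N[of L] by auto
    have mF[measurable]: "atom A F S \<in> sets X" for S by (rule sets_atom) (use F A in auto)
    obtain K1 where K1: "K1 > 0" "prob {\<omega>\<in>space M. \<bar>\<Sum>S\<in>Pow F. \<bar>\<mu> (atom A F S) \<omega>\<bar>\<bar> > K1} \<le> e"
      using tight_random_variable[of "\<lambda>\<omega>. \<Sum>S\<in>Pow F. \<bar>\<mu> (atom A F S) \<omega>\<bar>" e] e by auto
    define K2 where "K2 = 2 ^ N * (L + K1)"
    have K2: "K2 \<ge> L"
    proof -
      have "1 * (L + K1) \<le> K2" unfolding K2_def using L0 K1 by (intro mult_right_mono) auto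
      then show ?thesis using K1 by simp
    qed
    obtain \<B> where B: "finite \<B>" "card \<B> \<le> r" "\<B> \<subseteq> sets X \<inter> Pow A"
      "reach A - e \<le> prob (\<Union>B\<in>\<B>. exceeds K2 B)"
      using r unfolding spread_def by meson
    define G where "G = F \<union> \<B>"
    have G: "finite G" "F \<subseteq> G" "\<B> \<subseteq> G" "G \<subseteq> sets X" using F B by (auto simp: G_def)
    have cardG: "card G \<le> N + r" unfolding G_def using card_Un_le[of F \<B>] F B by linarith
    let ?H = "{\<omega>\<in>space M. Suc m \<le> card {S\<in>Pow F. \<bar>\<mu> (atom A F S) \<omega>\<bar> > L}}"
    let ?H' = "\<Union>B\<in>\<B>. exceeds K2 B"
    let ?Z = "{\<omega>\<in>space M. \<bar>\<Sum>S\<in>Pow F. \<bar>\<mu> (atom A F S) \<omega>\<bar>\<bar> > K1}"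
    let ?H'' = "{\<omega>\<in>space M. Suc (Suc m) \<le> card {T\<in>Pow G. \<bar>\<mu> (atom A G T) \<omega>\<bar> > K}}"
    have H_ev[measurable]: "?H \<in> events" by (rule events_many_large_atoms) (use F A in auto)
    have H'_ev[measurable]: "?H' \<in> events" using B by (intro sets.finite_UN exceeds_events) auto
    have H''_ev: "?H'' \<in> events" by (rule events_many_large_atoms) (use G A in auto)
    have Z_ev[measurable]: "?Z \<in> events" by measurable

    \<comment> \<open>Atoms of \<open>F\<close> and members of \<open>\<B>\<close> together are a family of bounded size, so that the union cannot
      have a larger probability than \<open>reach A\<close>, up to \<open>e\<close>.\<close>
    have "?H \<union> ?H' \<subseteq> (\<Union>B\<in>(atom A F ` Pow F \<union> \<B>). exceeds L B)"
    proof
      fix \<omega> assume "\<omega> \<in> ?H \<union> ?H'"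
      then consider "\<omega> \<in> ?H" | "\<omega> \<in> ?H'" by blast
      then show "\<omega> \<in> (\<Union>B\<in>(atom A F ` Pow F \<union> \<B>). exceeds L B)"
      proof cases
        case 1
        then have "card {S\<in>Pow F. \<bar>\<mu> (atom A F S) \<omega>\<bar> > L} \<noteq> 0" by (intro notI) simp
        then have "{S\<in>Pow F. \<bar>\<mu> (atom A F S) \<omega>\<bar> > L} \<noteq> {}" by (metis card.empty)
        then show ?thesis using 1 by (auto simp: exceeds_def)
      next
        case 2
        then show ?thesis using exceeds_antimono[OF K2] by blast
      qed
    qed
    then have "prob (?H \<union> ?H') \<le> prob (\<Union>B\<in>(atom A F ` Pow F \<union> \<B>). exceeds L B)"
      using F B by (intro finite_measure_mono sets.finite_UN exceeds_events) auto
    also have "\<dots> < reach A + e"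
    proof (rule K0[OF L(2)], intro conjI)
      have "card (atom A F ` Pow F) \<le> 2 ^ card F"
        using card_image_le[of "Pow F" "atom A F"] F by (simp add: card_Pow)
      also have "\<dots> \<le> 2 ^ N" using F by (intro power_increasing) auto
      finally show "card (atom A F ` Pow F \<union> \<B>) \<le> 2 ^ N + r"
        using card_Un_le[of "atom A F ` Pow F" \<B>] B by linarith
      show "atom A F ` Pow F \<union> \<B> \<subseteq> sets X \<inter> Pow A"
        using B(3) mF atom_subset[of A F] by blast
    qed (use F B in auto)
    finally have union: "prob (?H \<union> ?H') < reach A + e" .
    have "?H \<in> fmeasurable M" "?H' \<in> fmeasurable M" using H_ev H'_ev by (simp_all only: fmeasurable_eq_sets)
    then have "prob (?H \<union> ?H') = prob ?H + prob ?H' - prob (?H \<inter> ?H')" by (rule measure_Un3)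
    then have inter: "prob (?H \<inter> ?H') \<ge> reach A - 3 * e" using union F B by linarith

    have AE1: "AE \<omega> in M. \<forall>S\<in>Pow F. \<mu> (atom A F S) \<omega>
        = (\<Sum>T\<in>{T\<in>Pow G. T \<inter> F = S}. \<mu> (atom A G T) \<omega>)"
    proof (rule AE_finite_allI)
      fix S assume "S \<in> Pow F"
      then have eq: "atom A F S = (\<Union>T\<in>{T\<in>Pow G. T \<inter> F = S}. atom A G T)"
        by (intro atom_refine[OF G(2)]) auto
      show "AE \<omega> in M. \<mu> (atom A F S) \<omega> = (\<Sum>T\<in>{T\<in>Pow G. T \<inter> F = S}. \<mu> (atom A G T) \<omega>)"
        unfolding eq by (rule AE_sm_union_of_atoms[OF G(1,4) A]) auto
    qed (use F in auto)
    have AE2: "AE \<omega> in M. \<forall>(S, B)\<in>Pow F \<times> \<B>. \<mu> (B \<inter> atom A F S) \<omega>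
        = (\<Sum>T\<in>{T\<in>Pow G. T \<inter> F = S \<and> B \<in> T}. \<mu> (atom A G T) \<omega>)"
    proof (rule AE_finite_allI, unfold split_beta)
      fix p assume p: "p \<in> Pow F \<times> \<B>"
      have "fst p \<subseteq> F" "snd p \<in> G" using p G by auto
      then have eq: "snd p \<inter> atom A F (fst p)
          = (\<Union>T\<in>{T\<in>Pow G. T \<inter> F = fst p \<and> snd p \<in> T}. atom A G T)"
        by (rule Int_atom_refine[OF G(2)])
      show "AE \<omega> in M. \<mu> (snd p \<inter> atom A F (fst p)) \<omega>
          = (\<Sum>T\<in>{T\<in>Pow G. T \<inter> F = fst p \<and> snd p \<in> T}. \<mu> (atom A G T) \<omega>)"
        unfolding eq by (rule AE_sm_union_of_atoms[OF G(1,4) A]) auto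
    qed (use F B in auto)
    have AE3: "AE \<omega> in M. \<forall>B\<in>\<B>. \<mu> B \<omega> = (\<Sum>S\<in>Pow F. \<mu> (B \<inter> atom A F S) \<omega>)"
      using B by (intro AE_finite_allI AE_sm_atom_pieces F A) auto
    have "AE \<omega> in M. \<omega> \<in> ?H \<inter> ?H' \<longrightarrow> \<omega> \<in> ?Z \<union> ?H''"
      using AE1 AE2 AE3
    proof eventually_elim
      case (elim \<omega>)
      show ?case
      proof
        assume \<omega>: "\<omega> \<in> ?H \<inter> ?H'"
        then have sp: "\<omega> \<in> space M" by auto
        have "\<omega> \<in> ?H''" if nZ: "\<omega> \<notin> ?Z"
        proof -
          obtain B where BB: "B \<in> \<B>" "\<bar>\<mu> B \<omega>\<bar> > K2" using \<omega> by (auto simp: exceeds_def)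
          have "\<exists>S\<in>Pow F. \<bar>\<mu> (B \<inter> atom A F S) \<omega>\<bar> > L + K1"
          proof (rule exists_large_summand)
            show "card (Pow F) \<le> 2 ^ N" using F by (simp add: card_Pow power_increasing)
            show "real (2 ^ N) * (L + K1) < \<bar>\<Sum>S\<in>Pow F. \<mu> (B \<inter> atom A F S) \<omega>\<bar>"
              using BB elim(3) by (simp add: K2_def)
          qed (use F L0 K1 in auto)
          then obtain S0 where S0: "S0 \<in> Pow F" "\<bar>\<mu> (B \<inter> atom A F S0) \<omega>\<bar> > L + K1" by blast
          have "\<bar>\<mu> (atom A F S0) \<omega>\<bar> \<le> (\<Sum>S\<in>Pow F. \<bar>\<mu> (atom A F S) \<omega>\<bar>)"
            using F S0 by (intro member_le_sum) auto
          also have "\<dots> \<le> K1" using nZ sp by auto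
          finally have cut: "\<bar>\<mu> (B \<inter> atom A F S0) \<omega>\<bar> > L"
            "\<bar>\<mu> (atom A F S0) \<omega> - \<mu> (B \<inter> atom A F S0) \<omega>\<bar> > L"
            using S0 K1 by linarith+
          let ?K = "max K 1"
          have L_ge: "2 ^ card G * ?K \<le> L"
          proof -
            have "2 ^ card G * ?K \<le> 2 ^ (N + r) * ?K"
              using cardG by (intro mult_right_mono power_increasing) auto
            then show ?thesis using L by simp
          qed
          let ?y = "\<lambda>T. \<mu> (atom A G T) \<omega>"
          have eq1: "(\<Sum>T\<in>{T\<in>Pow G. T \<inter> F = S}. ?y T) = \<mu> (atom A F S) \<omega>" if "S \<in> Pow F" for S
            using elim(1) that by simp
          have eq2: "(\<Sum>T\<in>{T\<in>Pow G. T \<inter> F = S0 \<and> B \<in> T}. ?y T) = \<mu> (B \<inter> atom A F S0) \<omega>"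
            using bspec[OF elim(2), of "(S0, B)"] S0 BB by simp
          have "Suc (card {S\<in>Pow F. \<bar>\<Sum>T\<in>{T\<in>Pow G. T \<inter> F = S}. ?y T\<bar> > 2 ^ card G * ?K})
              \<le> card {T\<in>Pow G. \<bar>?y T\<bar> > ?K}"
          proof (rule count_large_refined[OF G(1,2)])
            show "2 ^ card G * ?K < \<bar>\<Sum>T\<in>{T\<in>Pow G. T \<inter> F = S0 \<and> B \<in> T}. ?y T\<bar>"
              unfolding eq2 using cut L_ge by linarith
            show "2 ^ card G * ?K < \<bar>(\<Sum>T\<in>{T\<in>Pow G. T \<inter> F = S0}. ?y T)
                - (\<Sum>T\<in>{T\<in>Pow G. T \<inter> F = S0 \<and> B \<in> T}. ?y T)\<bar>"
              unfolding eq2 eq1[OF S0(1)] using cut L_ge by linarith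
          qed (use S0 in auto)
          moreover have "card {S\<in>Pow F. \<bar>\<mu> (atom A F S) \<omega>\<bar> > L}
              \<le> card {S\<in>Pow F. \<bar>\<Sum>T\<in>{T\<in>Pow G. T \<inter> F = S}. ?y T\<bar> > 2 ^ card G * ?K}"
          proof (intro card_mono subsetI CollectI conjI)
            fix S assume S: "S \<in> {S\<in>Pow F. \<bar>\<mu> (atom A F S) \<omega>\<bar> > L}"
            then show SF: "S \<in> Pow F" by blast
            have "\<bar>\<mu> (atom A F S) \<omega>\<bar> > L" using S by blast
            then show "\<bar>\<Sum>T\<in>{T\<in>Pow G. T \<inter> F = S}. ?y T\<bar> > 2 ^ card G * ?K"
              unfolding eq1[OF SF] using L_ge by linarith
          qed (use F in simp)
          moreover have "card {T\<in>Pow G. \<bar>?y T\<bar> > ?K} \<le> card {T\<in>Pow G. \<bar>?y T\<bar> > K}"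
            using G by (intro card_mono) auto
          moreover have "Suc m \<le> card {S\<in>Pow F. \<bar>\<mu> (atom A F S) \<omega>\<bar> > L}" using \<omega> by blast
          ultimately have "Suc (Suc m) \<le> card {T\<in>Pow G. \<bar>?y T\<bar> > K}" by linarith
          then show ?thesis using sp by simp
        qed
        then show "\<omega> \<in> ?Z \<union> ?H''" by blast
      qed
    qed
    then have "prob (?H \<inter> ?H') \<le> prob (?Z \<union> ?H'')"
      using H''_ev by (intro finite_measure_mono_AE) auto
    also have "\<dots> \<le> prob ?Z + prob ?H''" using H''_ev by (intro measure_Un_le) auto
    finally have "q \<le> prob ?H''" using inter K1 e by linarith
    then show "\<exists>F. finite F \<and> card F \<le> N + r \<and> F \<subseteq> sets X \<and> q \<le> prob
        {\<omega>\<in>space M. Suc (Suc m) \<le> card {S\<in>Pow F. \<bar>\<mu> (atom A F S) \<omega>\<bar> > K}}"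
      using G cardG by (intro exI[of _ G]) auto
  qed
qed

text \<open>Colour the atoms of a fine partition at random with \<open>n\<close> colours and let \<open>D\<close> consist of colour
  \<open>0\<close>. If there are many large atoms, then \<open>\<mu> D\<close> is large with a probability that does not depend on
  \<open>n\<close>. On the other hand, an \<open>\<omega>\<close> that sees arbitrarily large measures sees them inside some atom, which
  survives in \<open>A - D\<close> with probability \<open>1 - 1 / n\<close>; so \<open>reach\<close> hardly decreases.\<close>

lemma split_off_large_part:
  assumes A: "A \<in> sets X" and g: "reach A > 0" and eta: "\<eta> > 0"
  shows "\<exists>D\<in>sets X. D \<subseteq> A \<and> prob (exceeds 1 D) \<ge> reach A / 16 \<and> reach (A - D) \<ge> reach A - \<eta>"
proof -
  define g where "g = reach A"
  have g: "g > 0" "g \<le> 1" using assms reach_le_1 by (auto simp: g_def)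
  define e where "e = min (g / 2) (\<eta> * g / 64)"
  have e: "e > 0" "e \<le> g / 2" "e \<le> \<eta> * g / 64" using g eta by (auto simp: e_def)
  obtain n0 :: nat where n0: "64 / (\<eta> * g) < real n0" using reals_Archimedean2 by blast
  define n where "n = n0 + 3"
  have n: "n \<ge> 3" "64 / (\<eta> * g) < real n" using n0 by (auto simp: n_def)
  have inv_n: "1 / real n \<le> \<eta> * g / 64" using n g eta by (simp add: field_simps)
  have base: "0 \<le> 1 - 2 / real n" "1 - 2 / real n < 1" using n by (auto simp: field_simps)
  then obtain m where m: "(1 - 2 / real n) ^ m < 1/2" using real_arch_pow_inv[of "1/2" "1 - 2 / real n"] by auto
  have pow: "(1 - 2 / real n) ^ k \<le> 1/2" if "Suc m \<le> k" for k
  proof -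
    have "(1 - 2 / real n) ^ k \<le> (1 - 2 / real n) ^ m" using that base by (intro power_decreasing) auto
    then show ?thesis using m by simp
  qed
  have "g - e < reach A" using e by (simp add: g_def)
  from many_large_atoms[OF A this, of m] obtain F where F: "finite F" "F \<subseteq> sets X"
    "g - e \<le> prob {\<omega>\<in>space M. Suc m \<le> card {S\<in>Pow F. \<bar>\<mu> (atom A F S) \<omega>\<bar> > 2}}"
    by blast
  let ?H = "{\<omega>\<in>space M. Suc m \<le> card {S\<in>Pow F. \<bar>\<mu> (atom A F S) \<omega>\<bar> > 2}}"
  have mF[measurable]: "atom A F S \<in> sets X" for S by (rule sets_atom) (use F A in auto)
  have H_ev[measurable]: "?H \<in> events" by (rule events_many_large_atoms) (use F A in auto)
  define C where "C = Pow F \<rightarrow>\<^sub>E {..<n}"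
  have C: "finite C" "card C = n ^ card (Pow F)"
    using F by (auto simp: C_def finite_PiE card_PiE)
  have Cpos: "real (card C) > 0" using C n by simp
  define D where "D c = (\<Union>S\<in>{S\<in>Pow F. c S = 0}. atom A F S)" for c :: "'b set set \<Rightarrow> nat"
  have D_sets[measurable]: "D c \<in> sets X" for c
    unfolding D_def using F by (intro sets.finite_UN) auto

  \<comment> \<open>On average over the colourings \<open>c\<close>, the set \<open>D c\<close> has large measure.\<close>
  have "real (card C) / 4 * prob ?H \<le> (\<Sum>c\<in>C. prob (exceeds 1 (D c)))"
  proof (rule double_counting[OF C(1)])
    have "AE \<omega> in M. \<forall>c\<in>C. \<mu> (D c) \<omega> = (\<Sum>S\<in>{S\<in>Pow F. c S = 0}. \<mu> (atom A F S) \<omega>)"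
      unfolding D_def by (intro AE_finite_allI C(1) AE_sm_union_of_atoms F A) auto
    then show "AE \<omega> in M. \<omega> \<in> ?H \<longrightarrow> real (card C) / 4 \<le> real (card {c\<in>C. \<omega> \<in> exceeds 1 (D c)})"
    proof eventually_elim
      case (elim \<omega>)
      show ?case
      proof
        assume \<omega>: "\<omega> \<in> ?H"
        let ?W = "{S\<in>Pow F. \<bar>\<mu> (atom A F S) \<omega>\<bar> > 2}"
        have "real (n ^ card (Pow F)) / 4
          \<le> real (card {c \<in> Pow F \<rightarrow>\<^sub>E {..<n}. \<bar>\<Sum>S\<in>{S\<in>Pow F. c S = 0}. \<mu> (atom A F S) \<omega>\<bar> > 1})"
          by (rule many_colourings_with_large_sum[where W = ?W])
             (use F n \<omega> pow[of "card ?W"] in auto)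
        also have "{c \<in> Pow F \<rightarrow>\<^sub>E {..<n}. \<bar>\<Sum>S\<in>{S\<in>Pow F. c S = 0}. \<mu> (atom A F S) \<omega>\<bar> > 1}
            = {c\<in>C. \<omega> \<in> exceeds 1 (D c)}"
          using elim \<omega> by (intro Collect_cong) (auto simp: C_def exceeds_def)
        finally show "real (card C) / 4 \<le> real (card {c\<in>C. \<omega> \<in> exceeds 1 (D c)})" by (simp add: C)
      qed
    qed
    show "?H \<in> events" by (rule H_ev)
  qed measurable
  moreover have "real (card C) / 4 * (g / 2) \<le> real (card C) / 4 * prob ?H"
    using F(3) e by (intro mult_left_mono) auto
  moreover have "real (card C) * (g / 8) = real (card C) / 4 * (g / 2)" by simp
  ultimately have large: "real (card C) * (g / 8) \<le> (\<Sum>c\<in>C. prob (exceeds 1 (D c)))" by linarith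

  \<comment> \<open>On average, \<open>reach (A - D c)\<close> is almost \<open>g\<close>. As there are only finitely many colourings, one bound
    \<open>K\<close> serves all of them.\<close>
  obtain r where r: "spread A r (g - e)"
    using spread_below_reach[of "g - e" A] e by (auto simp: g_def)
  have "\<forall>c\<in>C. \<exists>K0. \<forall>K\<ge>K0. \<forall>\<B>. finite \<B> \<and> card \<B> \<le> r * 2 ^ card F \<and> \<B> \<subseteq> sets X \<inter> Pow (A - D c)
    \<longrightarrow> prob (\<Union>B\<in>\<B>. exceeds K B) < reach (A - D c) + e"
    using prob_above_reach e by (meson less_add_same_cancel1)
  then obtain k where k: "\<And>c K \<B>. c \<in> C \<Longrightarrow> K \<ge> k c \<Longrightarrow> finite \<B> \<Longrightarrow> card \<B> \<le> r * 2 ^ card F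
      \<Longrightarrow> \<B> \<subseteq> sets X \<inter> Pow (A - D c) \<Longrightarrow> prob (\<Union>B\<in>\<B>. exceeds K B) < reach (A - D c) + e"
    by metis
  define K where "K = Max (insert 0 (k ` C))"
  have K: "K \<ge> 0" "\<And>c. c \<in> C \<Longrightarrow> k c \<le> K" using C by (auto simp: K_def)
  obtain \<B> where B: "finite \<B>" "card \<B> \<le> r" "\<B> \<subseteq> sets X \<inter> Pow A"
    "g - e \<le> prob (\<Union>B\<in>\<B>. exceeds (2 ^ card F * K) B)"
    using r unfolding spread_def by meson
  let ?H' = "\<Union>B\<in>\<B>. exceeds (2 ^ card F * K) B"
  have H'_ev[measurable]: "?H' \<in> events" using B by (intro sets.finite_UN exceeds_events) auto
  define \<C> where "\<C> c = (\<lambda>(B, S). B \<inter> atom A F S) ` (\<B> \<times> {S\<in>Pow F. c S \<noteq> 0})" for c :: "'b set set \<Rightarrow> nat"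
  have \<C>_fin: "finite (\<C> c)" for c unfolding \<C>_def using F B by auto
  have \<C>_sets: "\<C> c \<subseteq> sets X" for c unfolding \<C>_def using B by auto
  have \<C>_sub: "\<C> c \<subseteq> Pow (A - D c)" for c
  proof -
    have "atom A F S \<inter> D c = {}" if S: "S \<in> Pow F" "c S \<noteq> 0" for S
    proof -
      have "atom A F S \<inter> atom A F T = {}" if "T \<in> Pow F" "c T = 0" for T
        using S that by (intro atom_disjoint) auto
      then show ?thesis unfolding D_def by blast
    qed
    then have "B \<inter> atom A F S \<subseteq> A - D c" if "S \<in> Pow F" "c S \<noteq> 0" for B S
      using that atom_subset[of A F S] by blast
    then show ?thesis unfolding \<C>_def by auto
  qed
  have \<C>_card: "card (\<C> c) \<le> r * 2 ^ card F" for c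
  proof -
    have "card (\<C> c) \<le> card (\<B> \<times> {S\<in>Pow F. c S \<noteq> 0})"
      unfolding \<C>_def using F B by (intro card_image_le) auto
    also have "\<dots> = card \<B> * card {S\<in>Pow F. c S \<noteq> 0}" by (rule card_cartesian_product)
    also have "\<dots> \<le> r * card (Pow F)" using B F by (intro mult_mono card_mono) auto
    finally show ?thesis using F by (simp add: card_Pow)
  qed
  have "(1 - 1 / real n) * real (card C) * prob ?H' \<le> (\<Sum>c\<in>C. prob (\<Union>B\<in>\<C> c. exceeds K B))"
  proof (rule double_counting[OF C(1)])
    show "(\<Union>B\<in>\<C> c. exceeds K B) \<in> events" for c
      using \<C>_fin \<C>_sets by (intro sets.finite_UN exceeds_events) auto
    have "AE \<omega> in M. \<forall>B\<in>\<B>. \<mu> B \<omega> = (\<Sum>S\<in>Pow F. \<mu> (B \<inter> atom A F S) \<omega>)"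
      using B by (intro AE_finite_allI AE_sm_atom_pieces F A) auto
    then show "AE \<omega> in M. \<omega> \<in> ?H' \<longrightarrow>
        (1 - 1 / real n) * real (card C) \<le> real (card {c\<in>C. \<omega> \<in> (\<Union>B\<in>\<C> c. exceeds K B)})"
    proof eventually_elim
      case (elim \<omega>)
      show ?case
      proof
        assume \<omega>: "\<omega> \<in> ?H'"
        then obtain B where BB: "B \<in> \<B>" "\<omega> \<in> space M" "\<bar>\<mu> B \<omega>\<bar> > 2 ^ card F * K"
          by (auto simp: exceeds_def)
        have "\<exists>S\<in>Pow F. \<bar>\<mu> (B \<inter> atom A F S) \<omega>\<bar> > K"
          by (rule exists_large_summand[of _ "2 ^ card F"]) (use BB elim F K in \<open>auto simp: card_Pow\<close>)
        then obtain S where S: "S \<in> Pow F" "\<bar>\<mu> (B \<inter> atom A F S) \<omega>\<bar> > K" by blast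
        have "(1 - 1 / real n) * real (card C) = real (card {c \<in> C. c S \<noteq> 0})"
          unfolding C(2) unfolding C_def
          by (rule card_colourings_avoiding[symmetric]) (use F S n in auto)
        also have "\<dots> \<le> real (card {c\<in>C. \<omega> \<in> (\<Union>B\<in>\<C> c. exceeds K B)})"
          unfolding of_nat_le_iff
        proof (rule card_mono)
          show "{c \<in> C. c S \<noteq> 0} \<subseteq> {c\<in>C. \<omega> \<in> (\<Union>B\<in>\<C> c. exceeds K B)}"
          proof
            fix c assume c: "c \<in> {c \<in> C. c S \<noteq> 0}"
            then have "B \<inter> atom A F S \<in> \<C> c"
              unfolding \<C>_def using BB S by (intro image_eqI[of _ _ "(B, S)"]) auto
            moreover have "\<omega> \<in> exceeds K (B \<inter> atom A F S)" using BB S by (simp add: exceeds_def)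
            ultimately show "c \<in> {c\<in>C. \<omega> \<in> (\<Union>B\<in>\<C> c. exceeds K B)}" using c by blast
          qed
          show "finite {c\<in>C. \<omega> \<in> (\<Union>B\<in>\<C> c. exceeds K B)}" using C by simp
        qed
        finally show "(1 - 1 / real n) * real (card C)
            \<le> real (card {c\<in>C. \<omega> \<in> (\<Union>B\<in>\<C> c. exceeds K B)})" .
      qed
    qed
  qed measurable
  also have "\<dots> \<le> (\<Sum>c\<in>C. reach (A - D c) + e)"
    using k[OF _ K(2) \<C>_fin \<C>_card] \<C>_sets \<C>_sub by (intro sum_mono less_imp_le) blast
  also have "\<dots> = (\<Sum>c\<in>C. reach (A - D c)) + real (card C) * e" by (simp add: sum.distrib)
  finally have "(1 - 1 / real n) * real (card C) * prob ?H'
      \<le> (\<Sum>c\<in>C. reach (A - D c)) + real (card C) * e" .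
  moreover have "(1 - 1 / real n) * real (card C) * (g - e) \<le> (1 - 1 / real n) * real (card C) * prob ?H'"
    using B(4) n Cpos by (intro mult_left_mono) auto
  ultimately have reach_sum: "(1 - 1 / real n) * real (card C) * (g - e) - real (card C) * e
      \<le> (\<Sum>c\<in>C. reach (A - D c))" by linarith

  \<comment> \<open>Both averages are optimised at once by averaging a suitable combination of the two quantities.\<close>
  have "\<exists>c\<in>C. g / 16 \<le> prob (exceeds 1 (D c)) - (g - reach (A - D c)) / \<eta>"
  proof (rule ccontr)
    assume "\<not> ?thesis"
    then have "(\<Sum>c\<in>C. prob (exceeds 1 (D c)) - (g - reach (A - D c)) / \<eta>) < (\<Sum>c\<in>C. g / 16)"
      using C Cpos by (intro sum_strict_mono) (auto simp: not_le)
    also have "(\<Sum>c\<in>C. prob (exceeds 1 (D c)) - (g - reach (A - D c)) / \<eta>)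
        = (\<Sum>c\<in>C. prob (exceeds 1 (D c))) - (real (card C) * g - (\<Sum>c\<in>C. reach (A - D c))) / \<eta>"
      by (simp add: sum_subtractf sum_divide_distrib[symmetric])
    finally have "(\<Sum>c\<in>C. prob (exceeds 1 (D c))) - (real (card C) * g - (\<Sum>c\<in>C. reach (A - D c))) / \<eta>
        < real (card C) * (g / 16)" by simp
    moreover have "(real (card C) * g - (\<Sum>c\<in>C. reach (A - D c))) / \<eta> \<le> real (card C) * (g / 16)"
    proof -
      have "real (card C) * g - (\<Sum>c\<in>C. reach (A - D c))
          \<le> real (card C) * (g - (1 - 1 / real n) * (g - e) + e)"
        using reach_sum by (simp add: algebra_simps)
      also have "\<dots> \<le> real (card C) * (\<eta> * (g / 16))"
      proof (rule mult_left_mono)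
        have "(1 / real n) * (g - e) \<le> (1 / real n) * 1" using g e by (intro mult_left_mono) auto
        then have "g - (1 - 1 / real n) * (g - e) + e \<le> 1 / real n + 2 * e" by (simp add: algebra_simps)
        also have "\<dots> \<le> 3 * (\<eta> * g / 64)" using inv_n e by linarith
        also have "\<dots> \<le> \<eta> * (g / 16)" using g eta by simp
        finally show "g - (1 - 1 / real n) * (g - e) + e \<le> \<eta> * (g / 16)" .
      qed simp
      finally show ?thesis using eta by (simp add: field_simps)
    qed
    ultimately show False using large by linarith
  qed
  then obtain c where c: "c \<in> C" "g / 16 \<le> prob (exceeds 1 (D c)) - (g - reach (A - D c)) / \<eta>" by blast
  have "reach (A - D c) \<le> g" unfolding g_def by (rule reach_mono) auto
  then have "(g - reach (A - D c)) / \<eta> \<ge> 0" using eta by simp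
  then have 1: "prob (exceeds 1 (D c)) \<ge> g / 16" using c by linarith
  have "(g - reach (A - D c)) / \<eta> \<le> 1" using c prob_le_1[of "exceeds 1 (D c)"] g by linarith
  then have 2: "reach (A - D c) \<ge> g - \<eta>" using eta by (simp add: field_simps)
  have "D c \<subseteq> A" unfolding D_def using atom_subset[of A F] by blast
  then show ?thesis using 1 2 D_sets unfolding g_def by blast
qed

text \<open>If \<open>reach\<close> were positive somewhere, repeated splitting would give disjoint sets whose measures do not
  tend to \<open>0\<close>.\<close>

lemma reach_eq_0:
  assumes A: "A \<in> sets X"
  shows "reach A = 0"
proof (rule ccontr)
  assume "reach A \<noteq> 0"
  define g where "g = reach A"
  have g: "g > 0" using reach_nonneg[of A] \<open>reach A \<noteq> 0\<close> by (simp add: g_def)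
  \<comment> \<open>Step \<open>j\<close> may lose \<open>g / 2 ^ (j + 2)\<close>, so that \<open>reach\<close> stays above \<open>g / 2\<close> for ever.\<close>
  define P where "P j B \<longleftrightarrow> B \<in> sets X \<and> reach B \<ge> g / 2 + g / 2 ^ (j + 1)" for j B
  define Q where "Q j B B' \<longleftrightarrow> B' \<subseteq> B \<and> prob (exceeds 1 (B - B')) \<ge> g / 32" for j :: nat and B B'
  have "\<exists>f. \<forall>j. P j (f j) \<and> Q j (f j) (f (Suc j))"
  proof (rule dependent_nat_choice)
    show "\<exists>B. P 0 B" using A by (auto simp: P_def g_def)
  next
    fix B j assume "P j B"
    then have B: "B \<in> sets X" "reach B \<ge> g / 2 + g / 2 ^ (j + 1)" by (auto simp: P_def)
    have pos: "g / 2 ^ (j + 1) > 0" using g by simp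
    have "reach B > 0" using B(2) pos g by linarith
    moreover have "g / 2 ^ (j + 2) > 0" using g by simp
    note split_off_large_part[OF B(1) calculation this]
    from this obtain D where
      D: "D \<in> sets X" "D \<subseteq> B" "prob (exceeds 1 D) \<ge> reach B / 16" "reach (B - D) \<ge> reach B - g / 2 ^ (j + 2)"
      by blast
    have "P (Suc j) (B - D)" using B D by (auto simp: P_def field_simps)
    moreover have "B - (B - D) = D" using D by auto
    then have "Q j B (B - D)" using D B pos by (auto simp: Q_def)
    ultimately show "\<exists>B'. P (Suc j) B' \<and> Q j B B'" by blast
  qed
  then obtain f where f: "\<And>j. P j (f j)" "\<And>j. Q j (f j) (f (Suc j))" by blast
  have f_sets[measurable]: "f j \<in> sets X" for j using f(1)[of j] by (simp add: P_def)
  have dec: "decseq f" by (rule decseq_SucI) (use f(2) in \<open>auto simp: Q_def\<close>)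
  define E where "E j = f j - f (Suc j)" for j
  have [measurable]: "E j \<in> sets X" for j by (auto simp: E_def)
  have disj: "E i \<inter> E j = {}" if "i < j" for i j
    using decseqD[OF dec, of "Suc i" j] that by (auto simp: E_def)
  have "disjoint_family E" unfolding disjoint_family_on_def
  proof (intro ballI impI)
    fix i j :: nat assume "i \<noteq> j"
    then show "E i \<inter> E j = {}" using disj[of i j] disj[of j i] by (cases "i < j") auto
  qed
  then have lim: "(\<lambda>j. L0_norm M (\<mu> (E j))) \<longlonglongrightarrow> 0" by (intro L0_norm_disjoint_tendsto_0) auto
  have "g / 32 \<le> L0_norm M (\<mu> (E j))" for j
  proof -
    have "g / 32 \<le> prob (exceeds 1 (E j))" using f(2)[of j] by (simp add: Q_def E_def)
    also have "\<dots> \<le> L0_norm M (\<mu> (E j)) / 1" unfolding exceeds_def by (rule prob_le_L0_norm) auto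
    finally show ?thesis by simp
  qed
  then have "g / 32 \<le> 0" by (intro LIMSEQ_le_const[OF lim]) auto
  then show False using g by simp
qed

theorem range_bounded_in_prob:
  assumes e: "e > 0"
  shows "\<exists>K>0. \<forall>A\<in>sets X. prob {\<omega>\<in>space M. \<bar>\<mu> A \<omega>\<bar> > K} \<le> e"
proof -
  have "reach (space X) < e" using reach_eq_0[of "space X"] e by simp
  from prob_above_reach[OF this, of 1] obtain K0 where
    K0: "\<And>K \<B>. K \<ge> K0 \<Longrightarrow> finite \<B> \<and> card \<B> \<le> 1 \<and> \<B> \<subseteq> sets X \<inter> Pow (space X)
      \<Longrightarrow> prob (\<Union>B\<in>\<B>. exceeds K B) < e" by blast
  have "prob (exceeds (max K0 1) A) \<le> e" if "A \<in> sets X" for A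
    using K0[of "max K0 1" "{A}"] that sets.sets_into_space[OF that] by auto
  then show ?thesis by (intro exI[of _ "max K0 1"]) (auto simp: exceeds_def)
qed

end

section \<open>Nikodym's theorem for stochastic measures\<close>

context prob_space
begin

lemma setwise_limit_split:
  assumes sm: "\<And>n. stochastic_measure M X (\<nu> n)"
    and N: "\<And>A. A \<in> sets X \<Longrightarrow> N A \<in> borel_measurable M"
    and lim: "\<And>A. A \<in> sets X \<Longrightarrow> tendsto_in_prob M (\<lambda>n. \<nu> n A) (N A)"
    and A: "A \<in> sets X" "B \<in> sets X"
  shows "AE \<omega> in M. N A \<omega> = N (A \<inter> B) \<omega> + N (A - B) \<omega>"
proof -
  have sp: "stochastic_measure_space M X (\<nu> n)" for n
    by (simp add: stochastic_measure_space_def stochastic_measure_space_axioms_def sm prob_space_axioms)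
  note [measurable] = stochastic_measure_space.measurable_sm[OF sp] N
  note [measurable] = A
  have "tendsto_in_prob M (\<lambda>n \<omega>. \<nu> n (A \<inter> B) \<omega> + \<nu> n (A - B) \<omega>) (\<lambda>\<omega>. N (A \<inter> B) \<omega> + N (A - B) \<omega>)"
    using A by (intro tendsto_in_prob_add lim N stochastic_measure_space.measurable_sm[OF sp]) auto
  moreover have "tendsto_in_prob M (\<lambda>n \<omega>. \<nu> n (A \<inter> B) \<omega> + \<nu> n (A - B) \<omega>) (N A)
      \<longleftrightarrow> tendsto_in_prob M (\<lambda>n. \<nu> n A) (N A)"
  proof (rule tendsto_in_prob_cong_AE)
    show "AE \<omega> in M. \<nu> n (A \<inter> B) \<omega> + \<nu> n (A - B) \<omega> = \<nu> n A \<omega>" for n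
      using stochastic_measure_space.sm_split[OF sp A, of n] by eventually_elim simp
  qed (use A in \<open>auto intro!: N stochastic_measure_space.measurable_sm[OF sp] borel_measurable_add\<close>)
  ultimately show ?thesis
    using lim[OF A(1)]
    using A by (intro tendsto_in_prob_unique[where Y = "\<lambda>n \<omega>. \<nu> n (A \<inter> B) \<omega> + \<nu> n (A - B) \<omega>"])
      (auto intro!: N stochastic_measure_space.measurable_sm[OF sp] borel_measurable_add)
qed

text \<open>A gliding hump again. Assume that \<open>N (B k)\<close> stays large. A set \<open>E\<close> is assembled from pieces of the
  \<open>B k\<close> in such a way that, at infinitely many stages, a later measure \<open>\<nu> l\<close> sees a large piece that
  the current measure \<open>\<nu> n\<close> does not see yet, while both nearly agree on what has been assembled before.
  Then \<open>\<nu> n E\<close> is not a Cauchy sequence.\<close>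

theorem nikodym_continuity_from_above:
  assumes sm: "\<And>n. stochastic_measure M X (\<nu> n)"
    and N: "\<And>A. A \<in> sets X \<Longrightarrow> N A \<in> borel_measurable M"
    and lim: "\<And>A. A \<in> sets X \<Longrightarrow> tendsto_in_prob M (\<lambda>n. \<nu> n A) (N A)"
    and B: "range B \<subseteq> sets X" "decseq B" "(\<Inter>k::nat. B k) = {}"
  shows "(\<lambda>k. L0_norm M (N (B k))) \<longlonglongrightarrow> 0"
proof (rule ccontr)
  assume contr: "\<not> ?thesis"
  have sp: "stochastic_measure_space M X (\<nu> n)" for n
    by (simp add: stochastic_measure_space_def stochastic_measure_space_axioms_def sm prob_space_axioms)
  note [measurable] = stochastic_measure_space.measurable_sm[OF sp] N
  have B_sets[measurable]: "B k \<in> sets X" for k using B by auto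
  have dec: "B j \<subseteq> B i" if "i \<le> j" for i j using decseqD[OF B(2) that] .
  let ?d = "\<lambda>n A. L0_norm M (\<lambda>\<omega>. \<nu> n A \<omega> - N A \<omega>)"
  have close: "\<exists>n0. \<forall>n\<ge>n0. ?d n A < e" if [measurable]: "A \<in> sets X" and "e > 0" for A e
  proof -
    have "(\<lambda>n. ?d n A) \<longlonglongrightarrow> 0" using lim[OF that(1)] by (subst (asm) tendsto_in_prob_iff_L0) measurable
    from LIMSEQ_D[OF this that(2)] show ?thesis by (auto simp: L0_norm_nonneg)
  qed
  have small: "\<exists>k0. \<forall>C\<in>sets X. C \<subseteq> B k0 \<longrightarrow> L0_norm M (\<nu> n C) < e" if "e > 0" for n e
    by (rule stochastic_measure_space.uniformly_small_on_decseq[OF sp B that])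
  obtain e where e: "e > 0" and ex: "\<And>k0. \<exists>k\<ge>k0. L0_norm M (N (B k)) \<ge> e"
    using contr by (auto simp: LIMSEQ_iff not_less L0_norm_nonneg)
  define d where "d = e / 8"
  have d: "d > 0" "e = 8 * d" using e by (auto simp: d_def)
  define P where "P j s \<longleftrightarrow> (case s of (A, k, n) \<Rightarrow> A \<in> sets X \<and> A \<inter> B k = {} \<and> j \<le> n
      \<and> (\<forall>C\<in>sets X. C \<subseteq> B k \<longrightarrow> L0_norm M (\<nu> n C) < d) \<and> (\<forall>m\<ge>n. ?d m A < d))" for j s
  define Q where "Q j s s' \<longleftrightarrow> (case s of (A, k, n) \<Rightarrow> case s' of (A', k', n') \<Rightarrow>
      A \<subseteq> A' \<and> A' - A \<subseteq> B k \<and> k \<le> k' \<and>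
      (\<exists>l\<ge>n. \<forall>E\<in>sets X. A' \<subseteq> E \<longrightarrow> E - A' \<subseteq> B k' \<longrightarrow>
        L0_norm M (\<lambda>\<omega>. \<nu> l E \<omega> - N A \<omega>) > 4 * d))" for j :: nat and s s' :: "_ \<times> nat \<times> nat"
  have complete: "\<exists>k' n'. P j (A, k', n') \<and> k \<le> k'"
    if A[measurable]: "A \<in> sets X" and AB: "A \<inter> B k = {}" for j A k
  proof -
    obtain n0 where n0: "\<And>n. n \<ge> n0 \<Longrightarrow> ?d n A < d" using close[OF A d(1)] by blast
    obtain k0 where k0: "\<And>C. C \<in> sets X \<Longrightarrow> C \<subseteq> B k0 \<Longrightarrow> L0_norm M (\<nu> (max n0 j) C) < d"
      using small[OF d(1)] by blast
    have "P j (A, max k k0, max n0 j)"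
      unfolding P_def prod.case
    proof (intro conjI ballI impI allI)
      show "A \<inter> B (max k k0) = {}" using dec[of k "max k k0"] AB by auto
      show "L0_norm M (\<nu> (max n0 j) C) < d" if "C \<in> sets X" "C \<subseteq> B (max k k0)" for C
        using k0[OF that(1)] that(2) dec[of k0 "max k k0"] by auto
    qed (use n0 in auto)
    then show ?thesis by (intro exI[of _ "max k k0"] exI[of _ "max n0 j"]) auto
  qed
  have "\<exists>f. \<forall>j. P j (f j) \<and> Q j (f j) (f (Suc j))"
  proof (rule dependent_nat_choice)
    have "\<exists>k' n'. P 0 ({}, k', n')" using complete[of "{}" 0 0] by simp
    then show "\<exists>s. P 0 s" by blast
  next
    fix s j assume "P j s"
    obtain A k n where s: "s = (A, k, n)" by (cases s) auto
    from \<open>P j s\<close> have A[measurable]: "A \<in> sets X" and AB: "A \<inter> B k = {}"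
      and A_close: "\<And>m. m \<ge> n \<Longrightarrow> ?d m A < d"
      by (auto simp: P_def s)
    obtain k1 where k1: "k1 \<ge> k" "L0_norm M (N (B k1)) \<ge> 8 * d" using ex[of k] d by auto
    obtain n1 where n1: "\<And>l. l \<ge> n1 \<Longrightarrow> ?d l (B k1) < d" using close[OF B_sets d(1)] by blast
    define l where "l = max n n1"
    have "L0_norm M (N (B k1)) \<le> ?d l (B k1) + L0_norm M (\<nu> l (B k1))"
      by (rule L0_norm_le_sum) auto
    moreover have "?d l (B k1) < d" by (rule n1) (simp add: l_def)
    ultimately have large: "L0_norm M (\<nu> l (B k1)) > 7 * d" using k1 by linarith
    obtain k2 where k2: "\<And>C. C \<in> sets X \<Longrightarrow> C \<subseteq> B k2 \<Longrightarrow> L0_norm M (\<nu> l C) < d"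
      using small[OF d(1)] by blast
    define k3 where "k3 = max k1 k2"
    have k3: "L0_norm M (\<nu> l C) < d" if "C \<in> sets X" "C \<subseteq> B k3" for C
      using k2[OF that(1)] that(2) dec[of k2 k3] by (auto simp: k3_def)
    define F where "F = B k1 - B k3"
    have F[measurable]: "F \<in> sets X" by (simp add: F_def)
    have "L0_norm M (\<nu> l (B k1)) \<le> L0_norm M (\<nu> l (B k1 \<inter> B k3)) + L0_norm M (\<nu> l F)"
      unfolding F_def by (rule stochastic_measure_space.L0_norm_tail_le[OF sp]) auto
    moreover have "L0_norm M (\<nu> l (B k1 \<inter> B k3)) < d" by (rule k3) auto
    ultimately have F_large: "L0_norm M (\<nu> l F) > 6 * d" using large by linarith
    have F_sub: "F \<subseteq> B k" using dec[OF k1(1)] by (auto simp: F_def)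
    have "(A \<union> F) \<inter> B k3 = {}"
      using AB dec[of k k3] k1 unfolding F_def k3_def by (simp add: max.coboundedI1) blast
    with complete[of "A \<union> F" k3 "Suc j"] obtain k' n' where
      next_state: "P (Suc j) (A \<union> F, k', n')" "k3 \<le> k'" by auto
    have "Q j s (A \<union> F, k', n')"
      unfolding Q_def s prod.case
    proof (intro conjI exI[of _ l] ballI impI)
      show "k \<le> k'" using next_state k1 by (simp add: k3_def)
      show "n \<le> l" by (simp add: l_def)
      fix E assume E[measurable]: "E \<in> sets X" and sub: "A \<union> F \<subseteq> E" "E - (A \<union> F) \<subseteq> B k'"
      let ?R = "E - (A \<union> F)"
      have R: "?R \<subseteq> B k3" using sub(2) dec[OF next_state(2)] by blast
      have AF: "A \<inter> F = {}" using AB F_sub by blast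
      have "AE \<omega> in M. \<nu> l E \<omega> = \<nu> l A \<omega> + \<nu> l F \<omega> + \<nu> l ?R \<omega>"
        using stochastic_measure_space.sm_split[OF sp E sets.Un[OF A F], of l]
          stochastic_measure_space.sm_Un[OF sp A F AF, of l]
      proof eventually_elim
        case (elim \<omega>)
        moreover have "E \<inter> (A \<union> F) = A \<union> F" using sub(1) by blast
        ultimately show ?case by simp
      qed
      then have "AE \<omega> in M. \<bar>\<nu> l F \<omega>\<bar> \<le> \<bar>\<nu> l E \<omega> - N A \<omega>\<bar> + \<bar>(\<bar>\<nu> l A \<omega> - N A \<omega>\<bar> + \<bar>\<nu> l ?R \<omega>\<bar>)\<bar>"
        by eventually_elim linarith
      then have "L0_norm M (\<nu> l F) \<le> L0_norm M (\<lambda>\<omega>. \<nu> l E \<omega> - N A \<omega>)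
          + L0_norm M (\<lambda>\<omega>. \<bar>\<nu> l A \<omega> - N A \<omega>\<bar> + \<bar>\<nu> l ?R \<omega>\<bar>)"
        by (intro L0_norm_le_sum) auto
      also have "L0_norm M (\<lambda>\<omega>. \<bar>\<nu> l A \<omega> - N A \<omega>\<bar> + \<bar>\<nu> l ?R \<omega>\<bar>) \<le> ?d l A + L0_norm M (\<nu> l ?R)"
        by (intro L0_norm_le_sum) auto
      also have "?d l A < d" by (rule A_close) (simp add: l_def)
      also have "L0_norm M (\<nu> l ?R) < d" by (rule k3) (use R in auto)
      finally show "L0_norm M (\<lambda>\<omega>. \<nu> l E \<omega> - N A \<omega>) > 4 * d" using F_large by linarith
    qed (use F_sub in auto)
    then show "\<exists>s'. P (Suc j) s' \<and> Q j s s'" using next_state by blast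
  qed
  then obtain f where f: "\<And>j. P j (f j)" "\<And>j. Q j (f j) (f (Suc j))" by blast
  define A k n where "A j = fst (f j)" and "k j = fst (snd (f j))" and "n j = snd (snd (f j))" for j
  have fj: "f j = (A j, k j, n j)" for j by (simp add: A_def k_def n_def)
  have A_sets[measurable]: "A j \<in> sets X" and n_ge: "j \<le> n j"
    and tail: "\<And>C. C \<in> sets X \<Longrightarrow> C \<subseteq> B (k j) \<Longrightarrow> L0_norm M (\<nu> (n j) C) < d"
    and A_close: "\<And>m. m \<ge> n j \<Longrightarrow> ?d m (A j) < d" for j
    using f(1)[of j] by (auto simp: P_def fj)
  have A_Suc: "A j \<subseteq> A (Suc j)" "A (Suc j) - A j \<subseteq> B (k j)" "k j \<le> k (Suc j)"
    and jump: "\<exists>l\<ge>n j. \<forall>E\<in>sets X. A (Suc j) \<subseteq> E \<longrightarrow> E - A (Suc j) \<subseteq> B (k (Suc j)) \<longrightarrow>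
        L0_norm M (\<lambda>\<omega>. \<nu> l E \<omega> - N (A j) \<omega>) > 4 * d" for j
    using f(2)[of j] by (auto simp: Q_def fj)
  define E where "E = (\<Union>j. A j)"
  have E[measurable]: "E \<in> sets X" by (auto simp: E_def)
  have inc: "incseq A" by (rule incseq_SucI) (rule A_Suc)
  have k_mono: "k i \<le> k j" if "i \<le> j" for i j using that A_Suc(3) by (rule lift_Suc_mono_le[rotated])
  have E_tail: "E - A j \<subseteq> B (k j)" for j
  proof -
    have "A i - A j \<subseteq> B (k j)" if "j \<le> i" for i
      using that
    proof (induction i rule: dec_induct)
      case (step i)
      then show ?case using A_Suc(2)[of i] dec[OF k_mono[OF step.hyps(1)]] by blast
    qed simp
    moreover have "A i - A j = {}" if "i \<le> j" for i using incseqD[OF inc that] by blast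
    ultimately show ?thesis unfolding E_def using linear[of j] by blast
  qed
  obtain n0 where n0: "\<And>m. m \<ge> n0 \<Longrightarrow> ?d m E < d" using close[OF E d(1)] by blast
  define j where "j = n0"
  obtain l where l: "l \<ge> n j" "L0_norm M (\<lambda>\<omega>. \<nu> l E \<omega> - N (A j) \<omega>) > 4 * d"
    using jump[of j] E E_tail[of "Suc j"] unfolding E_def by blast
  have "L0_norm M (\<lambda>\<omega>. \<nu> l E \<omega> - N (A j) \<omega>)
      \<le> ?d l E + L0_norm M (\<lambda>\<omega>. N E \<omega> - N (A j) \<omega>)"
    by (intro L0_norm_le_sum) auto
  also have "L0_norm M (\<lambda>\<omega>. N E \<omega> - N (A j) \<omega>)
      \<le> ?d (n j) E + L0_norm M (\<lambda>\<omega>. \<nu> (n j) E \<omega> - N (A j) \<omega>)"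
    by (intro L0_norm_le_sum) auto
  also have "L0_norm M (\<lambda>\<omega>. \<nu> (n j) E \<omega> - N (A j) \<omega>) \<le> ?d (n j) (A j) + L0_norm M (\<nu> (n j) (E - A j))"
  proof (rule L0_norm_le_sum)
    have "E \<inter> A j = A j" by (auto simp: E_def)
    then show "AE \<omega> in M. \<bar>\<nu> (n j) E \<omega> - N (A j) \<omega>\<bar>
        \<le> \<bar>\<nu> (n j) (A j) \<omega> - N (A j) \<omega>\<bar> + \<bar>\<nu> (n j) (E - A j) \<omega>\<bar>"
      using stochastic_measure_space.sm_split[OF sp E A_sets, of "n j" j] by (auto elim!: eventually_mono)
  qed auto
  also have "?d l E < d" by (rule n0) (use l n_ge[of j] in \<open>simp add: j_def\<close>)
  also have "?d (n j) E < d" by (rule n0) (use n_ge[of j] in \<open>simp add: j_def\<close>)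
  also have "?d (n j) (A j) < d" by (rule A_close) simp
  also have "L0_norm M (\<nu> (n j) (E - A j)) < d" by (rule tail) (use E_tail in auto)
  finally show False using l by linarith
qed

end

section \<open>Indefinite integrals\<close>

context stochastic_measure_space
begin

lemma sm_simple_integral_factor:
  assumes p: "simple_function X p" and A: "A \<in> sets X" and f: "\<And>x. x \<in> space X \<Longrightarrow> f x = a (p x)"
  shows "AE \<omega> in M. sm_simple_integral X \<mu> A f \<omega>
    = (\<Sum>i\<in>p ` space X. a i * \<mu> (A \<inter> (p -` {i} \<inter> space X)) \<omega>)"
proof -
  define I where "I = p ` space X"
  have I: "finite I" using p by (simp add: I_def simple_function_def)
  have fI: "f ` space X = a ` I" using f by (auto simp: I_def image_image)
  have cell[measurable]: "p -` {i} \<inter> space X \<in> sets X" for i using simple_functionD(2)[OF p] .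
  have "AE \<omega> in M. \<forall>c\<in>a ` I. \<mu> (A \<inter> (f -` {c} \<inter> space X)) \<omega>
      = (\<Sum>i\<in>{i\<in>I. a i = c}. \<mu> (A \<inter> (p -` {i} \<inter> space X)) \<omega>)"
  proof (rule AE_finite_allI)
    fix c
    have "A \<inter> (f -` {c} \<inter> space X) = (\<Union>i\<in>{i\<in>I. a i = c}. A \<inter> (p -` {i} \<inter> space X))"
      using f by (auto simp: I_def)
    moreover have "AE \<omega> in M. \<mu> (\<Union>i\<in>{i\<in>I. a i = c}. A \<inter> (p -` {i} \<inter> space X)) \<omega>
        = (\<Sum>i\<in>{i\<in>I. a i = c}. \<mu> (A \<inter> (p -` {i} \<inter> space X)) \<omega>)"
      using I A by (intro sm_finite_UN) (auto simp: disjoint_family_on_def)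
    ultimately show "AE \<omega> in M. \<mu> (A \<inter> (f -` {c} \<inter> space X)) \<omega>
        = (\<Sum>i\<in>{i\<in>I. a i = c}. \<mu> (A \<inter> (p -` {i} \<inter> space X)) \<omega>)" by simp
  qed (use I in auto)
  then show ?thesis
  proof eventually_elim
    case (elim \<omega>)
    have "sm_simple_integral X \<mu> A f \<omega> = (\<Sum>c\<in>a ` I. c * \<mu> (A \<inter> (f -` {c} \<inter> space X)) \<omega>)"
      by (simp add: sm_simple_integral_def fI)
    also have "\<dots> = (\<Sum>c\<in>a ` I. \<Sum>i\<in>{i\<in>I. a i = c}. a i * \<mu> (A \<inter> (p -` {i} \<inter> space X)) \<omega>)"
      using elim by (intro sum.cong) (auto simp: sum_distrib_left)
    also have "\<dots> = (\<Sum>i\<in>I. a i * \<mu> (A \<inter> (p -` {i} \<inter> space X)) \<omega>)"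
      by (rule sum.image_gen[OF I, symmetric])
    finally show ?case by (simp add: I_def)
  qed
qed

lemma sm_simple_integral_add:
  assumes f: "simple_function X f" "simple_function X g" and A: "A \<in> sets X"
  shows "AE \<omega> in M. sm_simple_integral X \<mu> A (\<lambda>x. f x + g x) \<omega>
    = sm_simple_integral X \<mu> A f \<omega> + sm_simple_integral X \<mu> A g \<omega>"
proof -
  let ?p = "\<lambda>x. (f x, g x)"
  have p: "simple_function X ?p" by (rule simple_function_Pair[OF f])
  have f_eq: "AE \<omega> in M. sm_simple_integral X \<mu> A f \<omega>
      = (\<Sum>i\<in>?p ` space X. fst i * \<mu> (A \<inter> (?p -` {i} \<inter> space X)) \<omega>)"
    by (rule sm_simple_integral_factor[OF p A]) simp
  have g_eq: "AE \<omega> in M. sm_simple_integral X \<mu> A g \<omega>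
      = (\<Sum>i\<in>?p ` space X. snd i * \<mu> (A \<inter> (?p -` {i} \<inter> space X)) \<omega>)"
    by (rule sm_simple_integral_factor[OF p A]) simp
  have "AE \<omega> in M. sm_simple_integral X \<mu> A (\<lambda>x. f x + g x) \<omega>
      = (\<Sum>i\<in>?p ` space X. (fst i + snd i) * \<mu> (A \<inter> (?p -` {i} \<inter> space X)) \<omega>)"
    by (rule sm_simple_integral_factor[OF p A]) simp
  then show ?thesis
    using f_eq g_eq by eventually_elim (simp only: distrib_right sum.distrib)
qed

lemma sm_simple_integral_cmult:
  assumes f: "simple_function X f" and A: "A \<in> sets X"
  shows "AE \<omega> in M. sm_simple_integral X \<mu> A (\<lambda>x. c * f x) \<omega> = c * sm_simple_integral X \<mu> A f \<omega>"
proof -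
  have f_eq: "AE \<omega> in M. sm_simple_integral X \<mu> A f \<omega>
      = (\<Sum>i\<in>f ` space X. i * \<mu> (A \<inter> (f -` {i} \<inter> space X)) \<omega>)"
    by (rule sm_simple_integral_factor[OF f A]) simp
  have "AE \<omega> in M. sm_simple_integral X \<mu> A (\<lambda>x. c * f x) \<omega>
      = (\<Sum>i\<in>f ` space X. c * i * \<mu> (A \<inter> (f -` {i} \<inter> space X)) \<omega>)"
    by (rule sm_simple_integral_factor[OF f A]) simp
  then show ?thesis
    using f_eq by eventually_elim (simp only: sum_distrib_left mult.assoc)
qed

lemma sm_simple_integral_indicator:
  assumes A: "A \<in> sets X" and B: "B \<in> sets X"
  shows "AE \<omega> in M. sm_simple_integral X \<mu> A (indicator B) \<omega> = \<mu> (A \<inter> B) \<omega>"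
  using sm_empty
proof eventually_elim
  case (elim \<omega>)
  let ?f = "indicator B :: 'b \<Rightarrow> real"
  have "sm_simple_integral X \<mu> A ?f \<omega> = (\<Sum>c\<in>{0, 1}. c * \<mu> (A \<inter> (?f -` {c} \<inter> space X)) \<omega>)"
    unfolding sm_simple_integral_def
  proof (rule sum.mono_neutral_left)
    show "?f ` space X \<subseteq> {0, 1}" by (auto simp: indicator_def)
    show "\<forall>c\<in>{0, 1} - ?f ` space X. c * \<mu> (A \<inter> (?f -` {c} \<inter> space X)) \<omega> = 0"
    proof
      fix c assume "c \<in> {0, 1} - ?f ` space X"
      then have "?f -` {c} \<inter> space X = {}" by auto
      then show "c * \<mu> (A \<inter> (?f -` {c} \<inter> space X)) \<omega> = 0" using elim by simp
    qed
  qed simp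
  also have "\<dots> = \<mu> (A \<inter> (?f -` {1} \<inter> space X)) \<omega>" by simp
  also have "A \<inter> (?f -` {1} \<inter> space X) = A \<inter> B"
    using sets.sets_into_space[OF A] by (auto simp: indicator_def split: if_splits)
  finally show ?case .
qed

lemma measurable_sm_simple_integral [measurable]:
  assumes "simple_function X f" "A \<in> sets X"
  shows "sm_simple_integral X \<mu> A f \<in> borel_measurable M"
  unfolding sm_simple_integral_def
  using assms by (intro borel_measurable_sum borel_measurable_times borel_measurable_const
      measurable_sm sets.Int simple_functionD(2)) auto

lemma stochastic_measure_simple_integral:
  assumes f: "simple_function X f"
  shows "stochastic_measure M X (\<lambda>A. sm_simple_integral X \<mu> A f)"
  unfolding stochastic_measure_def
proof (intro conjI ballI allI impI)
  fix A :: "nat \<Rightarrow> 'b set" assume A: "range A \<subseteq> sets X" "disjoint_family A"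
  let ?V = "\<lambda>c. f -` {c} \<inter> space X"
  have V[measurable]: "?V c \<in> sets X" for c using simple_functionD(2)[OF f] .
  have [measurable]: "A i \<in> sets X" for i using A by auto
  have "tendsto_in_prob M (\<lambda>n \<omega>. \<Sum>c\<in>f ` space X. c * (\<Sum>i<n. \<mu> (A i \<inter> ?V c) \<omega>))
      (\<lambda>\<omega>. \<Sum>c\<in>f ` space X. c * \<mu> (\<Union>i. A i \<inter> ?V c) \<omega>)"
  proof (intro tendsto_in_prob_sum tendsto_in_prob_cmult sm_sigma_additive)
    show "disjoint_family (\<lambda>i. A i \<inter> ?V c)" for c using A(2) by (auto simp: disjoint_family_on_def)
  qed auto
  also have "(\<lambda>n \<omega>. \<Sum>c\<in>f ` space X. c * (\<Sum>i<n. \<mu> (A i \<inter> ?V c) \<omega>))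
      = (\<lambda>n \<omega>. \<Sum>i<n. sm_simple_integral X \<mu> (A i) f \<omega>)"
    unfolding sm_simple_integral_def sum_distrib_left by (intro ext sum.swap)
  finally show "tendsto_in_prob M (\<lambda>n \<omega>. \<Sum>i<n. sm_simple_integral X \<mu> (A i) f \<omega>)
      (sm_simple_integral X \<mu> (\<Union>i. A i) f)"
    by (simp add: sm_simple_integral_def Int_UN_distrib2 Int_commute)
qed (use f in measurable)

end

context stochastic_measure_space
begin

text \<open>The full family of limits over all sets is kept, because it is their convergence for every set that
  makes \<open>N\<close> continuous from above by Nikodym's theorem.\<close>

definition indefinite_integral :: "('b \<Rightarrow> real) \<Rightarrow> ('b set \<Rightarrow> 'a \<Rightarrow> real) \<Rightarrow> bool" where
  "indefinite_integral f N \<longleftrightarrow> (\<forall>A\<in>sets X. N A \<in> borel_measurable M) \<and>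
    (\<exists>s. (\<forall>n. simple_function X (s n)) \<and> (\<forall>x\<in>space X. (\<lambda>n. s n x) \<longlonglongrightarrow> f x) \<and>
      (\<forall>A\<in>sets X. tendsto_in_prob M (\<lambda>n. sm_simple_integral X \<mu> A (s n)) (N A)))"

lemma indefinite_integral_measurable:
  "indefinite_integral f N \<Longrightarrow> A \<in> sets X \<Longrightarrow> N A \<in> borel_measurable M"
  by (simp add: indefinite_integral_def)

lemma indefinite_integral_function_measurable:
  assumes "indefinite_integral f N" shows "f \<in> borel_measurable X"
proof -
  obtain s where s: "\<And>n. simple_function X (s n)" "\<And>x. x \<in> space X \<Longrightarrow> (\<lambda>n. s n x) \<longlonglongrightarrow> f x"
    using assms unfolding indefinite_integral_def by blast
  show ?thesis
    by (rule borel_measurable_LIMSEQ_real[OF s(2)]) (auto intro: borel_measurable_simple_function s(1))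
qed

lemma indefinite_integral_add:
  assumes "indefinite_integral f N" "indefinite_integral g N'"
  shows "indefinite_integral (\<lambda>x. f x + g x) (\<lambda>A \<omega>. N A \<omega> + N' A \<omega>)"
proof -
  obtain s where s: "\<And>n. simple_function X (s n)" "\<And>x. x \<in> space X \<Longrightarrow> (\<lambda>n. s n x) \<longlonglongrightarrow> f x"
    "\<And>A. A \<in> sets X \<Longrightarrow> tendsto_in_prob M (\<lambda>n. sm_simple_integral X \<mu> A (s n)) (N A)"
    using assms(1) unfolding indefinite_integral_def by blast
  obtain s' where s': "\<And>n. simple_function X (s' n)" "\<And>x. x \<in> space X \<Longrightarrow> (\<lambda>n. s' n x) \<longlonglongrightarrow> g x"
    "\<And>A. A \<in> sets X \<Longrightarrow> tendsto_in_prob M (\<lambda>n. sm_simple_integral X \<mu> A (s' n)) (N' A)"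
    using assms(2) unfolding indefinite_integral_def by blast
  note [measurable] = indefinite_integral_measurable[OF assms(1)] indefinite_integral_measurable[OF assms(2)]
  have ss: "simple_function X (\<lambda>x. s n x + s' n x)" for n
    using simple_function_compose2[OF s(1) s'(1), of "(+)"] by simp
  have "tendsto_in_prob M (\<lambda>n. sm_simple_integral X \<mu> A (\<lambda>x. s n x + s' n x)) (\<lambda>\<omega>. N A \<omega> + N' A \<omega>)"
    if A: "A \<in> sets X" for A
  proof -
    note [measurable] = A measurable_sm_simple_integral[OF s(1) A] measurable_sm_simple_integral[OF s'(1) A]
      measurable_sm_simple_integral[OF ss A]
    have "tendsto_in_prob M (\<lambda>n \<omega>. sm_simple_integral X \<mu> A (s n) \<omega> + sm_simple_integral X \<mu> A (s' n) \<omega>)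
        (\<lambda>\<omega>. N A \<omega> + N' A \<omega>)"
      by (intro tendsto_in_prob_add s(3) s'(3) A) auto
    then show ?thesis
      by (subst tendsto_in_prob_cong_AE[where Z' = "\<lambda>\<omega>. N A \<omega> + N' A \<omega>"
            and Y' = "\<lambda>n \<omega>. sm_simple_integral X \<mu> A (s n) \<omega> + sm_simple_integral X \<mu> A (s' n) \<omega>"])
        (auto intro: sm_simple_integral_add s(1) s'(1) A)
  qed
  then show ?thesis
    unfolding indefinite_integral_def
    by (intro conjI ballI exI[of _ "\<lambda>n x. s n x + s' n x"] allI ss tendsto_add s(2) s'(2)) auto
qed

lemma indefinite_integral_cmult:
  assumes "indefinite_integral f N"
  shows "indefinite_integral (\<lambda>x. c * f x) (\<lambda>A \<omega>. c * N A \<omega>)"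
proof -
  obtain s where s: "\<And>n. simple_function X (s n)" "\<And>x. x \<in> space X \<Longrightarrow> (\<lambda>n. s n x) \<longlonglongrightarrow> f x"
    "\<And>A. A \<in> sets X \<Longrightarrow> tendsto_in_prob M (\<lambda>n. sm_simple_integral X \<mu> A (s n)) (N A)"
    using assms(1) unfolding indefinite_integral_def by blast
  note [measurable] = indefinite_integral_measurable[OF assms]
  have ss: "simple_function X (\<lambda>x. c * s n x)" for n
    using simple_function_compose1[OF s(1), of "(*) c"] by simp
  have "tendsto_in_prob M (\<lambda>n. sm_simple_integral X \<mu> A (\<lambda>x. c * s n x)) (\<lambda>\<omega>. c * N A \<omega>)"
    if A: "A \<in> sets X" for A
  proof -
    note [measurable] = A measurable_sm_simple_integral[OF s(1) A] measurable_sm_simple_integral[OF ss A]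
    have "tendsto_in_prob M (\<lambda>n \<omega>. c * sm_simple_integral X \<mu> A (s n) \<omega>) (\<lambda>\<omega>. c * N A \<omega>)"
      by (intro tendsto_in_prob_cmult s(3) A)
    then show ?thesis
      by (subst tendsto_in_prob_cong_AE[where Z' = "\<lambda>\<omega>. c * N A \<omega>"
            and Y' = "\<lambda>n \<omega>. c * sm_simple_integral X \<mu> A (s n) \<omega>"])
        (auto intro: sm_simple_integral_cmult s(1) A)
  qed
  then show ?thesis
    unfolding indefinite_integral_def
    by (intro conjI ballI exI[of _ "\<lambda>n x. c * s n x"] allI ss tendsto_mult_left s(2)) auto
qed

lemma indefinite_integral_zero: "indefinite_integral (\<lambda>x. 0) (\<lambda>A \<omega>. 0)"
  unfolding indefinite_integral_def
proof (intro conjI ballI exI[of _ "\<lambda>n x. 0"] allI)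
  fix A assume "A \<in> sets X"
  have "sm_simple_integral X \<mu> A (\<lambda>x. 0) = (\<lambda>\<omega>. 0)"
    by (auto simp: sm_simple_integral_def intro!: ext sum.neutral)
  then show "tendsto_in_prob M (\<lambda>n. sm_simple_integral X \<mu> A (\<lambda>x. 0)) (\<lambda>\<omega>. 0)"
    by (simp add: tendsto_in_prob_const)
qed auto

lemma indefinite_integral_sum:
  assumes "\<And>i. i \<in> I \<Longrightarrow> indefinite_integral (f i) (N i)"
  shows "indefinite_integral (\<lambda>x. \<Sum>i\<in>I. f i x) (\<lambda>A \<omega>. \<Sum>i\<in>I. N i A \<omega>)"
  using assms
proof (induction I rule: infinite_finite_induct)
  case (insert i I)
  then show ?case using indefinite_integral_add[of "f i" "N i"] by simp
qed (auto intro: indefinite_integral_zero)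

lemma indefinite_integral_indicator:
  assumes B: "B \<in> sets X"
  shows "indefinite_integral (indicator B) (\<lambda>A. \<mu> (A \<inter> B))"
  unfolding indefinite_integral_def
proof (intro conjI ballI exI[of _ "\<lambda>n. indicator B"] allI)
  fix A assume A: "A \<in> sets X"
  note [measurable] = A B measurable_sm_simple_integral[OF simple_function_indicator[OF B] A]
  show "tendsto_in_prob M (\<lambda>n. sm_simple_integral X \<mu> A (indicator B)) (\<mu> (A \<inter> B))"
    by (subst tendsto_in_prob_cong_AE[where Y' = "\<lambda>n. \<mu> (A \<inter> B)" and Z' = "\<mu> (A \<inter> B)"])
      (auto intro: sm_simple_integral_indicator A B simp: tendsto_in_prob_const)
  show "\<mu> (A \<inter> B) \<in> borel_measurable M" by measurable
qed (use B in auto)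

lemma indefinite_integral_one: "indefinite_integral (\<lambda>x. 1) \<mu>"
proof -
  have "indefinite_integral (indicator (space X)) (\<lambda>A. \<mu> (A \<inter> space X))"
    by (rule indefinite_integral_indicator) auto
  then show ?thesis by (simp add: indefinite_integral_def sets.Int_space_eq2)
qed

lemma indefinite_integral_sm_integral:
  assumes g: "sm_integrable M X \<mu> g" and A: "A \<in> sets X"
  shows "\<exists>N. indefinite_integral g N \<and> N A = sm_integral M X \<mu> A g"
proof -
  obtain s where "sm_approx_seq M X \<mu> g s" using g by (auto simp: sm_integrable_def)
  then have "\<exists>J. has_sm_integral M X \<mu> A g J"
    using A unfolding has_sm_integral_def sm_approx_seq_def by blast
  then have "has_sm_integral M X \<mu> A g (sm_integral M X \<mu> A g)"
    unfolding sm_integral_def by (rule someI_ex)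
  then obtain s where J: "sm_integral M X \<mu> A g \<in> borel_measurable M" and s: "sm_approx_seq M X \<mu> g s"
    "tendsto_in_prob M (\<lambda>n. sm_simple_integral X \<mu> A (s n)) (sm_integral M X \<mu> A g)"
    unfolding has_sm_integral_def by blast
  have "\<forall>B\<in>sets X. \<exists>J. J \<in> borel_measurable M \<and> tendsto_in_prob M (\<lambda>n. sm_simple_integral X \<mu> B (s n)) J"
    using s(1) unfolding sm_approx_seq_def by blast
  from bchoice[OF this] obtain N where N: "\<forall>B\<in>sets X. N B \<in> borel_measurable M
      \<and> tendsto_in_prob M (\<lambda>n. sm_simple_integral X \<mu> B (s n)) (N B)" ..
  have "indefinite_integral g (N(A := sm_integral M X \<mu> A g))"
    unfolding indefinite_integral_def
    by (intro conjI ballI exI[of _ s]) (use N J s in \<open>auto simp: sm_approx_seq_def\<close>)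
  then show ?thesis by (intro exI[of _ "N(A := sm_integral M X \<mu> A g)"]) simp
qed

section \<open>Bounded convergence\<close>

text \<open>The level sets of \<open>s\<close> are disjoint, so the subset sums of their measures are measures of sets again.\<close>

lemma prob_simple_integral_le:
  assumes s: "simple_function X s" and D: "D \<in> sets X"
    and c: "c > 0" "\<And>x. x \<in> D \<Longrightarrow> \<bar>s x\<bar> \<le> c" and K: "K > 0"
    and p: "\<And>A. A \<in> sets X \<Longrightarrow> A \<subseteq> D \<Longrightarrow> prob {\<omega>\<in>space M. \<bar>\<mu> A \<omega>\<bar> > K} \<le> p"
  shows "prob {\<omega>\<in>space M. \<bar>sm_simple_integral X \<mu> D s \<omega>\<bar> > 8 * c * K} \<le> 52 * p"
proof -
  define V where "V v = D \<inter> (s -` {v} \<inter> space X)" for v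
  have V[measurable]: "V v \<in> sets X" for v
    unfolding V_def by (rule sets.Int[OF D simple_functionD(2)[OF s]])
  define I where "I = {v\<in>s ` space X. V v \<noteq> {}}"
  have sI: "finite (s ` space X)" using s by (simp add: simple_function_def)
  then have I: "finite I" by (simp add: I_def)
  have Ic: "\<bar>v / c\<bar> \<le> 1" if "v \<in> I" for v
  proof -
    from that obtain x where "x \<in> D" "s x = v" by (auto simp: I_def V_def)
    then have "\<bar>v\<bar> \<le> c" using c(2)[of x] by simp
    then show ?thesis using c(1) by simp
  qed
  note [measurable] = measurable_sm_simple_integral[OF s D]
  have "AE \<omega> in M. sm_simple_integral X \<mu> D s \<omega> = c * (\<Sum>v\<in>I. v / c * \<mu> (V v) \<omega>)"
    using sm_empty
  proof eventually_elim
    case (elim \<omega>)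
    have "sm_simple_integral X \<mu> D s \<omega> = (\<Sum>v\<in>I. v * \<mu> (V v) \<omega>)"
      unfolding sm_simple_integral_def V_def[symmetric]
      by (rule sum.mono_neutral_right) (use elim sI in \<open>auto simp: I_def\<close>)
    also have "\<dots> = c * (\<Sum>v\<in>I. v / c * \<mu> (V v) \<omega>)" using c by (simp add: sum_distrib_left)
    finally show ?case .
  qed
  then have "AE \<omega> in M. \<bar>sm_simple_integral X \<mu> D s \<omega>\<bar> > 8 * c * K \<longrightarrow> \<bar>\<Sum>v\<in>I. v / c * \<mu> (V v) \<omega>\<bar> > 8 * K"
  proof eventually_elim
    case (elim \<omega>)
    have "8 * c * K = c * (8 * K)" by simp
    then show ?case unfolding elim using c by (simp only: abs_mult abs_of_pos mult_less_cancel_left_pos) simp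
  qed
  then have "prob {\<omega>\<in>space M. \<bar>sm_simple_integral X \<mu> D s \<omega>\<bar> > 8 * c * K}
      \<le> prob {\<omega>\<in>space M. \<bar>\<Sum>v\<in>I. v / c * \<mu> (V v) \<omega>\<bar> > 8 * K}"
    by (rule prob_mono_AE[rotated]) measurable
  also have "\<dots> \<le> 52 * p"
  proof (rule prob_bounded_combination_le[OF I _ K Ic])
    fix S assume S: "S \<subseteq> I"
    have US[measurable]: "(\<Union>v\<in>S. V v) \<in> sets X"
      using finite_subset[OF S I] by (intro sets.finite_UN V) auto
    have "AE \<omega> in M. \<mu> (\<Union>v\<in>S. V v) \<omega> = (\<Sum>v\<in>S. \<mu> (V v) \<omega>)"
    proof (rule sm_finite_UN)
      show "disjoint_family_on V S" by (auto simp: disjoint_family_on_def V_def)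
    qed (use finite_subset[OF S I] in auto)
    then have "prob {\<omega>\<in>space M. \<bar>\<Sum>v\<in>S. \<mu> (V v) \<omega>\<bar> > K} \<le> prob {\<omega>\<in>space M. \<bar>\<mu> (\<Union>v\<in>S. V v) \<omega>\<bar> > K}"
      by (intro prob_mono_AE) (measurable, auto elim!: eventually_mono)
    also have "\<dots> \<le> p"
    proof (rule p)
      show "(\<Union>v\<in>S. V v) \<in> sets X" by (rule US)
      show "(\<Union>v\<in>S. V v) \<subseteq> D" by (auto simp: V_def)
    qed
    finally show "prob {\<omega>\<in>space M. \<bar>\<Sum>v\<in>S. \<mu> (V v) \<omega>\<bar> > K} \<le> p" .
  qed measurable
  finally show ?thesis .
qed

lemma indefinite_integral_split:
  assumes N: "indefinite_integral f N" and A: "A \<in> sets X" "B \<in> sets X"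
  shows "AE \<omega> in M. N A \<omega> = N (A \<inter> B) \<omega> + N (A - B) \<omega>"
proof -
  obtain s where s: "\<And>n. simple_function X (s n)"
    "\<And>A. A \<in> sets X \<Longrightarrow> tendsto_in_prob M (\<lambda>n. sm_simple_integral X \<mu> A (s n)) (N A)"
    using N unfolding indefinite_integral_def by blast
  show ?thesis
    by (rule setwise_limit_split[OF stochastic_measure_simple_integral[OF s(1)]
          indefinite_integral_measurable[OF N] s(2) A])
qed

text \<open>The approximating simple functions need not be bounded uniformly. But they eventually are within
  \<open>c\<close> of \<open>f\<close> outside sets decreasing to the empty set, and by Nikodym's theorem the integral over those
  sets vanishes in the limit.\<close>

lemma prob_indefinite_integral_le:
  assumes N: "indefinite_integral f N" and D: "D \<in> sets X"
    and c: "c > 0" "\<And>x. x \<in> D \<Longrightarrow> \<bar>f x\<bar> \<le> c" and K: "K > 0"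
    and p: "\<And>A. A \<in> sets X \<Longrightarrow> A \<subseteq> D \<Longrightarrow> prob {\<omega>\<in>space M. \<bar>\<mu> A \<omega>\<bar> > K} \<le> p"
  shows "prob {\<omega>\<in>space M. \<bar>N D \<omega>\<bar> > 18 * c * K} \<le> 52 * p"
proof -
  obtain s where s: "\<And>n. simple_function X (s n)" "\<And>x. x \<in> space X \<Longrightarrow> (\<lambda>n. s n x) \<longlonglongrightarrow> f x"
    "\<And>A. A \<in> sets X \<Longrightarrow> tendsto_in_prob M (\<lambda>n. sm_simple_integral X \<mu> A (s n)) (N A)"
    using N unfolding indefinite_integral_def by blast
  note [measurable] = indefinite_integral_measurable[OF N] indefinite_integral_function_measurable[OF N]
    borel_measurable_simple_function[OF s(1)] D measurable_sm_simple_integral[OF s(1)]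
  have DX: "D \<subseteq> space X" by (rule sets.sets_into_space[OF D])
  define B where "B k = D \<inter> (\<Union>n\<in>{k..}. {x\<in>space X. \<bar>s n x - f x\<bar> > c})" for k
  have B_sets[measurable]: "B k \<in> sets X" for k unfolding B_def by measurable
  have B_dec: "decseq B" by (auto simp: B_def decseq_def intro: order_trans)
  have B_empty: "(\<Inter>k. B k) = {}"
  proof (rule ccontr)
    assume "(\<Inter>k. B k) \<noteq> {}"
    then obtain x where x: "\<And>k. x \<in> B k" by auto
    then have "x \<in> space X" using DX by (auto simp: B_def)
    from LIMSEQ_D[OF s(2)[OF this] c(1)] obtain k where "\<And>n. n \<ge> k \<Longrightarrow> \<bar>s n x - f x\<bar> < c" by auto
    then show False using x[of k] by (force simp: B_def)
  qed
  \<comment> \<open>The simple functions are bounded by \<open>2 * c\<close> here. The factor \<open>16\<close> grows to \<open>17\<close> in the limit of the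
    simple functions and to \<open>18\<close> in the limit \<open>k \<longlonglongrightarrow> \<infinity>\<close>.\<close>
  have good: "prob {\<omega>\<in>space M. \<bar>N (D - B k) \<omega>\<bar> > 17 * c * K} \<le> 52 * p" for k
  proof (rule tail_bound_limit_in_prob[OF _ _ s(3)])
    show "16 * c * K < 17 * c * K" using c K by simp
    fix n assume n: "n \<ge> k"
    have "prob {\<omega>\<in>space M. \<bar>sm_simple_integral X \<mu> (D - B k) (s n) \<omega>\<bar> > 8 * (2 * c) * K} \<le> 52 * p"
    proof (rule prob_simple_integral_le[OF s(1)])
      fix x assume x: "x \<in> D - B k"
      then have "\<bar>s n x - f x\<bar> \<le> c" using n DX by (auto simp: B_def not_less)
      moreover have "\<bar>f x\<bar> \<le> c" using x c(2) by auto
      ultimately show "\<bar>s n x\<bar> \<le> 2 * c" by linarith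
    qed (use c K p in auto)
    then show "prob {\<omega>\<in>space M. \<bar>sm_simple_integral X \<mu> (D - B k) (s n) \<omega>\<bar> > 16 * c * K} \<le> 52 * p" by simp
  qed auto
  have "(\<lambda>k. L0_norm M (N (B k))) \<longlonglongrightarrow> 0"
    by (rule nikodym_continuity_from_above[OF stochastic_measure_simple_integral[OF s(1)]
          indefinite_integral_measurable[OF N] s(3) _ B_dec B_empty]) auto
  then have bad: "(\<lambda>k. L0_norm M (\<lambda>\<omega>. N (D - B k) \<omega> - N D \<omega>)) \<longlonglongrightarrow> 0"
  proof (rule Lim_transform_eventually, intro always_eventually allI)
    fix k
    have DB: "D \<inter> B k = B k" by (auto simp: B_def)
    have "L0_norm M (\<lambda>\<omega>. N (D - B k) \<omega> - N D \<omega>) = L0_norm M (\<lambda>\<omega>. - N (B k) \<omega>)"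
      by (rule L0_norm_cong_AE)
        (use indefinite_integral_split[OF N D B_sets, of k] in \<open>auto elim!: eventually_mono simp: DB\<close>)
    then show "L0_norm M (N (B k)) = L0_norm M (\<lambda>\<omega>. N (D - B k) \<omega> - N D \<omega>)" by (simp add: L0_norm_def)
  qed
  show ?thesis
  proof (rule tail_bound_limit_in_prob[where Y = "\<lambda>k. N (D - B k)" and ?n0.0 = 0, OF _ _ _ _ good])
    show "tendsto_in_prob M (\<lambda>k. N (D - B k)) (N D)"
      using bad by (subst tendsto_in_prob_iff_L0) auto
    show "17 * c * K < 18 * c * K" using c K by simp
  qed auto
qed

text \<open>Where \<open>f n\<close> is already small, boundedness of the range suffices; the remaining points form subsets
  of a sequence decreasing to the empty set, on which \<open>\<mu>\<close> itself is uniformly small.\<close>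

theorem bounded_convergence:
  assumes N: "\<And>n. indefinite_integral (f n) (N n)" and A: "A \<in> sets X"
    and lim: "\<And>x. x \<in> A \<Longrightarrow> (\<lambda>n. f n x) \<longlonglongrightarrow> 0"
    and C: "\<And>n x. x \<in> A \<Longrightarrow> \<bar>f n x\<bar> \<le> C"
  shows "tendsto_in_prob M (\<lambda>n. N n A) (\<lambda>\<omega>. 0)"
  unfolding tendsto_in_prob_def
proof (intro allI impI LIMSEQ_I)
  fix e r :: real assume e: "e > 0" and r: "r > 0"
  note [measurable] = indefinite_integral_measurable[OF N] indefinite_integral_function_measurable[OF N] A
  have AX: "A \<subseteq> space X" by (rule sets.sets_into_space[OF A])
  define p where "p = r / 208"
  have p: "p > 0" using r by (simp add: p_def)
  obtain K where K: "K > 0" "\<And>B. B \<in> sets X \<Longrightarrow> prob {\<omega>\<in>space M. \<bar>\<mu> B \<omega>\<bar> > K} \<le> p"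
    using range_bounded_in_prob[OF p] by blast
  define c where "c = e / (36 * K)"
  have c: "c > 0" using e K by (simp add: c_def)
  define B where "B k = A \<inter> (\<Union>n\<in>{k..}. {x\<in>space X. \<bar>f n x\<bar> > c})" for k
  have B_sets[measurable]: "B k \<in> sets X" for k unfolding B_def by measurable
  have B_dec: "decseq B" by (auto simp: B_def decseq_def intro: order_trans)
  have B_empty: "(\<Inter>k. B k) = {}"
  proof (rule ccontr)
    assume "(\<Inter>k. B k) \<noteq> {}"
    then obtain x where x: "\<And>k. x \<in> B k" by auto
    then have "x \<in> A" by (auto simp: B_def)
    from LIMSEQ_D[OF lim[OF this] c] obtain k where "\<And>n. n \<ge> k \<Longrightarrow> \<bar>f n x\<bar> < c" by auto
    then show False using x[of k] by (force simp: B_def)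
  qed
  define C' where "C' = max C 1"
  have C': "C' > 0" "C \<le> C'" by (auto simp: C'_def)
  define K' where "K' = min 1 (e / (36 * C'))"
  have K': "K' > 0" "K' \<le> 1" "K' \<le> e / (36 * C')" using e C' by (auto simp: K'_def)
  have B_range: "range B \<subseteq> sets X" by (rule image_subsetI) (rule B_sets)
  obtain k where k: "\<And>E. E \<in> sets X \<Longrightarrow> E \<subseteq> B k \<Longrightarrow> L0_norm M (\<mu> E) < p * K'"
    using uniformly_small_on_decseq[OF B_range B_dec B_empty, of "p * K'"] p K' by auto
  have "norm (prob {\<omega>\<in>space M. \<bar>N n A \<omega> - 0\<bar> > e} - 0) < r" if n: "n \<ge> k" for n
  proof -
    have "prob {\<omega>\<in>space M. \<bar>N n A \<omega>\<bar> > e}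
        \<le> prob {\<omega>\<in>space M. \<bar>N n (A \<inter> B k) \<omega>\<bar> > e / 2} + prob {\<omega>\<in>space M. \<bar>N n (A - B k) \<omega>\<bar> > e / 2}"
      by (rule prob_Un_le2) (use indefinite_integral_split[OF N A B_sets, of n k] in \<open>auto elim!: eventually_mono\<close>)
    moreover have "prob {\<omega>\<in>space M. \<bar>N n (A - B k) \<omega>\<bar> > e / 2} \<le> 52 * p"
    proof -
      have "prob {\<omega>\<in>space M. \<bar>N n (A - B k) \<omega>\<bar> > 18 * c * K} \<le> 52 * p"
      proof (rule prob_indefinite_integral_le[OF N _ c _ K(1)])
        show "\<bar>f n x\<bar> \<le> c" if "x \<in> A - B k" for x
          using that n AX by (auto simp: B_def not_less)
      qed (use K in auto)
      moreover have "18 * c * K = e / 2" using K by (simp add: c_def)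
      ultimately show ?thesis by simp
    qed
    moreover have "prob {\<omega>\<in>space M. \<bar>N n (A \<inter> B k) \<omega>\<bar> > e / 2} \<le> 52 * p"
    proof -
      have "prob {\<omega>\<in>space M. \<bar>N n (A \<inter> B k) \<omega>\<bar> > 18 * C' * K'} \<le> 52 * p"
      proof (rule prob_indefinite_integral_le[OF N _ C'(1) _ K'(1)])
        show "\<bar>f n x\<bar> \<le> C'" if "x \<in> A \<inter> B k" for x using that C[of x n] C' by auto
        show "prob {\<omega>\<in>space M. \<bar>\<mu> E \<omega>\<bar> > K'} \<le> p" if E: "E \<in> sets X" "E \<subseteq> A \<inter> B k" for E
        proof -
          have "prob {\<omega>\<in>space M. \<bar>\<mu> E \<omega>\<bar> > K'} \<le> L0_norm M (\<mu> E) / K'"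
            using E K' by (intro prob_le_L0_norm) auto
          also have "\<dots> \<le> p" using k[of E] E K' by (simp add: field_simps)
          finally show ?thesis .
        qed
      qed auto
      moreover have "18 * C' * K' \<le> e / 2" using K'(3) C' by (simp add: field_simps)
      then have "prob {\<omega>\<in>space M. \<bar>N n (A \<inter> B k) \<omega>\<bar> > e / 2} \<le> prob {\<omega>\<in>space M. \<bar>N n (A \<inter> B k) \<omega>\<bar> > 18 * C' * K'}"
        by (intro finite_measure_mono) auto
      ultimately show ?thesis by simp
    qed
    ultimately have "prob {\<omega>\<in>space M. \<bar>N n A \<omega>\<bar> > e} \<le> 104 * p" by linarith
    also have "\<dots> < r" using r by (simp add: p_def)
    finally show ?thesis by simp
  qed
  then show "\<exists>k. \<forall>n\<ge>k. norm (prob {\<omega>\<in>space M. \<bar>N n A \<omega> - 0\<bar> > e} - 0) < r" by blast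
qed

end

section \<open>The Fourier series of the sawtooth function\<close>

lemma sum_cos_closed_form:
  fixes u :: real
  shows "2 * sin (u/2) * (\<Sum>k=1..n. cos (real k * u)) = sin ((real n + 1/2) * u) - sin (u/2)"
proof (induction n)
  case (Suc n)
  have "2 * sin (u/2) * cos (real (Suc n) * u)
      = sin (u/2 + real (Suc n) * u) + sin (u/2 - real (Suc n) * u)"
    by (simp add: sin_add sin_diff)
  also have "u/2 + real (Suc n) * u = (real (Suc n) + 1/2) * u" by (simp add: algebra_simps)
  also have "u/2 - real (Suc n) * u = - ((real n + 1/2) * u)" by (simp add: algebra_simps)
  finally have "2 * sin (u/2) * cos (real (Suc n) * u) = sin ((real (Suc n) + 1/2) * u) - sin ((real n + 1/2) * u)"
    by simp
  moreover have "2 * sin (u/2) * (\<Sum>k=1..Suc n. cos (real k * u))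
      = 2 * sin (u/2) * (\<Sum>k=1..n. cos (real k * u)) + 2 * sin (u/2) * cos (real (Suc n) * u)"
    by (simp add: algebra_simps)
  ultimately show ?case using Suc.IH by linarith
qed simp

definition sawtooth_sum :: "nat \<Rightarrow> real \<Rightarrow> real" where
  "sawtooth_sum n x = (\<Sum>k=1..n. sin (real k * x) / real k)"

text \<open>By the closed form of \<open>\<Sum> cos(ku)\<close>, the error has derivative \<open>sin((n + 1/2) u) / (2 sin(u/2))\<close>, which
  oscillates quickly. One integration by parts, from the zero of the error at \<open>\<pi>\<close>, gains the factor
  \<open>1 / (2 n + 1)\<close>. Below, \<open>F\<close> is the error plus the boundary term, so that \<open>F'\<close> is the integrand that
  remains, and \<open>G\<close> is a function whose derivative dominates it in absolute value.\<close>

lemma sawtooth_sum_error_half: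
  fixes x :: real
  assumes x: "0 < x" "x \<le> pi"
  shows "\<bar>sawtooth_sum n x - (pi - x) / 2\<bar> \<le> 2 / ((2 * real n + 1) * sin (x/2))"
proof -
  define N where "N = 2 * real n + 1"
  have N: "N > 0" by (simp add: N_def)
  define F where "F u = sawtooth_sum n u - (pi - u) / 2 + cos (N/2 * u) / (N * sin (u/2))" for u
  define G where "G u = 1 / (N * sin (u/2))" for u
  define F' where "F' u = - (cos (N/2 * u) * cos (u/2)) / (2 * N * (sin (u/2))\<^sup>2)" for u
  define G' where "G' u = - cos (u/2) / (2 * N * (sin (u/2))\<^sup>2)" for u
  have s: "sin (u/2) > 0" if "x \<le> u" "u \<le> pi" for u
    using that x by (intro sin_gt_zero) auto
  have c: "cos (u/2) \<ge> 0" if "x \<le> u" "u \<le> pi" for u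
    using that x by (intro cos_ge_zero) auto
  have dS: "(sawtooth_sum n has_real_derivative (\<Sum>k=1..n. cos (real k * u))) (at u)" for u
    unfolding sawtooth_sum_def by (auto intro!: derivative_eq_intros sum.cong)
  have dF: "(F has_real_derivative F' u) (at u)" if u: "x \<le> u" "u \<le> pi" for u
  proof -
    have su: "sin (u/2) \<noteq> 0" using s[OF u] by simp
    have sum: "(\<Sum>k=1..n. cos (real k * u)) = (sin (N/2 * u) - sin (u/2)) / (2 * sin (u/2))"
      using sum_cos_closed_form[of u n] su by (simp add: N_def field_simps)
    have "(F has_real_derivative ((\<Sum>k=1..n. cos (real k * u)) + 1/2
        + ((- sin (N/2 * u) * (N/2)) * (N * sin (u/2)) - cos (N/2 * u) * (N * (cos (u/2) / 2)))
          / (N * sin (u/2) * (N * sin (u/2))))) (at u)"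
      unfolding F_def
      by (rule derivative_eq_intros dS refl | use su N in \<open>simp add: field_simps\<close>)+
    also have "(\<Sum>k=1..n. cos (real k * u)) + 1/2
        + ((- sin (N/2 * u) * (N/2)) * (N * sin (u/2)) - cos (N/2 * u) * (N * (cos (u/2) / 2)))
          / (N * sin (u/2) * (N * sin (u/2))) = F' u"
      unfolding sum F'_def using su N by (simp add: field_simps power2_eq_square)
    finally show ?thesis .
  qed
  have dG: "(G has_real_derivative G' u) (at u)" if u: "x \<le> u" "u \<le> pi" for u
  proof -
    have su: "sin (u/2) \<noteq> 0" using s[OF u] by simp
    show ?thesis unfolding G_def G'_def
      by (rule derivative_eq_intros refl | use su N in \<open>simp add: field_simps power2_eq_square\<close>)+
  qed
  have FG: "\<bar>F' u\<bar> \<le> - G' u" if u: "x \<le> u" "u \<le> pi" for u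
  proof -
    have "\<bar>F' u\<bar> = \<bar>cos (N/2 * u)\<bar> * cos (u/2) / (2 * N * (sin (u/2))\<^sup>2)"
      using c[OF u] N by (simp add: F'_def abs_mult)
    also have "\<dots> \<le> 1 * cos (u/2) / (2 * N * (sin (u/2))\<^sup>2)"
      using c[OF u] N by (intro divide_right_mono mult_right_mono) auto
    finally show ?thesis by (simp add: G'_def)
  qed
  have "sawtooth_sum n pi = 0" by (auto simp: sawtooth_sum_def intro!: sum.neutral)
  moreover have "cos (N/2 * pi) = 0"
  proof -
    have "N/2 * pi = pi/2 + real n * pi" by (simp add: N_def field_simps)
    then show ?thesis by (simp only: cos_add) simp
  qed
  ultimately have Fpi: "F pi = 0" by (simp add: F_def)
  have "F x + G x \<ge> F pi + G pi"
  proof (rule DERIV_nonpos_imp_nonincreasing[of x pi "\<lambda>u. F u + G u"])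
    fix u assume "x \<le> u" "u \<le> pi"
    then show "\<exists>y. ((\<lambda>u. F u + G u) has_real_derivative y) (at u) \<and> y \<le> 0"
      using dF[of u] dG[of u] FG[of u] by (intro exI[of _ "F' u + G' u"]) (auto intro!: DERIV_add)
  qed (use x in auto)
  moreover have "G x - F x \<ge> G pi - F pi"
  proof (rule DERIV_nonpos_imp_nonincreasing[of x pi "\<lambda>u. G u - F u"])
    fix u assume "x \<le> u" "u \<le> pi"
    then show "\<exists>y. ((\<lambda>u. G u - F u) has_real_derivative y) (at u) \<and> y \<le> 0"
      using dF[of u] dG[of u] FG[of u] by (intro exI[of _ "G' u - F' u"]) (auto intro!: DERIV_diff)
  qed (use x in auto)
  moreover have "G pi \<ge> 0" using N by (simp add: G_def)
  ultimately have "\<bar>F x\<bar> \<le> G x" using Fpi by linarith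
  moreover have "\<bar>cos (N/2 * x) / (N * sin (x/2))\<bar> \<le> G x"
    using s[of x] x N by (simp add: G_def divide_right_mono)
  moreover have "sawtooth_sum n x - (pi - x) / 2 = F x - cos (N/2 * x) / (N * sin (x/2))"
    by (simp add: F_def)
  ultimately have "\<bar>sawtooth_sum n x - (pi - x) / 2\<bar> \<le> 2 * G x" by linarith
  then show ?thesis by (simp add: G_def N_def)
qed

lemma sawtooth_sum_minus: "sawtooth_sum n (- x) = - sawtooth_sum n x"
  by (simp add: sawtooth_sum_def sum_negf)

lemma sawtooth_sum_reflect: "sawtooth_sum n (2 * pi - x) = - sawtooth_sum n x"
proof -
  have "sin (real k * (2 * pi - x)) = - sin (real k * x)" for k
  proof -
    have "real k * (2 * pi - x) = - (real k * x) + real k * (2 * pi)" by (simp add: algebra_simps)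
    also have "sin \<dots> = sin (- (real k * x))"
      using sin.plus_of_nat[of "- (real k * x)" k] by simp
    finally show ?thesis by simp
  qed
  then show ?thesis by (simp add: sawtooth_sum_def sum_negf)
qed

lemma sawtooth_sum_error:
  fixes x :: real
  assumes x: "0 < x" "x < 2 * pi"
  shows "\<bar>sawtooth_sum n x - (pi - x) / 2\<bar> \<le> 2 / ((2 * real n + 1) * sin (x/2))"
proof (cases "x \<le> pi")
  case False
  have "\<bar>sawtooth_sum n (2*pi - x) - (pi - (2*pi - x)) / 2\<bar> \<le> 2 / ((2 * real n + 1) * sin ((2*pi - x)/2))"
    by (rule sawtooth_sum_error_half) (use False x in auto)
  moreover have "sin ((2*pi - x)/2) = sin (x/2)"
    using sin_pi_minus[of "x/2"] by (simp add: diff_divide_distrib)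
  moreover have "sawtooth_sum n (2*pi - x) - (pi - (2*pi - x)) / 2 = - (sawtooth_sum n x - (pi - x) / 2)"
    unfolding sawtooth_sum_reflect by (simp add: field_simps)
  ultimately show ?thesis by (simp only: abs_minus_cancel)
qed (use sawtooth_sum_error_half x in auto)

lemma sawtooth_sum_tendsto:
  fixes x :: real
  assumes x: "0 < x" "x < 2 * pi"
  shows "(\<lambda>n. sawtooth_sum n x) \<longlonglongrightarrow> (pi - x) / 2"
proof -
  have s: "sin (x/2) > 0" using x by (intro sin_gt_zero) auto
  have "(\<lambda>n. 2 / ((2 * real n + 1) * sin (x/2))) \<longlonglongrightarrow> 0"
    using s by real_asymp
  then have "(\<lambda>n. sawtooth_sum n x - (pi - x) / 2) \<longlonglongrightarrow> 0"
    by (rule Lim_null_comparison[rotated]) (use sawtooth_sum_error[OF x] in auto)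
  then show ?thesis by (rule LIM_zero_cancel)
qed

text \<open>Near the jump the error estimate is useless, but there each term is at most \<open>x\<close>, so that the
  first \<open>n\<close> terms contribute at most \<open>1\<close> when \<open>x \<le> 1 / n\<close>.\<close>

lemma sawtooth_sum_bound_half:
  fixes x :: real
  assumes x: "0 < x" "x \<le> pi"
  shows "\<bar>sawtooth_sum n x\<bar> \<le> 2 * pi"
proof (cases "real n * x \<le> 1")
  case True
  have "\<bar>sawtooth_sum n x\<bar> \<le> (\<Sum>k=1..n. \<bar>sin (real k * x) / real k\<bar>)"
    unfolding sawtooth_sum_def by (rule sum_abs)
  also have "\<dots> \<le> (\<Sum>k=1..n. x)"
  proof (rule sum_mono)
    fix k assume "k \<in> {1..n}"
    then have "k > 0" by auto
    have "\<bar>sin (real k * x)\<bar> \<le> \<bar>real k * x\<bar>" by (rule abs_sin_x_le_abs_x)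
    then show "\<bar>sin (real k * x) / real k\<bar> \<le> x" using \<open>k > 0\<close> x by (simp add: field_simps abs_mult)
  qed
  also have "\<dots> \<le> 1" using True by simp
  also have "1 \<le> 2 * pi" using pi_gt3 by simp
  finally show ?thesis .
next
  case False
  have half: "x / 4 \<le> sin (x/2)"
  proof (cases "x/2 \<le> pi/3")
    case True
    have "sin 0 - 0/2 \<le> sin (x/2) - (x/2)/2"
    proof (rule DERIV_nonneg_imp_nondecreasing[of 0 "x/2" "\<lambda>y. sin y - y/2"])
      fix y assume y: "0 \<le> y" "y \<le> x/2"
      have "cos (pi/3) \<le> cos y" using y True x by (intro cos_monotone_0_pi_le) auto
      then have "cos y \<ge> 1/2" by (simp add: cos_60)
      then show "\<exists>d. ((\<lambda>y. sin y - y/2) has_real_derivative d) (at y) \<and> 0 \<le> d"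
        by (intro exI[of _ "cos y - 1/2"]) (auto intro!: derivative_eq_intros)
    qed (use x in auto)
    then show ?thesis by simp
  next
    case False
    have "sin (pi/3) \<le> sin (x/2)" using False x by (intro sin_monotone_2pi_le) auto
    moreover have "sin (pi/3) \<ge> 4/5"
      unfolding sin_60 using real_le_rsqrt[of "8/5" 3] by (simp add: power2_eq_square)
    moreover have "x / 4 \<le> 4/5" using x pi_less_4 pi_approx by simp
    ultimately show ?thesis by linarith
  qed
  have nx: "real n * x > 1" using False by simp
  then have "n > 0" by (cases n) auto
  have "2 / ((2 * real n + 1) * sin (x/2)) \<le> 2 / (2 * real n * (x/4))"
    using half x \<open>n > 0\<close> by (intro divide_left_mono mult_mono mult_pos_pos) auto
  also have "\<dots> = 4 / (real n * x)" by simp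
  also have "\<dots> \<le> 4 / 1" using nx by (intro divide_left_mono) auto
  finally have "\<bar>sawtooth_sum n x - (pi - x) / 2\<bar> \<le> 4"
    using sawtooth_sum_error_half[OF x, of n] by linarith
  moreover have "\<bar>(pi - x) / 2\<bar> \<le> pi / 2" using x by auto
  ultimately have "\<bar>sawtooth_sum n x\<bar> \<le> 4 + pi/2" by linarith
  then show ?thesis using pi_gt3 by linarith
qed

lemma sawtooth_sum_bound:
  assumes "\<bar>x\<bar> \<le> 2 * pi"
  shows "\<bar>sawtooth_sum n x\<bar> \<le> 2 * pi"
proof -
  have pos: "\<bar>sawtooth_sum n y\<bar> \<le> 2 * pi" if y: "0 \<le> y" "y \<le> 2 * pi" for y
  proof -
    have zero: "sawtooth_sum n 0 = 0" by (simp add: sawtooth_sum_def)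
    consider "y = 0" | "y = 2 * pi" | "0 < y" "y \<le> pi" | "pi < y" "y < 2 * pi" using y by linarith
    then show ?thesis
    proof cases
      case 1
      then show ?thesis using zero by simp
    next
      case 2
      then show ?thesis using zero sawtooth_sum_reflect[of n 0] by simp
    next
      case 3
      then show ?thesis by (rule sawtooth_sum_bound_half)
    next
      case 4
      then show ?thesis
        using sawtooth_sum_bound_half[of "2*pi - y" n] sawtooth_sum_reflect[of n y] by simp
    qed
  qed
  show ?thesis
    using pos[of x] pos[of "-x"] assms by (cases "x \<ge> 0") (auto simp: sawtooth_sum_minus)
qed

section \<open>Fourier series of the paths\<close>

definition sawtooth :: "real \<Rightarrow> real" where
  "sawtooth x = (if 0 < x \<and> x < 2 * pi then (pi - x) / 2
     else if - 2 * pi < x \<and> x < 0 then - (pi + x) / 2 else 0)"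

lemma sawtooth_sum_tendsto_sawtooth:
  assumes "\<bar>x\<bar> \<le> 2 * pi"
  shows "(\<lambda>n. sawtooth_sum n x) \<longlonglongrightarrow> sawtooth x"
proof -
  have zero: "sawtooth_sum n 0 = 0" "sawtooth_sum n (2 * pi) = 0" "sawtooth_sum n (- (2 * pi)) = 0" for n
  proof -
    show z: "sawtooth_sum n 0 = 0" by (simp add: sawtooth_sum_def)
    show "sawtooth_sum n (2 * pi) = 0" using sawtooth_sum_reflect[of n 0] z by simp
    then show "sawtooth_sum n (- (2 * pi)) = 0" unfolding sawtooth_sum_minus by simp
  qed
  consider "0 < x" "x < 2 * pi" | "- (2 * pi) < x" "x < 0" | "x = 0 \<or> x = 2 * pi \<or> x = - (2 * pi)"
    using assms by linarith
  then show ?thesis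
  proof cases
    case 1
    then show ?thesis using sawtooth_sum_tendsto[OF 1] by (simp add: sawtooth_def)
  next
    case 2
    have "(\<lambda>n. - sawtooth_sum n (- x)) \<longlonglongrightarrow> - ((pi - (- x)) / 2)"
      by (intro tendsto_minus sawtooth_sum_tendsto) (use 2 in auto)
    moreover have "sawtooth x = - ((pi - (- x)) / 2)" using 2 by (simp add: sawtooth_def field_simps)
    ultimately show ?thesis by (simp add: sawtooth_sum_minus)
  next
    case 3
    then have "sawtooth x = 0" "\<And>n. sawtooth_sum n x = 0" using zero by (auto simp: sawtooth_def)
    then show ?thesis by simp
  qed
qed

text \<open>The kernel of the partial sum: as the Fourier coefficients are integrals against \<open>\<mu>\<close>, the
  \<open>n\<close>-th partial sum at \<open>t\<close> is the integral of this function over \<open>(0, 2\<pi>]\<close>.\<close>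

definition fourier_kernel :: "nat \<Rightarrow> real \<Rightarrow> real \<Rightarrow> real" where
  "fourier_kernel n t s = 1 - s / (2 * pi) + (sawtooth_sum n (t - s) - sawtooth_sum n t) / pi"

lemma fourier_kernel_eq:
  "fourier_kernel n t s = 1 + (- 1 / (2 * pi)) * s +
    (\<Sum>k=1..n. - (1 / (real k * pi)) * cos (real k * t) * sin (real k * s)
      + 1 / (real k * pi) * sin (real k * t) * (cos (real k * s) - 1))"
proof -
  have "(sawtooth_sum n (t - s) - sawtooth_sum n t) / pi
      = (\<Sum>k=1..n. (sin (real k * (t - s)) / real k - sin (real k * t) / real k) / pi)"
    by (simp only: sawtooth_sum_def sum_subtractf[symmetric] sum_divide_distrib)
  also have "\<dots> = (\<Sum>k=1..n. - (1 / (real k * pi)) * cos (real k * t) * sin (real k * s)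
      + 1 / (real k * pi) * sin (real k * t) * (cos (real k * s) - 1))"
    by (intro sum.cong refl) (simp add: right_diff_distrib sin_diff field_simps)
  finally show ?thesis by (simp add: fourier_kernel_def)
qed

lemma fourier_kernel_bound:
  assumes "0 \<le> s" "s \<le> 2 * pi" "0 \<le> t" "t \<le> 2 * pi"
  shows "\<bar>fourier_kernel n t s\<bar> \<le> 5"
proof -
  have "\<bar>1 - s / (2 * pi)\<bar> \<le> 1" using assms by (simp add: abs_le_iff field_simps)
  moreover have "\<bar>sawtooth_sum n (t - s)\<bar> \<le> 2 * pi" "\<bar>sawtooth_sum n t\<bar> \<le> 2 * pi"
    using assms by (auto intro!: sawtooth_sum_bound)
  then have "\<bar>sawtooth_sum n (t - s) - sawtooth_sum n t\<bar> \<le> 4 * pi" by linarith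
  then have "\<bar>(sawtooth_sum n (t - s) - sawtooth_sum n t) / pi\<bar> \<le> 4" by (simp add: field_simps)
  ultimately show ?thesis unfolding fourier_kernel_def by linarith
qed

lemma fourier_kernel_tendsto:
  assumes s: "0 < s" "s \<le> 2 * pi" and t: "0 < t" "t < 2 * pi"
  shows "(\<lambda>n. fourier_kernel n t s) \<longlonglongrightarrow> 1 * indicator {0<..<t} s + 1/2 * indicator {t} s"
proof -
  have "(\<lambda>n. fourier_kernel n t s) \<longlonglongrightarrow> 1 - s / (2 * pi) + (sawtooth (t - s) - sawtooth t) / pi"
    unfolding fourier_kernel_def
    by (intro tendsto_intros sawtooth_sum_tendsto_sawtooth) (use s t in auto)
  also have "1 - s / (2 * pi) + (sawtooth (t - s) - sawtooth t) / pi
      = 1 * indicator {0<..<t} s + 1/2 * indicator {t} s"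
    using s t by (cases s t rule: linorder_cases) (auto simp: sawtooth_def indicator_def field_simps)
  finally show ?thesis .
qed

lemma fourier_kernel_0_tendsto:
  assumes s: "0 < s" "s \<le> 2 * pi"
  shows "(\<lambda>n. fourier_kernel n 0 s) \<longlonglongrightarrow> 1/2 * indicator {0<..<2 * pi} s + 0 * indicator {2 * pi} s"
proof -
  have "(\<lambda>n. fourier_kernel n 0 s) \<longlonglongrightarrow> 1 - s / (2 * pi) + (sawtooth (0 - s) - sawtooth 0) / pi"
    unfolding fourier_kernel_def
    by (intro tendsto_intros sawtooth_sum_tendsto_sawtooth) (use s in auto)
  also have "1 - s / (2 * pi) + (sawtooth (0 - s) - sawtooth 0) / pi
      = 1/2 * indicator {0<..<2 * pi} s + 0 * indicator {2 * pi} s"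
    using s by (cases "s = 2 * pi") (auto simp: sawtooth_def indicator_def field_simps)
  finally show ?thesis .
qed

text \<open>Bounded functions satisfy the exponential integrability condition with respect to any finite measure,
  and the kernels of the partial sums are bounded.\<close>

locale continuous_stochastic_measure = stochastic_measure_space M borel_0_2pi \<mu>
  for M :: "'a measure" and \<mu> :: "real set \<Rightarrow> 'a \<Rightarrow> real" +
  assumes bounded_integrable: "\<And>g C. g \<in> borel_measurable borel_0_2pi \<Longrightarrow>
      (\<And>x. x \<in> space borel_0_2pi \<Longrightarrow> \<bar>g x\<bar> \<le> C) \<Longrightarrow> sm_integrable M borel_0_2pi \<mu> g"
    and continuous_paths: "AE \<omega> in M. continuous_on {0..2 * pi} (\<lambda>t. \<mu> {0<..t} \<omega>)"
begin

lemma indefinite_integral_fourier_kernel: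
  shows "\<exists>N. indefinite_integral (fourier_kernel n t) N \<and> N {0<..2 * pi} = sm_fourier_sum M \<mu> n t"
proof -
  let ?A = "{0<..2 * pi}"
  have sp: "space borel_0_2pi = {0..2 * pi}" by (simp add: space_restrict_space)
  have A: "?A \<in> sets borel_0_2pi" by (auto simp: sets_restrict_space_iff)
  have meas: "g \<in> borel_measurable borel_0_2pi" if "g \<in> borel_measurable borel" for g :: "real \<Rightarrow> real"
    using that by (rule measurable_restrict_space1)
  have id: "sm_integrable M borel_0_2pi \<mu> (\<lambda>s. s)"
    by (rule bounded_integrable[of _ "2 * pi"]) (auto intro!: meas simp: sp)
  have "sm_integrable M borel_0_2pi \<mu> (\<lambda>s. sin (real k * s))" for k
    by (rule bounded_integrable[of _ 1]) (auto intro!: meas)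
  then have "\<exists>N. indefinite_integral (\<lambda>s. sin (real k * s)) N
      \<and> N ?A = sm_integral M borel_0_2pi \<mu> ?A (\<lambda>s. sin (real k * s))" for k
    by (rule indefinite_integral_sm_integral[OF _ A])
  then obtain N_sin where N_sin: "\<And>k. indefinite_integral (\<lambda>s. sin (real k * s)) (N_sin k)"
    "\<And>k. N_sin k ?A = sm_integral M borel_0_2pi \<mu> ?A (\<lambda>s. sin (real k * s))" by metis
  have "\<bar>cos y - 1\<bar> \<le> 2" for y :: real using cos_ge_minus_one[of y] cos_le_one[of y] by linarith
  then have "sm_integrable M borel_0_2pi \<mu> (\<lambda>s. cos (real k * s) - 1)" for k
    by (intro bounded_integrable[of _ 2]) (auto intro!: meas)
  then have "\<exists>N. indefinite_integral (\<lambda>s. cos (real k * s) - 1) N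
      \<and> N ?A = sm_integral M borel_0_2pi \<mu> ?A (\<lambda>s. cos (real k * s) - 1)" for k
    by (rule indefinite_integral_sm_integral[OF _ A])
  then obtain N_cos where N_cos: "\<And>k. indefinite_integral (\<lambda>s. cos (real k * s) - 1) (N_cos k)"
    "\<And>k. N_cos k ?A = sm_integral M borel_0_2pi \<mu> ?A (\<lambda>s. cos (real k * s) - 1)" by metis
  obtain N_id where N_id: "indefinite_integral (\<lambda>s. s) N_id" "N_id ?A = sm_integral M borel_0_2pi \<mu> ?A (\<lambda>s. s)"
    using indefinite_integral_sm_integral[OF id A] by blast
  define N where "N B \<omega> = \<mu> B \<omega> + (- 1 / (2 * pi)) * N_id B \<omega> +
    (\<Sum>k=1..n. - (1 / (real k * pi)) * cos (real k * t) * N_sin k B \<omega>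
      + 1 / (real k * pi) * sin (real k * t) * N_cos k B \<omega>)" for B \<omega>
  have "indefinite_integral (fourier_kernel n t) N"
    unfolding fourier_kernel_eq[abs_def] N_def[abs_def]
    by (intro indefinite_integral_add indefinite_integral_sum indefinite_integral_cmult indefinite_integral_one N_id N_sin N_cos)
  moreover have "N ?A = sm_fourier_sum M \<mu> n t"
  proof
    fix \<omega>
    have "N ?A \<omega> = sm_xi M \<mu> 0 \<omega> / 2 +
      (\<Sum>k=1..n. sm_xi M \<mu> k \<omega> * cos (real k * t) + sm_eta M \<mu> k \<omega> * sin (real k * t))"
      unfolding N_def N_id N_sin N_cos
      by (intro arg_cong2[where f = "(+)"] sum.cong) (auto simp: sm_xi_def sm_eta_def field_simps)
    then show "N ?A \<omega> = sm_fourier_sum M \<mu> n t \<omega>" by (simp add: sm_fourier_sum_def)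
  qed
  ultimately show ?thesis by blast
qed

text \<open>Left-continuity of the paths at \<open>t\<close> excludes an atom of \<open>\<mu>\<close> at \<open>t\<close>.\<close>

lemma sm_singleton_eq_0:
  assumes t: "0 < t" "t \<le> 2 * pi"
  shows "AE \<omega> in M. \<mu> {0<..<t} \<omega> = \<mu> {0<..t} \<omega>" and "AE \<omega> in M. \<mu> {t} \<omega> = 0"
proof -
  define r where "r n = t - t / real (Suc n)" for n
  have r: "0 \<le> r n" "r n < t" for n using t by (auto simp: r_def field_simps)
  have r_le: "r n \<le> 2 * pi" for n using r(2)[of n] t by simp
  have r_lim: "r \<longlonglongrightarrow> t"
  proof -
    have "(\<lambda>n. t - t / real (Suc n)) \<longlonglongrightarrow> t - 0"
      by (intro tendsto_diff tendsto_const LIMSEQ_Suc lim_const_over_n)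
    then show ?thesis by (simp add: r_def[abs_def])
  qed
  have r_mono: "r m \<le> r n" if "m \<le> n" for m n
    using t that by (auto simp: r_def intro!: divide_left_mono)
  have s1[measurable]: "{0<..r n} \<in> sets borel_0_2pi" for n
    using r_le[of n] by (subst sets_restrict_space_iff) auto
  have s2[measurable]: "{0<..<t} \<in> sets borel_0_2pi" "{0<..t} \<in> sets borel_0_2pi" "{t} \<in> sets borel_0_2pi"
    using t by (auto simp: sets_restrict_space_iff)
  have "tendsto_in_prob M (\<lambda>n. \<mu> {0<..r n}) (\<mu> (\<Union>n. {0<..r n}))"
  proof (rule sm_incseq)
    show "incseq (\<lambda>n. {0<..r n})" unfolding incseq_def using r_mono by force
  qed (use s1 in blast)
  also have "(\<Union>n. {0<..r n}) = {0<..<t}"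
  proof (intro equalityI subsetI)
    fix x assume x: "x \<in> {0<..<t}"
    then obtain n where "x < r n"
      using order_tendstoD(1)[OF r_lim, of x] by (auto simp: eventually_sequentially)
    then show "x \<in> (\<Union>n. {0<..r n})" using x by (auto intro: less_imp_le)
  qed (use r(2) in \<open>force intro: le_less_trans\<close>)
  finally have lim1: "tendsto_in_prob M (\<lambda>n. \<mu> {0<..r n}) (\<mu> {0<..<t})" .
  have "tendsto_in_prob M (\<lambda>n. \<mu> {0<..r n}) (\<mu> {0<..t})"
  proof (rule tendsto_in_prob_AE)
    show "AE \<omega> in M. (\<lambda>n. \<mu> {0<..r n} \<omega>) \<longlonglongrightarrow> \<mu> {0<..t} \<omega>"
      using continuous_paths
    proof eventually_elim
      case (elim \<omega>)
      show ?case
        by (rule continuous_on_tendsto_compose[OF elim r_lim]) (use t r r_le in auto)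
    qed
  qed auto
  then show eq: "AE \<omega> in M. \<mu> {0<..<t} \<omega> = \<mu> {0<..t} \<omega>"
    by (intro tendsto_in_prob_unique[OF _ _ _ lim1]) auto
  have "{0<..t} = {0<..<t} \<union> {t}" using t by auto
  then have "AE \<omega> in M. \<mu> {0<..t} \<omega> = \<mu> {0<..<t} \<omega> + \<mu> {t} \<omega>"
    using sm_Un[OF s2(1,3)] by simp
  then show "AE \<omega> in M. \<mu> {t} \<omega> = 0" using eq by eventually_elim simp
qed

text \<open>For \<open>0 < t < 2\<pi>\<close> the kernels jump at \<open>u = t\<close> in the limit; for \<open>t = 0\<close> their limit
  is \<open>1/2\<close> up to \<open>u = 2\<pi>\<close>, which averages the two sides of the jump of the periodically continued path.\<close>

lemma fourier_sum_tendsto: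
  assumes t: "0 \<le> t" "t \<le> 2 * pi" and u: "0 < u" "u \<le> 2 * pi"
    and lim: "\<And>s. 0 < s \<Longrightarrow> s \<le> 2 * pi \<Longrightarrow>
      (\<lambda>n. fourier_kernel n t s) \<longlonglongrightarrow> a * indicator {0<..<u} s + b * indicator {u} s"
  shows "tendsto_in_prob M (\<lambda>n. sm_fourier_sum M \<mu> n t) (\<lambda>\<omega>. a * \<mu> {0<..u} \<omega>)"
proof -
  let ?A = "{0<..2 * pi}"
  let ?h = "\<lambda>s. a * indicator {0<..<u} s + b * indicator {u} s :: real"
  have sets[measurable]: "?A \<in> sets borel_0_2pi" "{0<..<u} \<in> sets borel_0_2pi" "{u} \<in> sets borel_0_2pi" "{0<..u} \<in> sets borel_0_2pi"
    using u by (auto simp: sets_restrict_space_iff)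
  have "\<forall>n. \<exists>N. indefinite_integral (fourier_kernel n t) N \<and> N ?A = sm_fourier_sum M \<mu> n t"
    using indefinite_integral_fourier_kernel by blast
  from choice[OF this] obtain N where N: "\<And>n. indefinite_integral (fourier_kernel n t) (N n)"
    "\<And>n. N n ?A = sm_fourier_sum M \<mu> n t"
    by blast
  define L where "L B \<omega> = a * \<mu> (B \<inter> {0<..<u}) \<omega> + b * \<mu> (B \<inter> {u}) \<omega>" for B \<omega>
  have L: "indefinite_integral ?h L"
    unfolding L_def[abs_def]
    by (intro indefinite_integral_add indefinite_integral_cmult indefinite_integral_indicator sets)
  have "indefinite_integral (\<lambda>s. fourier_kernel n t s + (- 1) * ?h s) (\<lambda>B \<omega>. N n B \<omega> + (- 1) * L B \<omega>)" for n
    by (intro indefinite_integral_add indefinite_integral_cmult N L)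
  then have lim0: "tendsto_in_prob M (\<lambda>n \<omega>. N n ?A \<omega> + (- 1) * L ?A \<omega>) (\<lambda>\<omega>. 0)"
  proof (rule bounded_convergence[OF _ sets(1), where C = "5 + \<bar>a\<bar> + \<bar>b\<bar>"])
    fix s assume s: "s \<in> ?A"
    have "(\<lambda>n. fourier_kernel n t s + (- 1) * ?h s) \<longlonglongrightarrow> ?h s + (- 1) * ?h s"
      using s by (intro tendsto_intros lim) auto
    then show "(\<lambda>n. fourier_kernel n t s + (- 1) * ?h s) \<longlonglongrightarrow> 0" by simp
    fix n
    have "\<bar>fourier_kernel n t s\<bar> \<le> 5" using s t by (intro fourier_kernel_bound) auto
    moreover have "\<bar>?h s\<bar> \<le> \<bar>a\<bar> + \<bar>b\<bar>" by (auto simp: indicator_def)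
    moreover have "\<bar>y + (- 1) * z\<bar> \<le> \<bar>y\<bar> + \<bar>z\<bar>" for y z :: real by simp
    from this[of "fourier_kernel n t s" "?h s"]
    have "\<bar>fourier_kernel n t s + (- 1) * ?h s\<bar> \<le> \<bar>fourier_kernel n t s\<bar> + \<bar>?h s\<bar>" .
    ultimately show "\<bar>fourier_kernel n t s + (- 1) * ?h s\<bar> \<le> 5 + \<bar>a\<bar> + \<bar>b\<bar>" by linarith
  qed
  have [measurable]: "N n ?A \<in> borel_measurable M" "L ?A \<in> borel_measurable M" for n
    using indefinite_integral_measurable[OF N(1)] indefinite_integral_measurable[OF L] sets by auto
  have lim1: "tendsto_in_prob M (\<lambda>n. N n ?A) (L ?A)"
    using lim0 unfolding tendsto_in_prob_def by simp
  have "AE \<omega> in M. L ?A \<omega> = a * \<mu> {0<..u} \<omega>"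
    using sm_singleton_eq_0[OF u]
  proof eventually_elim
    case (elim \<omega>)
    have "?A \<inter> {0<..<u} = {0<..<u}" "?A \<inter> {u} = {u}" using u by auto
    then show ?case using elim by (simp add: L_def)
  qed
  then have "tendsto_in_prob M (\<lambda>n. N n ?A) (\<lambda>\<omega>. a * \<mu> {0<..u} \<omega>)"
    using lim1 by (subst tendsto_in_prob_cong_AE[where Y' = "\<lambda>n. N n ?A" and Z' = "L ?A"]) (auto elim!: eventually_mono)
  then show ?thesis unfolding N .
qed

end

theorem theorem3:
  fixes M :: "'a measure"
    and \<mu> :: "real set \<Rightarrow> 'a \<Rightarrow> real"
    and m :: "real measure"
  assumes "prob_space M" and "complete_measure M"
    and "stochastic_measure M borel_0_2pi \<mu>"
    and "finite_measure m" and "sets m = sets borel_0_2pi"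
    and "\<And>g :: real \<Rightarrow> real. g \<in> borel_measurable borel_0_2pi \<Longrightarrow>
           (\<forall>l>0. (\<integral>\<^sup>+x. ennreal (2 powr (l * \<bar>g x\<bar>)) \<partial>m) < \<infinity>) \<Longrightarrow>
           sm_integrable M borel_0_2pi \<mu> g"
    and "AE \<omega> in M. continuous_on {0..2 * pi} (\<lambda>t. \<mu> {0<..t} \<omega>)"
  shows "(\<forall>t\<in>{0<..<2 * pi}. tendsto_in_prob M (\<lambda>n. sm_fourier_sum M \<mu> n t) (\<mu> {0<..t})) \<and>
         (\<forall>n. sm_fourier_sum M \<mu> n 0 = sm_fourier_sum M \<mu> n (2 * pi)) \<and>
         tendsto_in_prob M (\<lambda>n. sm_fourier_sum M \<mu> n 0) (\<lambda>\<omega>. \<mu> {0<..2 * pi} \<omega> / 2)"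
proof -
  have sp: "stochastic_measure_space M borel_0_2pi \<mu>"
    using assms(1,3) by (simp add: stochastic_measure_space_def stochastic_measure_space_axioms_def)
  have space_m: "space m = space borel_0_2pi" by (rule sets_eq_imp_space_eq[OF assms(5)])
  have int: "sm_integrable M borel_0_2pi \<mu> g"
    if g: "g \<in> borel_measurable borel_0_2pi" "\<And>x. x \<in> space borel_0_2pi \<Longrightarrow> \<bar>g x\<bar> \<le> C" for g C
  proof (rule assms(6)[OF g(1)], intro allI impI)
    fix l :: real assume "l > 0"
    have "(\<integral>\<^sup>+x. ennreal (2 powr (l * \<bar>g x\<bar>)) \<partial>m) \<le> (\<integral>\<^sup>+x. ennreal (2 powr (l * C)) \<partial>m)"
      using g(2) \<open>l > 0\<close> by (intro nn_integral_mono ennreal_leI powr_mono mult_left_mono) (auto simp: space_m)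
    also have "\<dots> = ennreal (2 powr (l * C)) * emeasure m (space m)" by (rule nn_integral_const)
    also have "\<dots> < \<infinity>"
      using finite_measure.emeasure_finite[OF assms(4)]
      by (simp add: ennreal_mult_less_top less_top)
    finally show "(\<integral>\<^sup>+x. ennreal (2 powr (l * \<bar>g x\<bar>)) \<partial>m) < \<infinity>" .
  qed
  interpret continuous_stochastic_measure M \<mu>
    by (rule continuous_stochastic_measure.intro[OF sp continuous_stochastic_measure_axioms.intro[OF int assms(7)]])
  have "tendsto_in_prob M (\<lambda>n. sm_fourier_sum M \<mu> n t) (\<mu> {0<..t})" if t: "t \<in> {0<..<2 * pi}" for t
    using fourier_sum_tendsto[of t t 1 "1/2"] fourier_kernel_tendsto t by simp
  moreover have "sm_fourier_sum M \<mu> n 0 = sm_fourier_sum M \<mu> n (2 * pi)" for n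
  proof -
    have "cos (real k * (2 * pi)) = 1" "sin (real k * (2 * pi)) = 0" for k
      using cos.plus_of_nat[of "0::real" k] sin.plus_of_nat[of "0::real" k] by simp_all
    then show ?thesis by (simp add: sm_fourier_sum_def)
  qed
  moreover have "tendsto_in_prob M (\<lambda>n. sm_fourier_sum M \<mu> n 0) (\<lambda>\<omega>. \<mu> {0<..2 * pi} \<omega> / 2)"
    using fourier_sum_tendsto[of 0 "2 * pi" "1/2" 0] fourier_kernel_0_tendsto by simp
  ultimately show ?thesis by blast
qed

end
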